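(* Let $p>7$ be a prime and let $P$ be a partial latin square of order $p$ of the form \[ P=\{(i,c+i,s+i),\ (i,c'+i,s'+i),\ (i,c''+i,s''+i)\mid 0\le i<p\} \] for some distinct $c,c',c''$ and some distinct $s,s',s''$ (all arithmetic mod $p$). Then $P$ can be completed to a diagonally cyclic latin square of order $p$.
   Context: Triples $(r,t,u)$ denote symbol $u$ in row $r$, column $t$, with rows, columns and symbols in $\{0,\dots,p-1\}$. A latin square with operation $\circ$ of odd order $n$ is diagonally cyclic if $i\circ j=k$ implies $(i+1)\circ(j+1)=k+1$ for all cells. Completing $P$ means finding a latin square containing $P$ as a set of triples. *)

theory Defs
  imports "HOL-Computational_Algebra.Primes"
begin

text \<open>Triples (r,t,u): symbol u in row r, column t; all entries in {0..<n}.\<close>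

definition partial_latin_square :: "nat \<Rightarrow> (nat \<times> nat \<times> nat) set \<Rightarrow> bool" where
  "partial_latin_square n P \<longleftrightarrow>
     P \<subseteq> {..<n} \<times> {..<n} \<times> {..<n} \<and>
     (\<forall>(r,t,u)\<in>P. \<forall>(r',t',u')\<in>P.
        (r = r' \<and> t = t' \<longrightarrow> u = u') \<and>
        (r = r' \<and> u = u' \<longrightarrow> t = t') \<and>
        (t = t' \<and> u = u' \<longrightarrow> r = r'))"

definition latin_square :: "nat \<Rightarrow> (nat \<times> nat \<times> nat) set \<Rightarrow> bool" where
  "latin_square n L \<longleftrightarrow> partial_latin_square n L \<and>
     (\<forall>r<n. \<forall>t<n. \<exists>u. (r,t,u) \<in> L)"

definition diagonally_cyclic :: "nat \<Rightarrow> (nat \<times> nat \<times> nat) set \<Rightarrow> bool" where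
  "diagonally_cyclic n L \<longleftrightarrow>
     (\<forall>(i,j,k)\<in>L. ((i+1) mod n, (j+1) mod n, (k+1) mod n) \<in> L)"

end

theory Submission
  imports Defs
    Complex_Main
    "Berlekamp_Zassenhaus.Finite_Field"
    "HOL-Computational_Algebra.Polynomial_Factorial"
    "HOL-Number_Theory.Euler_Criterion"
begin

text \<open>
  A diagonally cyclic latin square of order \<open>p\<close> is the same as an orthomorphism of \<open>\<int>/p\<close>, that is, a
  map \<open>f\<close> for which \<open>f\<close> and \<open>x \<mapsto> f x - x\<close> are bijective: cell \<open>(i, i + d)\<close> contains \<open>i + f d\<close>. So we need
  an orthomorphism through three given points \<open>A, B, C\<close> no two of which share \<open>x\<close>, \<open>y\<close> or \<open>y - x\<close>. If
  they are collinear a linear map does it. Otherwise let \<open>a, b, c\<close> be the slopes of \<open>BC, CA, AB\<close>; up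
  to translation and scaling the triangle is determined by them. The map with slope \<open>s\<close> on the
  nonzero squares and slope \<open>c\<close> elsewhere is an orthomorphism when \<open>s/c\<close> and \<open>(s-1)/(c-1)\<close> are
  squares, and it contains such a triangle, with \<open>A, B\<close> on the line of slope \<open>c\<close> through the centre,
  as soon as \<open>(s-a)/(c-a)\<close> and \<open>(s-b)/(c-b)\<close> are non-squares.

  For \<open>p \<ge> 149\<close> such an \<open>s\<close> exists because the character sums that count the solutions involve only
  products of at most four linear factors, and Hasse's bound \<open>2 \<surd>p\<close> applies to them. Hasse's bound
  is proved by Manin's elementary method: on the twist \<open>f(t) Y\<^sup>2 = f(X)\<close> over \<open>F\<^sub>p(t)\<close> the heights of the
  points \<open>(t\<^sup>p, f(t)\<^bsup>(p-1)/2\<^esup>) + n (t, \<plusminus>1)\<close> form a quadratic polynomial in \<open>n\<close>, which is never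
  negative. For the primes below 149 the existence of \<open>s\<close> (for one of the three choices of the
  distinguished slope, and up to the symmetries \<open>m \<mapsto> 1 - m\<close>, \<open>m \<mapsto> 1/m\<close> of the slopes) is checked by
  evaluation, except for a few triples with \<open>p \<le> 41\<close>, for which an orthomorphism is given explicitly.
\<close>

section \<open>Heights of rational functions\<close>

definition reduced :: "'a::field_gcd poly fract \<Rightarrow> 'a poly \<Rightarrow> 'a poly \<Rightarrow> bool" where
  "reduced X A B \<longleftrightarrow> coprime A B \<and> B \<noteq> 0 \<and> X = to_fract A / to_fract B"

text \<open>The logarithmic Weil height over the function field, that is, the degree of
  \<open>X\<close> as a self-map of the projective line.\<close>

definition height :: "'a::field_gcd poly fract \<Rightarrow> nat" where
  "height X = max (degree (fst (quot_of_fract X))) (degree (snd (quot_of_fract X)))"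

lemma reduced_quot_of_fract: "reduced X (fst (quot_of_fract X)) (snd (quot_of_fract X))"
  unfolding reduced_def using coprime_quot_of_fract[of X] Fract_quot_of_fract[of X]
  by (auto simp: Fract_conv_to_fract[symmetric])

section \<open>Gauss's lemma and the heights of the roots of a quadratic\<close>

lemma coprime_if_no_prime_dvd:
  fixes A B :: "'a::field_gcd poly"
  assumes "B \<noteq> 0" "\<And>q. prime_elem q \<Longrightarrow> q dvd A \<Longrightarrow> q dvd B \<Longrightarrow> False"
  shows "coprime A B"
proof (rule ccontr)
  assume "\<not> coprime A B"
  then have "\<not> is_unit (gcd A B)" using is_unit_gcd by blast
  moreover have "gcd A B \<noteq> 0" using assms(1) by simp
  ultimately obtain q where "prime q" "q dvd gcd A B" using prime_divisor_exists by blast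
  then show False using assms(2)[of q] by auto
qed

lemma is_unit_if_no_prime_dvd:
  fixes d :: "'a::field_gcd poly"
  assumes "d \<noteq> 0" "\<And>q. prime_elem q \<Longrightarrow> q dvd d \<Longrightarrow> False"
  shows "is_unit d"
  using assms prime_divisor_exists[of d] by blast

text \<open>The three polynomials are the coefficients of \<open>(A1 Z + B1) (A2 Z + B2)\<close>,
  and this is Gauss's lemma at the infinite place: the coefficients of degree \<open>?h1\<close> and
  \<open>?h2\<close> form two nonzero linear forms over the field, so their product is
  nonzero.\<close>

lemma max_degree_product:
  fixes A1 A2 B1 B2 :: "'a::field poly"
  assumes "A1 \<noteq> 0 \<or> B1 \<noteq> 0" "A2 \<noteq> 0 \<or> B2 \<noteq> 0"
  shows "max (degree (A1 * A2)) (max (degree (A1 * B2 + A2 * B1)) (degree (B1 * B2)))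
         = max (degree A1) (degree B1) + max (degree A2) (degree B2)" (is "?L = ?h1 + ?h2")
proof (rule antisym)
  have a: "degree A1 \<le> ?h1" "degree B1 \<le> ?h1" "degree A2 \<le> ?h2" "degree B2 \<le> ?h2" by auto
  have "degree (A1 * A2) \<le> ?h1 + ?h2" "degree (B1 * B2) \<le> ?h1 + ?h2"
    "degree (A1 * B2) \<le> ?h1 + ?h2" "degree (A2 * B1) \<le> ?h1 + ?h2"
    using a by (meson add_mono degree_mult_le order_trans, meson add_mono degree_mult_le order_trans,
      meson add_mono degree_mult_le order_trans, metis add.commute add_mono degree_mult_le order_trans)
  then show "?L \<le> ?h1 + ?h2" by (simp add: degree_add_le)
  have c: "coeff (P * Q) (m + n) = coeff P m * coeff Q n" if "degree P \<le> m" "degree Q \<le> n"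
    for P Q :: "'a poly" and m n
  proof -
    have "coeff (P * Q) (m + n) = (\<Sum>i\<le>m+n. coeff P i * coeff Q (m + n - i))" by (rule coeff_mult)
    also have "\<dots> = (\<Sum>i\<in>{m}. coeff P i * coeff Q (m + n - i))"
    proof (rule sum.mono_neutral_right)
      show "\<forall>i\<in>{..m + n} - {m}. coeff P i * coeff Q (m + n - i) = 0"
      proof
        fix i assume "i \<in> {..m + n} - {m}"
        then have "i > degree P \<or> m + n - i > degree Q" using that by auto
        then show "coeff P i * coeff Q (m + n - i) = 0" by (auto simp: coeff_eq_0)
      qed
    qed auto
    finally show ?thesis by simp
  qed
  have nz: "coeff A h \<noteq> 0 \<or> coeff B h \<noteq> 0"
    if "A \<noteq> 0 \<or> B \<noteq> 0" "h = max (degree A) (degree B)" for A B :: "'a poly" and h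
  proof (cases "degree A \<le> degree B")
    case True
    then show ?thesis using that leading_coeff_0_iff[of A] by (cases "B = 0") (auto simp: max_def)
  next
    case False
    then show ?thesis using that by (cases "A = 0") (auto simp: max_def)
  qed
  let ?h = "?h1 + ?h2"
  have "coeff (A1 * A2) ?h \<noteq> 0 \<or> coeff (A1 * B2 + A2 * B1) ?h \<noteq> 0 \<or> coeff (B1 * B2) ?h \<noteq> 0"
  proof -
    have e: "coeff (A1 * A2) ?h = coeff A1 ?h1 * coeff A2 ?h2"
      "coeff (A1 * B2 + A2 * B1) ?h = coeff A1 ?h1 * coeff B2 ?h2 + coeff B1 ?h1 * coeff A2 ?h2"
      "coeff (B1 * B2) ?h = coeff B1 ?h1 * coeff B2 ?h2"
      using c[OF a(1) a(3)] c[OF a(2) a(4)] c[OF a(1) a(4)] c[OF a(2) a(3)]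
      by (simp_all add: mult.commute[of A2 B1])
    show ?thesis unfolding e using nz[OF assms(1) refl] nz[OF assms(2) refl] by auto
  qed
  then show "?h \<le> ?L" by (metis le_degree le_max_iff_disj)
qed

text \<open>Gauss's lemma at the finite places for the same product. A prime dividing both outer
  coefficients divides, say, \<open>A1\<close> and \<open>B2\<close> but neither \<open>A2\<close>
  nor \<open>B1\<close>; then it divides only one summand of the middle coefficient.\<close>

lemma primitive_product:
  fixes A1 A2 B1 B2 :: "'a::field_gcd poly"
  assumes "coprime A1 B1" "coprime A2 B2" "B1 \<noteq> 0" "B2 \<noteq> 0"
    and "d dvd A1 * A2" "d dvd A1 * B2 + A2 * B1" "d dvd B1 * B2"
  shows "is_unit d"
proof (rule is_unit_if_no_prime_dvd)
  show "d \<noteq> 0" using assms by auto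
  fix q assume q: "prime_elem q" "q dvd d"
  have n: "\<not> (q dvd A1 \<and> q dvd B1)" "\<not> (q dvd A2 \<and> q dvd B2)"
    using assms(1,2) q(1) by (meson coprime_common_divisor prime_elem_def)+
  have d: "q dvd A1 * A2" "q dvd A1 * B2 + A2 * B1" "q dvd B1 * B2" using q assms by (meson dvd_trans)+
  then have "q dvd A1 \<or> q dvd A2" "q dvd B1 \<or> q dvd B2" using q(1) prime_elem_dvd_mult_iff by blast+
  with n consider "q dvd A1" "q dvd B2" "\<not> q dvd A2" "\<not> q dvd B1" | "q dvd A2" "q dvd B1" "\<not> q dvd A1" "\<not> q dvd B2" by auto
  then show False
  proof cases
    case 1
    then have "q dvd A2 * B1" using d(2) by (metis dvd_add_right_iff dvd_mult2)
    then show False using 1 q(1) prime_elem_dvd_mult_iff by blast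
  next
    case 2
    then have "q dvd A1 * B2" using d(2) by (metis dvd_add_left_iff dvd_mult2)
    then show False using 2 q(1) prime_elem_dvd_mult_iff by blast
  qed
qed

lemma degree_unit_mult:
  fixes P w :: "'a::field_gcd poly"
  assumes "is_unit w" shows "degree (P * w) = degree P"
  using assms by (metis degree_mult_eq is_unit_iff_degree mult_zero_left add.right_neutral not_is_unit_0)

text \<open>\<open>X1\<close> and \<open>X2\<close> are the roots of \<open>W Z^2 - V Z + U\<close>.
  Their reduced fractions give a second quadratic with these roots, primitive by Gauss's lemma. Two
  primitive quadratics with the same roots differ by a unit, and maximal degrees add.\<close>

lemma height_sum_of_roots:
  fixes U V W :: "'a::field_gcd poly"
  assumes "W \<noteq> 0" and prim: "\<And>q. prime_elem q \<Longrightarrow> q dvd U \<Longrightarrow> q dvd V \<Longrightarrow> q dvd W \<Longrightarrow> False"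
    and prod: "X1 * X2 * to_fract W = to_fract U" and sum: "(X1 + X2) * to_fract W = to_fract V"
  shows "height X1 + height X2 = max (degree U) (max (degree V) (degree W))"
proof -
  define A1 B1 A2 B2 where "A1 = fst (quot_of_fract X1)" "B1 = snd (quot_of_fract X1)"
    "A2 = fst (quot_of_fract X2)" "B2 = snd (quot_of_fract X2)"
  note defs = this
  have r: "reduced X1 A1 B1" "reduced X2 A2 B2" unfolding defs by (rule reduced_quot_of_fract)+
  then have c: "coprime A1 B1" "coprime A2 B2" "B1 \<noteq> 0" "B2 \<noteq> 0"
    and X: "X1 = to_fract A1 / to_fract B1" "X2 = to_fract A2 / to_fract B2"
    unfolding reduced_def by auto
  define D where "D = B1 * B2"
  have "to_fract (A1 * A2 * W) = to_fract (U * D)" 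
    using prod c unfolding X D_def by (simp add: field_simps)
  then have e1: "A1 * A2 * W = U * D" by (simp del: to_fract_mult)
  have "to_fract ((A1 * B2 + A2 * B1) * W) = to_fract (V * D)" 
    using sum c unfolding X D_def by (simp add: field_simps)
  then have e2: "(A1 * B2 + A2 * B1) * W = V * D" by (simp del: to_fract_mult)
  \<comment> \<open>Once the gcd is removed, \<open>d\<close> divides the coefficients of one
    quadratic and \<open>w\<close> those of the other, so primitivity makes both units.\<close>
  define g where "g = gcd W D"
  have g0: "g \<noteq> 0" using assms(1) by (simp add: g_def)
  obtain w d where wd: "W = g * w" "D = g * d" "coprime w d"
    using gcd_coprime_exists[of W D] g0 unfolding g_def by (metis mult.commute)
  have f1: "A1 * A2 * w = U * d" using e1 g0 unfolding wd by (simp add: algebra_simps)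
  have "g * ((A1 * B2 + A2 * B1) * w) = g * (V * d)" using e2 unfolding wd by (simp only: mult_ac)
  then have f2: "(A1 * B2 + A2 * B1) * w = V * d" using g0 by (simp only: mult_cancel_left) simp
  have "d dvd A1 * A2" "d dvd A1 * B2 + A2 * B1"
    using f1 f2 wd(3) by (metis coprime_commute coprime_dvd_mult_left_iff dvd_triv_right)+
  then have ud: "is_unit d" using primitive_product[OF c] wd(2) D_def by auto
  have uw: "is_unit w"
  proof (rule is_unit_if_no_prime_dvd)
    show "w \<noteq> 0" using wd assms by auto
    fix q assume q: "prime_elem q" "q dvd w"
    have "w dvd U" "w dvd V" using f1 f2 wd(3) by (metis coprime_dvd_mult_left_iff dvd_triv_right)+
    then show False using prim[OF q(1)] q(2) wd(1) by (meson dvd_trans dvd_triv_right)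
  qed
  have "degree U = degree (A1 * A2)" by (metis f1 degree_unit_mult ud uw)
  moreover have "degree V = degree (A1 * B2 + A2 * B1)" by (metis f2 degree_unit_mult ud uw)
  moreover have "degree W = degree (B1 * B2)" by (metis wd(1,2) D_def degree_unit_mult ud uw)
  ultimately have "max (degree U) (max (degree V) (degree W)) = max (degree A1) (degree B1) + max (degree A2) (degree B2)"
    using max_degree_product[of A1 B1 A2 B2] c by simp
  then show ?thesis unfolding height_def defs by simp
qed

text \<open>The quadratic \<open>B Z^2 - A Z\<close> has the roots \<open>X\<close> and 0, and 0 has
  height 0, so any reduced fraction computes the height.\<close>

lemma height_reduced:
  fixes A B :: "'a::field_gcd poly"
  assumes "reduced X A B" shows "height X = max (degree A) (degree B)"
proof -
  have "height X + height (0 :: 'a poly fract) = max (degree (0 :: 'a poly)) (max (degree A) (degree B))"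
    using assms unfolding reduced_def
    by (intro height_sum_of_roots[of B 0 A X 0]) (auto dest: coprime_common_divisor simp: prime_elem_def)
  then show ?thesis by (simp add: height_def)
qed

section \<open>Hasse's bound\<close>

text \<open>
  On \<open>lam Y\<^sup>2 = X\<^sup>3 + a2 X\<^sup>2 + a4 X\<close> with \<open>lam = t\<^sup>3 + a2 t\<^sup>2 + a4 t\<close>, the abscissae of
  \<open>(X, Y) + (t, e)\<close> and \<open>(X, Y) - (t, e)\<close> are \<open>x1\<close> and \<open>x2\<close>. Only these chord formulas are used, never
  the associativity of the group law.
\<close>

lemma chord_products:
  fixes X Y t a2 a4 lam e :: "'k::field"
  assumes lam: "lam = t^3 + a2 * t^2 + a4 * t" and crv: "lam * Y^2 = X^3 + a2 * X^2 + a4 * X"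
    and e: "e^2 = 1" and ne: "X \<noteq> t"
    and x1: "x1 = lam * ((Y - e) / (X - t))^2 - a2 - X - t"
    and x2: "x2 = lam * ((Y + e) / (X - t))^2 - a2 - X - t"
  shows "x1 * x2 * (X - t)^2 = (X * t - a4)^2"
    and "(x1 + x2) * (X - t)^2 = 2 * ((X * t + a4) * (X + t) + 2 * a2 * X * t)"
proof -
  define G where "G = (X * t + a4) * (X + t) + 2 * a2 * X * t"
  have d: "(X - t)^2 \<noteq> 0" using ne by simp
  have "x1 * (X - t)^2 = lam * (Y - e)^2 - (a2 + X + t) * (X - t)^2"
    unfolding x1 using ne by (simp add: power_divide left_diff_distrib algebra_simps)
  also have "\<dots> = lam * Y^2 + lam * e^2 - 2 * lam * e * Y - (a2 + X + t) * (X - t)^2"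
    by Groebner_Basis.algebra
  also have "\<dots> = G - 2 * lam * e * Y"
    unfolding crv e G_def by (subst lam) Groebner_Basis.algebra
  finally have 1: "x1 * (X - t)^2 = G - 2 * lam * e * Y" .
  have "x2 * (X - t)^2 = lam * (Y + e)^2 - (a2 + X + t) * (X - t)^2"
    unfolding x2 using ne by (simp add: power_divide left_diff_distrib algebra_simps)
  also have "\<dots> = lam * Y^2 + lam * e^2 + 2 * lam * e * Y - (a2 + X + t) * (X - t)^2"
    by Groebner_Basis.algebra
  also have "\<dots> = G + 2 * lam * e * Y"
    unfolding crv e G_def by (subst lam) Groebner_Basis.algebra
  finally have 2: "x2 * (X - t)^2 = G + 2 * lam * e * Y" .
  have "(x1 * x2 * (X - t)^2) * (X - t)^2 = (x1 * (X - t)^2) * (x2 * (X - t)^2)" by Groebner_Basis.algebra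
  also have "\<dots> = G^2 - 4 * lam * (lam * Y^2) * e^2" unfolding 1 2 by Groebner_Basis.algebra
  also have "\<dots> = (X * t - a4)^2 * (X - t)^2"
    unfolding crv e G_def unfolding lam by Groebner_Basis.algebra
  finally show "x1 * x2 * (X - t)^2 = (X * t - a4)^2" using d by (simp only: mult_cancel_right) simp
  have "(x1 + x2) * (X - t)^2 = (G - 2 * lam * e * Y) + (G + 2 * lam * e * Y)"
    unfolding 1[symmetric] 2[symmetric] by Groebner_Basis.algebra
  also have "\<dots> = 2 * G" by Groebner_Basis.algebra
  finally show "(x1 + x2) * (X - t)^2 = 2 * ((X * t + a4) * (X + t) + 2 * a2 * X * t)"
    unfolding G_def .
qed

text \<open>The curve equations at \<open>(X, Y)\<close> and \<open>(t, e)\<close> are subtracted,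
  \<open>Y = e + m (X - t)\<close> is inserted, and the factor \<open>X - t\<close> is
  cancelled.\<close>

lemma chord_slope:
  fixes X Y t a2 a4 lam e :: "'k::field"
  assumes lam: "lam = t^3 + a2 * t^2 + a4 * t" and crv: "lam * Y^2 = X^3 + a2 * X^2 + a4 * X"
    and e: "e^2 = 1" and ne: "X \<noteq> t" and m: "m = (Y - e) / (X - t)"
  shows "lam * m * (2 * e + m * (X - t)) = X^2 + X * t + t^2 + a2 * (X + t) + a4"
proof -
  have Y: "m * (X - t) = Y - e" using ne m by simp
  have "lam * m * (2 * e + m * (X - t)) * (X - t) = lam * (m * (X - t)) * (2 * e + m * (X - t))" by Groebner_Basis.algebra
  also have "\<dots> = lam * Y^2 - lam * e^2" unfolding Y by Groebner_Basis.algebra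
  also have "\<dots> = (X^2 + X * t + t^2 + a2 * (X + t) + a4) * (X - t)"
    unfolding crv e unfolding lam by Groebner_Basis.algebra
  finally show ?thesis using ne by simp
qed

text \<open>By Vieta \<open>X'\<close> is the third root on the chord, and \<open>Y'\<close> is the
  negated ordinate there, so \<open>(X', Y')\<close> is \<open>(X, Y) + (t, e)\<close>.\<close>

lemma chord_on_curve:
  fixes X Y t a2 a4 lam e :: "'k::field"
  assumes lam: "lam = t^3 + a2 * t^2 + a4 * t" and crv: "lam * Y^2 = X^3 + a2 * X^2 + a4 * X"
    and e: "e^2 = 1" and ne: "X \<noteq> t" and m: "m = (Y - e) / (X - t)"
    and X': "X' = lam * m^2 - a2 - X - t" and Y': "Y' = - (e + m * (X' - t))"
  shows "lam * Y'^2 = X'^3 + a2 * X'^2 + a4 * X'"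
proof -
  note s = chord_slope[OF assms(1-5)]
  have "X'^3 + a2 * X'^2 + a4 * X' - lam * Y'^2 = (X'^3 + a2 * X'^2 + a4 * X' - lam * e^2)
     - (2 * e * lam * m * (X' - t) + lam * m^2 * (X' - t)^2)"
    unfolding Y' by Groebner_Basis.algebra
  also have "\<dots> = (X' - t) * (X'^2 + X' * t + t^2 + a2 * (X' + t) + a4 - 2 * e * lam * m - lam * m^2 * (X' - t))"
    unfolding e using lam by Groebner_Basis.algebra
  \<comment> \<open>The cofactor splits into a multiple of Vieta's relation for \<open>X'\<close>
    and the difference that \<open>chord_slope\<close> makes zero.\<close>
  also have "X'^2 + X' * t + t^2 + a2 * (X' + t) + a4 - 2 * e * lam * m - lam * m^2 * (X' - t)
    = (X' - X) * (X' + X + t + a2 - lam * m^2)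
      + ((X^2 + X * t + t^2 + a2 * (X + t) + a4) - lam * m * (2 * e + m * (X - t)))"
    by Groebner_Basis.algebra
  also have "\<dots> = 0" unfolding s unfolding X' by Groebner_Basis.algebra
  finally show ?thesis by simp
qed

text \<open>If the sum has abscissa \<open>t\<close>, the chord is tangent at \<open>(t, e)\<close>;
  then \<open>(X, Y)\<close> is \<open>-2 (t, e)\<close> and the conclusion is the duplication
  formula.\<close>

lemma chord_degenerate:
  fixes X Y t a2 a4 lam e :: "'k::field"
  assumes lam: "lam = t^3 + a2 * t^2 + a4 * t" and crv: "lam * Y^2 = X^3 + a2 * X^2 + a4 * X"
    and e: "e^2 = 1" and ne: "X \<noteq> t" and m: "m = (Y - e) / (X - t)"
    and X': "t = lam * m^2 - a2 - X - t"
  shows "X * (4 * lam) = (t^2 - a4)^2"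
proof -
  note s = chord_slope[OF assms(1-5)]
  have q: "lam * m^2 = a2 + 2 * t + X" using X' by Groebner_Basis.algebra
  have "2 * e * lam * m = X^2 + X * t + t^2 + a2 * (X + t) + a4 - (lam * m^2) * (X - t)"
    using s by Groebner_Basis.algebra
  also have "\<dots> = 3 * t^2 + 2 * a2 * t + a4" unfolding q by Groebner_Basis.algebra
  \<comment> \<open>\<open>m\<close> is the slope of the tangent at \<open>(t, e)\<close>.\<close>
  finally have r: "2 * e * lam * m = 3 * t^2 + 2 * a2 * t + a4" .
  have "4 * lam * (lam * m^2) * e^2 = (2 * e * lam * m)^2" by Groebner_Basis.algebra
  then have "4 * lam * (a2 + 2 * t + X) = (3 * t^2 + 2 * a2 * t + a4)^2" unfolding q r e by simp
  then have "X * (4 * lam) = (3 * t^2 + 2 * a2 * t + a4)^2 - 4 * lam * (a2 + 2 * t)" by Groebner_Basis.algebra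
  also have "\<dots> = (t^2 - a4)^2" unfolding lam by Groebner_Basis.algebra
  finally show ?thesis .
qed

section \<open>Heights on the twist of a cubic with nonzero discriminant\<close>

locale legendre_cubic =
  fixes a2 a4 :: "'a::field_gcd"
  assumes a4: "a4 \<noteq> 0" and disc: "a2^2 \<noteq> 4 * a4" and two: "(2::'a) \<noteq> 0"
begin

abbreviation "x \<equiv> [:0, 1:] :: 'a poly"

definition cubic :: "'a poly" where "cubic = x^3 + [:a2:] * x^2 + [:a4:] * x"

lemma degree_cubic: "degree cubic = 3" 
proof -
  have "cubic = [:0, a4, a2, 1:]" unfolding cubic_def by (simp add: power2_eq_square power3_eq_cube)
  then show ?thesis by simp
qed

lemma cubic_nonzero: "cubic \<noteq> 0"
  using degree_cubic by auto

lemma const_not_dvd: "prime_elem q \<Longrightarrow> q dvd [:c:] \<Longrightarrow> c = 0" for q :: "'a poly"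
  by (metis is_unit_const_poly_iff dvd_trans prime_elem_not_unit dvd_field_iff)

text \<open>This puts the duplication formula in lowest terms. Since \<open>a4\<close> is nonzero,
  \<open>q\<close> does not divide \<open>x\<close>; eliminating \<open>x\<close> between
  \<open>x^2 - a4\<close> and the quadratic factor of \<open>cubic\<close> leaves the constant
  \<open>4 a4 - a2^2\<close>.\<close>

lemma no_common_prime:
  assumes q: "prime_elem q" and 1: "q dvd cubic" and 2: "q dvd x^2 - [:a4:]"
  shows False
proof -
  have nx: "\<not> q dvd x"
  proof
    assume "q dvd x"
    then have "q dvd x * x - (x^2 - [:a4:])" using 2 by (metis dvd_diff dvd_mult)
    then have "q dvd [:a4:]" by (simp add: power2_eq_square)
    then show False using const_not_dvd[OF q] a4 by simp
  qed
  have "cubic = x * (x^2 + [:a2:] * x + [:a4:])" unfolding cubic_def by Groebner_Basis.algebra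
  then have g: "q dvd x^2 + [:a2:] * x + [:a4:]" using 1 q nx prime_elem_dvd_mult_iff by metis
  have "q dvd (x^2 + [:a2:] * x + [:a4:]) + (x^2 - [:a4:])" using g 2 by (rule dvd_add)
  also have "(x^2 + [:a2:] * x + [:a4:]) + (x^2 - [:a4:]) = x * (2 * x + [:a2:])" by Groebner_Basis.algebra
  finally have h: "q dvd 2 * x + [:a2:]" using q nx prime_elem_dvd_mult_iff by metis
  have i: "q dvd (x^2 + [:a2:] * x + [:a4:]) - (x^2 - [:a4:])" using g 2 by (rule dvd_diff)
  have "q dvd 2 * ((x^2 + [:a2:] * x + [:a4:]) - (x^2 - [:a4:])) - [:a2:] * (2 * x + [:a2:])"
    using h i by (metis dvd_diff dvd_mult)
  also have "\<dots> = 4 * [:a4:] - [:a2:]^2" by Groebner_Basis.algebra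
  also have "\<dots> = [:4 * a4 - a2^2:]"
    by (simp add: power2_eq_square numeral_poly)
  finally show False using const_not_dvd[OF q] disc by fastforce
qed

text \<open>
  The quadratic with roots \<open>x1, x2\<close> has primitive integral coefficients of maximal degree
  \<open>2 height X + 2\<close>, and both content and maximal degree are multiplicative.
\<close>

lemma height_step:
  assumes ne: "X \<noteq> to_fract x"
    and prod: "x1 * x2 * (X - to_fract x)^2 = (X * to_fract x - to_fract [:a4:])^2"
    and sum: "(x1 + x2) * (X - to_fract x)^2 =
      2 * ((X * to_fract x + to_fract [:a4:]) * (X + to_fract x) + 2 * to_fract [:a2:] * X * to_fract x)"
  shows "height x1 + height x2 = 2 * height X + 2"
proof -
  define A B where "A = fst (quot_of_fract X)" "B = snd (quot_of_fract X)"
  have r: "reduced X A B" unfolding A_B_def by (rule reduced_quot_of_fract)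
  then have cop: "coprime A B" and B0: "B \<noteq> 0" and X: "X = to_fract A / to_fract B"
    unfolding reduced_def by auto
  have hX: "height X = max (degree A) (degree B)" by (rule height_reduced[OF r])
  have XB: "X * to_fract B = to_fract A" unfolding X using B0 by simp
  \<comment> \<open>The coefficients of the quadratic with roots \<open>x1\<close>,
    \<open>x2\<close>, multiplied by \<open>B^2\<close>.\<close>
  define U V W where "U = (A * x - [:a4:] * B)^2"
    and "V = 2 * ((A * x + [:a4:] * B) * (A + x * B) + 2 * [:a2:] * A * B * x)"
    and "W = (A - x * B)^2"
  have to2: "to_fract 2 = (2 :: 'a poly fract)"
    by (metis one_add_one to_fract_1 to_fract_add)
  have pow: "to_fract (P^2) = (to_fract P)^2" for P :: "'a poly" by (simp add: power2_eq_square)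
  have W: "to_fract W = (X - to_fract x)^2 * to_fract B^2"
    unfolding W_def pow to_fract_diff to_fract_mult XB[symmetric] by (simp add: power2_eq_square algebra_simps)
  have U: "to_fract U = (X * to_fract x - to_fract [:a4:])^2 * to_fract B^2"
    unfolding U_def pow to_fract_diff to_fract_mult XB[symmetric] by (simp add: power2_eq_square algebra_simps)
  have V: "to_fract V = 2 * ((X * to_fract x + to_fract [:a4:]) * (X + to_fract x) + 2 * to_fract [:a2:] * X * to_fract x) * to_fract B^2"
    unfolding V_def to_fract_add to_fract_mult to2 XB[symmetric] by (simp add: power2_eq_square algebra_simps)
  have W0: "W \<noteq> 0"
  proof
    assume "W = 0"
    then have "to_fract W = 0" by simp
    then show False unfolding W using ne B0 by simp
  qed
  have "height x1 + height x2 = max (degree U) (max (degree V) (degree W))"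
  proof (rule height_sum_of_roots[OF W0])
    show "x1 * x2 * to_fract W = to_fract U" unfolding U W prod[symmetric] by (simp add: mult_ac)
    show "(x1 + x2) * to_fract W = to_fract V" unfolding V W sum[symmetric] by (simp add: mult_ac)
    fix q assume q: "prime_elem q" "q dvd U" "q dvd V" "q dvd W"
    have 1: "q dvd A - x * B" using q(1,4) prime_elem_dvd_power unfolding W_def by blast
    have nB: "\<not> q dvd B"
    proof
      assume "q dvd B"
      then have "q dvd A - x * B + x * B" using 1 by (meson dvd_add dvd_mult)
      then show False using \<open>q dvd B\<close> cop q(1) by (metis coprime_common_divisor diff_add_cancel prime_elem_not_unit)
    qed
    have "q dvd A * x - [:a4:] * B" using q(1,2) prime_elem_dvd_power unfolding U_def by blast
    \<comment> \<open>Modulo \<open>q\<close> the numerator \<open>A\<close> equals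
      \<open>x B\<close>, which turns \<open>U\<close> into \<open>B^2 (x^2 - a4)^2\<close> and
      \<open>V\<close> into \<open>4 B^2 cubic\<close>.\<close>
    then have "q dvd (A * x - [:a4:] * B) - x * (A - x * B)" using 1 by (meson dvd_diff dvd_mult)
    also have "\<dots> = B * (x^2 - [:a4:])" by Groebner_Basis.algebra
    finally have 2: "q dvd x^2 - [:a4:]" using nB q(1) prime_elem_dvd_mult_iff by blast
    have "q dvd V - (A - x * B) * (2 * (x * (A + x * B) + x^2 * B + [:a4:] * B + 2 * [:a2:] * x * B))"
      using 1 q(3) by (meson dvd_diff dvd_mult2)
    also have "\<dots> = 4 * (B^2 * cubic)" unfolding V_def cubic_def by Groebner_Basis.algebra
    also have "\<dots> = [:4:] * (B^2 * cubic)" by (simp add: numeral_poly)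
    finally have "q dvd [:4:] \<or> q dvd B^2 * cubic" using q(1) prime_elem_dvd_mult_iff by blast
    moreover have "(4::'a) \<noteq> 0" using two by (metis mult_eq_0_iff numeral_Bit0 mult_2 one_add_one numeral_One mult_2_right)
    ultimately have "q dvd B^2 * cubic" using const_not_dvd[OF q(1)] by blast
    then have "q dvd cubic" using nB q(1) prime_elem_dvd_mult_iff prime_elem_dvd_power by blast
    then show False using no_common_prime[OF q(1)] 2 by blast
  qed
  also have "\<dots> = 2 * height X + 2"
  proof -
    define h where "h = max (degree A) (degree B)"
    have dA: "degree A \<le> h" and dB: "degree B \<le> h" unfolding h_def by auto
    have dxB: "degree (x * B) \<le> h + 1" "degree (A * x) \<le> h + 1" "degree ([:a4:] * B) \<le> h + 1"
      using dA dB degree_mult_le[of x B] degree_mult_le[of A x] degree_mult_le[of "[:a4:]" B] by auto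
    have b: "degree (P * Q) \<le> 2 * h + 2" if "degree P \<le> h + 1" "degree Q \<le> h + 1" for P Q :: "'a poly"
      using degree_mult_le[of P Q] that by simp
    have U1: "degree U \<le> 2 * h + 2" unfolding U_def power2_eq_square
      by (intro b degree_diff_le dxB)
    have W1: "degree W \<le> 2 * h + 2" unfolding W_def power2_eq_square
      using dA dxB by (intro b degree_diff_le) auto
    have "degree (2 * [:a2:] * A * B * x) \<le> 2 * h + 2"
    proof -
      have "degree (2 * [:a2:] * A) \<le> h + 1" 
        using degree_mult_le[of "[:2 * a2:]" A] dA by (simp add: numeral_poly)
      then have "degree ((2 * [:a2:] * A) * (x * B)) \<le> 2 * h + 2" using dxB by (intro b)
      then show ?thesis by (simp only: mult_ac)
    qed
    moreover have "degree ((A * x + [:a4:] * B) * (A + x * B)) \<le> 2 * h + 2"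
      using dA by (intro b degree_add_le dxB) auto
    ultimately have "degree ((A * x + [:a4:] * B) * (A + x * B) + 2 * [:a2:] * A * B * x) \<le> 2 * h + 2"
      by (rule degree_add_le[rotated])
    then have V1: "degree V \<le> 2 * h + 2" 
      unfolding V_def using degree_mult_le[of "[:2:]"] by (simp add: numeral_poly)
    \<comment> \<open>The larger of \<open>degree A\<close> and \<open>degree B\<close> supplies a
      leading term that does not cancel: in \<open>U\<close> through \<open>A x\<close>, or in
      \<open>W\<close> through \<open>x B\<close>.\<close>
    have "2 * h + 2 \<le> max (degree U) (degree W)"
    proof (cases "A \<noteq> 0 \<and> degree B \<le> degree A")
      case True
      then have "degree (A * x) = degree A + 1" by (simp add: degree_mult_eq)
      moreover have "degree ([:a4:] * B) < degree A + 1" using True by simp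
      ultimately have "degree (A * x - [:a4:] * B) = degree A + 1"
        by (metis degree_add_eq_left degree_minus diff_conv_add_uminus)
      then have "degree U = 2 * (degree A + 1)" unfolding U_def by (subst degree_power_eq) auto
      then show ?thesis using True h_def by simp
    next
      case False
      have "degree (x * B) = degree B + 1" using B0 by (simp add: degree_mult_eq)
      moreover have "degree A < degree B + 1" using False by (cases "A = 0") auto
      ultimately have "degree (x * B - A) = degree B + 1"
        by (metis degree_add_eq_left degree_minus diff_conv_add_uminus)
      then have "degree (A - x * B) = degree B + 1" by (metis degree_minus minus_diff_eq)
      then have "degree W = 2 * (degree B + 1)" unfolding W_def by (subst degree_power_eq) auto
      then show ?thesis using False h_def by auto
    qed
    then show ?thesis using U1 V1 W1 unfolding hX h_def by linarith
  qed
  finally show ?thesis .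
qed

text \<open>The abscissa of \<open>-2 (x, e)\<close> has a numerator of degree 4 over a coprime
  denominator of degree 3.\<close>

lemma height_double:
  assumes "X * (4 * to_fract cubic) = (to_fract x^2 - to_fract [:a4:])^2"
  shows "height X = 4"
proof -
  have four: "(4::'a) \<noteq> 0" using two by (metis mult_eq_0_iff numeral_Bit0 mult_2 one_add_one numeral_One mult_2_right)
  have to4: "to_fract [:4:] = (4 :: 'a poly fract)"
  proof -
    have "[:4:] = (1 + 1 + 1 + 1 :: 'a poly)" by (simp add: one_pCons)
    then show ?thesis by (simp only: to_fract_add to_fract_1) simp
  qed
  have pow: "to_fract (P^2) = (to_fract P)^2" for P :: "'a poly" by (simp add: power2_eq_square)
  have B0: "[:4:] * cubic \<noteq> 0" using cubic_nonzero four by simp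
  have "reduced X ((x^2 - [:a4:])^2) ([:4:] * cubic)"
    unfolding reduced_def
  proof (intro conjI)
    show "coprime ((x^2 - [:a4:])^2) ([:4:] * cubic)"
    proof (rule coprime_if_no_prime_dvd[OF B0])
      fix q assume q: "prime_elem q" "q dvd (x^2 - [:a4:])^2" "q dvd [:4:] * cubic"
      have "q dvd cubic" using q(1,3) four const_not_dvd[OF q(1)] prime_elem_dvd_mult_iff by blast
      moreover have "q dvd x^2 - [:a4:]" using q(1,2) prime_elem_dvd_power by blast
      ultimately show False using no_common_prime[OF q(1)] by blast
    qed
    have "to_fract ([:4:] * cubic) \<noteq> 0" using B0 by (simp only: to_fract_eq_0_iff) simp
    then show "X = to_fract ((x^2 - [:a4:])^2) / to_fract ([:4:] * cubic)"
      using assms unfolding pow to_fract_mult to_fract_diff to4 by (simp only: eq_divide_eq) simp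
  qed fact
  then have "height X = max (degree ((x^2 - [:a4:])^2)) (degree ([:4:] * cubic))" by (rule height_reduced)
  moreover have "degree (x^2 - [:a4:]) = 2" by (simp add: power2_eq_square)
  then have "degree ((x^2 - [:a4:])^2) = 4" by (subst degree_power_eq) auto
  moreover have "degree ([:4:] * cubic) = 3" using four degree_cubic by simp
  ultimately show ?thesis by simp
qed

end

section \<open>The quadratic character, by Euler's criterion\<close>

definition chi :: "'a::finite_field \<Rightarrow> int" where
  "chi z = (if z = 0 then 0 else if z ^ ((CARD('a) - 1) div 2) = 1 then 1 else -1)"

lemma power_half_card:
  fixes z :: "'a::finite_field"
  assumes "odd (CARD('a))" "z \<noteq> 0"
  shows "z ^ ((CARD('a) - 1) div 2) = 1 \<or> z ^ ((CARD('a) - 1) div 2) = -1"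
proof -
  have "z ^ CARD('a) = z" by (rule finite_field_power_card_eq_same)
  moreover have "CARD('a) = Suc (2 * ((CARD('a) - 1) div 2))" using assms(1) by (auto elim!: oddE)
  ultimately have "z * (z ^ ((CARD('a) - 1) div 2))^2 = z * 1"
    by (metis power_Suc power_mult mult.commute mult.right_neutral)
  then have "(z ^ ((CARD('a) - 1) div 2))^2 = 1" using assms(2) by simp
  then show ?thesis by (simp add: power2_eq_1_iff)
qed

lemma two_nonzero:
  assumes "odd (CARD('a::finite_field))" shows "(2::'a) \<noteq> 0"
proof
  assume "(2::'a) = 0"
  then have "of_nat 2 = (0::'a)" by simp
  then have "CHAR('a) dvd 2" by (simp only: of_nat_eq_0_iff_char_dvd)
  then have "CHAR('a) = 2" using CHAR_prime[where 'a='a] by (metis primes_dvd_imp_eq two_is_prime_nat)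
  then show False using CHAR_dvd_CARD[where 'a='a] assms by simp
qed

lemma chi_eq_power:
  assumes "odd (CARD('a::finite_field))"
  shows "of_int (chi (z::'a)) = z ^ ((CARD('a) - 1) div 2)"
proof (cases "z = 0")
  case True
  \<comment> \<open>At \<open>z = 0\<close> the power is 0 only because the exponent is
    positive.\<close>
  have "CARD('a) > 2" using assms card_mono[of UNIV "{0,1::'a}"] by (metis One_nat_def Suc_1 card_2_iff even_Suc
     finite le_neq_implies_less subset_UNIV zero_neq_one even_zero)
  then have "(CARD('a) - 1) div 2 > 0" by simp
  then show ?thesis using True by (simp add: chi_def)
next
  case False
  then show ?thesis using power_half_card[OF assms False] by (auto simp: chi_def)
qed

lemma chi_values: "chi z = 0 \<or> chi z = 1 \<or> chi z = -1" by (simp add: chi_def)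

lemma chi_eq_0_iff [simp]: "chi z = 0 \<longleftrightarrow> z = 0" by (simp add: chi_def)

lemma chi_0 [simp]: "chi 0 = 0" by (simp add: chi_def)

lemma chi_mult:
  assumes "odd (CARD('a::finite_field))"
  shows "chi (y * z :: 'a) = chi y * chi z"
proof -
  have "(of_int (chi (y * z)) :: 'a) = of_int (chi y * chi z)"
    using assms by (simp add: chi_eq_power power_mult_distrib)
  moreover have "(1::'a) \<noteq> -1" using two_nonzero[OF assms] by (metis add.right_inverse one_add_one)
  ultimately show ?thesis using chi_values[of "y*z"] chi_values[of y] chi_values[of z]
    by (cases "y = 0 \<or> z = 0") (auto simp del: chi_eq_0_iff)
qed

section \<open>Linear factors and the Frobenius map on polynomials\<close>

lemma prod_linear_dvd:
  fixes P :: "'a::field poly"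
  assumes "finite R" "\<And>r. r \<in> R \<Longrightarrow> poly P r = 0"
  shows "(\<Prod>r\<in>R. [:-r, 1:]) dvd P"
  using assms
proof (induction R arbitrary: P rule: finite_induct)
  case (insert r R)
  then obtain Q where Q: "P = [:-r, 1:] * Q" by (metis poly_eq_0_iff_dvd dvdE insertI1)
  have "(\<Prod>r\<in>R. [:-r, 1:]) dvd Q"
  proof (rule insert.IH)
    fix s assume s: "s \<in> R"
    then have "poly P s = 0" using insert.prems by simp
    moreover have "s \<noteq> r" using s insert.hyps by auto
    ultimately show "poly Q s = 0" unfolding Q by simp
  qed
  then show ?case unfolding Q prod.insert[OF insert.hyps] by (rule mult_dvd_mono[OF dvd_refl])
qed simp

lemma prime_dvd_prod_linear:
  fixes q :: "'a::field_gcd poly"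
  assumes "finite R" "prime_elem q" "q dvd (\<Prod>r\<in>R. [:-r, 1:])"
  obtains r where "r \<in> R" "[:-r, 1:] dvd q"
proof -
  have "\<exists>r\<in>R. q dvd [:-r, 1:]"
    using assms(1,3)
  proof (induction R rule: finite_induct)
    case empty
    then show ?case using assms(2) by (auto simp: prime_elem_def)
  next
    case (insert r R)
    then show ?case unfolding prod.insert[OF insert.hyps] using assms(2) prime_elem_dvd_mult_iff by blast
  qed
  then obtain r where r: "r \<in> R" "q dvd [:-r, 1:]" by blast
  then obtain g where g: "[:-r, 1:] = q * g" by (elim dvdE)
  have "poly [:-r, 1:] r = 0" by simp
  then have "poly q r = 0 \<or> poly g r = 0" unfolding g by simp
  moreover have "poly g r \<noteq> 0"
  proof
    assume "poly g r = 0"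
    then obtain g' where "g = [:-r,1:] * g'" by (metis poly_eq_0_iff_dvd dvdE)
    then have "[:-r,1:] * (q * g') = [:-r,1:] * 1" using g by (metis mult.left_commute mult.right_neutral)
    then have "q * g' = 1" by (simp only: mult_cancel_left) auto
    then show False using assms(2) by (metis dvd_triv_left prime_elem_not_unit)
  qed
  ultimately have "[:-r, 1:] dvd q" by (simp add: poly_eq_0_iff_dvd)
  then show ?thesis using r that by blast
qed

text \<open>Every field element is a root of the left side, so the product divides it, and both
  sides are monic of degree \<open>CARD('a)\<close>.\<close>

lemma card_power_poly:
  fixes c :: "'a::{finite_field,field_gcd}"
  shows "[:0, 1:] ^ CARD('a) - [:0, 1:] = (\<Prod>r\<in>(UNIV::'a set). [:-r, 1:])" (is "?T = ?P")
proof -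
  have c1: "CARD('a) > 1" using card_mono[of UNIV "{0,1::'a}"] by simp
  have "?P dvd ?T" by (rule prod_linear_dvd) (auto simp: finite_field_power_card_eq_same)
  then obtain g where g: "?T = ?P * g" by (elim dvdE)
  have d: "degree ?P = CARD('a)" "lead_coeff ?P = 1"
    by (simp add: degree_prod_eq_sum_degree) (subst lead_coeff_prod, simp)
  have m: "[:0, 1::'a:] ^ CARD('a) = monom 1 CARD('a)" by (simp add: monom_altdef)
  have dx: "degree [:0, 1::'a:] < degree ([:0, 1::'a:] ^ CARD('a))" unfolding m using c1 by (simp add: degree_monom_eq)
  have dT: "degree ?T = CARD('a)" "lead_coeff ?T = 1"
  proof -
    have "degree ([:0, 1::'a:] ^ CARD('a) + (- [:0, 1:])) = degree ([:0, 1::'a:] ^ CARD('a))"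
      using dx by (intro degree_add_eq_left) simp
    then show e: "degree ?T = CARD('a)" unfolding m diff_conv_add_uminus by (simp add: degree_monom_eq)
    show "lead_coeff ?T = 1" unfolding e unfolding m using c1 by (simp add: coeff_pCons split: nat.split)
  qed
  have "g \<noteq> 0" using g dT(2) by auto
  then have "degree g = 0" using g d dT by (metis add_cancel_right_right degree_mult_eq leading_coeff_0_iff zero_neq_one)
  moreover have "lead_coeff g = 1" using g d dT by (metis lead_coeff_mult mult_1)
  ultimately have "g = 1" by (metis degree_eq_zeroE lead_coeff_pCons(2) one_pCons pCons_0_0 lead_coeff_1 degree_0 coeff_pCons_0)
  then show ?thesis using g by simp
qed

lemma poly_power_card:
  fixes a :: "'a::{finite_field,field_gcd}"
  assumes "prime (CARD('a))"
  shows "(F + G :: 'a poly) ^ CARD('a) = F ^ CARD('a) + G ^ CARD('a)" and "[:a:] ^ CARD('a) = [:a:]"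
proof -
  have "CHAR('a) = CARD('a)"
    using CHAR_dvd_CARD[where 'a='a] CHAR_prime[where 'a='a] assms primes_dvd_imp_eq by blast
  then show "(F + G :: 'a poly) ^ CARD('a) = F ^ CARD('a) + G ^ CARD('a)"
    using assms by (intro freshmans_dream) auto
  show "[:a:] ^ CARD('a) = [:a:]" by (simp add: poly_const_pow finite_field_power_card_eq_same)
qed

section \<open>The first step of the chain and the character sum\<close>

locale frobenius_chain = legendre_cubic a2 a4
  for a2 a4 :: "'a::{finite_field,field_gcd}" +
  fixes e :: int and p k :: nat
  assumes prime_card: "prime (CARD('a))" and odd_card: "odd (CARD('a))" and e: "e = 1 \<or> e = -1"
    and p_def: "p = CARD('a)" and k_def: "k = (CARD('a) - 1) div 2"
begin

abbreviation "T \<equiv> x ^ p"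
abbreviation "ep \<equiv> [:of_int e:] :: 'a poly"

lemma card_eq: "p = 2 * k + 1" unfolding p_def k_def using odd_card by (auto elim!: oddE)

lemma k_pos: "k > 0"
  using card_eq prime_card unfolding p_def by (metis add_0 gr0I mult_0_right not_prime_1)

lemma frobenius:
  "(F + G :: 'a poly) ^ p = F ^ p + G ^ p" "[:a::'a:] ^ p = [:a:]" "r ^ p = (r::'a)"
  using poly_power_card[OF prime_card] unfolding p_def by (auto simp: finite_field_power_card_eq_same)

lemma ep_square: "ep ^ 2 = 1" using e by (auto simp: power2_eq_square one_pCons)

lemma poly_cubic: "poly cubic r = r^3 + a2 * r^2 + a4 * r"
  unfolding cubic_def by (simp add: algebra_simps power2_eq_square power3_eq_cube)

text \<open>Frobenius takes \<open>cubic\<close> to its value at \<open>T\<close>, and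
  \<open>p = 2 k + 1\<close>; so \<open>(T, cubic ^ k)\<close> is a point of the twist.\<close>

lemma cubic_power_card: "cubic * (cubic ^ k)^2 = T^3 + [:a2:] * T^2 + [:a4:] * T"
proof -
  have "cubic * (cubic ^ k)^2 = cubic ^ p"
    by (subst card_eq) (simp add: power_mult[symmetric] mult.commute)
  also have "\<dots> = (x^3)^p + ([:a2:] * x^2)^p + ([:a4:] * x)^p"
    unfolding cubic_def by (simp only: frobenius(1))
  also have "\<dots> = T^3 + [:a2:] * T^2 + [:a4:] * T"
    by (simp only: power_mult_distrib frobenius(2))
       (simp only: power_mult[symmetric] mult.commute)
  finally show ?thesis .
qed

text \<open>\<open>M / (T - x)\<close> is the slope of the chord from \<open>(T, cubic ^ k)\<close>
  to \<open>(x, e)\<close>, and \<open>N / (T - x)^2\<close> is the abscissa of their sum.\<close>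

definition "M = cubic ^ k - ep"
definition "N = cubic * M^2 - ([:a2:] + T + x) * (T - x)^2"
definition R :: "int \<Rightarrow> 'a set" where "R s = {r. chi (poly cubic r) = s}"
definition lin :: "'a set \<Rightarrow> 'a poly" where "lin S = (\<Prod>r\<in>S. [:-r, 1:])"

lemma degree_lin: "degree (lin S) = card S"
  unfolding lin_def by (simp add: degree_prod_eq_sum_degree)

lemma lin_nonzero: "lin S \<noteq> 0" unfolding lin_def by simp

lemma poly_M: "poly M r = of_int (chi (poly cubic r)) - of_int e"
  by (simp add: M_def chi_eq_power[OF odd_card]) (simp add: k_def)

lemma UNIV_split: "UNIV = R e \<union> R 0 \<union> R (-e)" "R e \<inter> R 0 = {}" "(R e \<union> R 0) \<inter> R (-e) = {}"
proof -
  have "chi (poly cubic r) = e \<or> chi (poly cubic r) = 0 \<or> chi (poly cubic r) = -e" for r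
    using chi_values[of "poly cubic r"] e by auto
  then show "UNIV = R e \<union> R 0 \<union> R (-e)" unfolding R_def by blast
  show "R e \<inter> R 0 = {}" "(R e \<union> R 0) \<inter> R (-e) = {}" unfolding R_def using e by auto
qed

lemma lin_split: "T - x = lin (R e) * lin (R 0) * lin (R (-e))"
proof -
  have "T - x = lin UNIV" unfolding lin_def p_def by (rule card_power_poly)
  also have "\<dots> = lin (R e \<union> R 0 \<union> R (-e))" using UNIV_split(1) by simp
  also have "\<dots> = lin (R e) * lin (R 0) * lin (R (-e))"
    unfolding lin_def by (simp only: prod.union_disjoint[OF finite finite UNIV_split(3)]
      prod.union_disjoint[OF finite finite UNIV_split(2)])
  finally show ?thesis .
qed

lemma T_minus_x_nonzero: "T - x \<noteq> 0" unfolding lin_split using lin_nonzero by simp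

text \<open>A double root is a root of the derivative, whose square is congruent to
  \<open>(x^2 - a4)^2\<close> modulo \<open>cubic\<close>; but \<open>x^2 - a4\<close> shares no
  factor with \<open>cubic\<close>.\<close>

lemma cubic_simple_roots:
  assumes "[:-r, 1:]^2 dvd cubic" shows False
proof -
  obtain g where g: "cubic = [:-r, 1:]^2 * g" using assms by (elim dvdE)
  have pr: "prime_elem [:-r, 1:]" by (simp add: prime_elem_linear_field_poly)
  have d1: "pderiv [:-r,1:] = 1" by (simp add: pderiv_pCons)
  have "pderiv cubic = [:-r,1:] * (2 * g + [:-r,1:] * pderiv g)"
    unfolding g power2_eq_square pderiv_mult d1 by Groebner_Basis.algebra
  then have "[:-r,1:] dvd pderiv cubic" by (metis dvd_triv_left)
  moreover have "pderiv cubic = 3 * x^2 + 2 * [:a2:] * x + [:a4:]"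
    unfolding cubic_def by (simp add: pderiv_add pderiv_mult pderiv_power pderiv_pCons power2_eq_square power3_eq_cube numeral_poly)
  ultimately have "[:-r,1:] dvd (3 * x^2 + 2 * [:a2:] * x + [:a4:])^2 - 4 * ([:a2:] + 2 * x) * cubic"
    using g by (metis dvd_diff dvd_mult dvd_mult2 dvd_triv_left power2_eq_square)
  also have "\<dots> = (x^2 - [:a4:])^2" unfolding cubic_def by Groebner_Basis.algebra
  finally have "[:-r,1:] dvd x^2 - [:a4:]" using pr prime_elem_dvd_power by blast
  moreover have "[:-r,1:] dvd cubic" using g by (metis dvd_mult2 dvd_triv_left power2_eq_square)
  ultimately show False using no_common_prime[OF pr] by blast
qed

text \<open>The curve equation rewrites \<open>cubic * M^2\<close> with leading term
  \<open>T^3\<close>. This cancels against the second part of \<open>N\<close>, and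
  \<open>T^2 x\<close> dominates what remains.\<close>

lemma degree_N: "degree N = 2 * p + 1"
proof -
  let ?V = "(T * x + [:a4:]) * (T + x) + 2 * [:a2:] * T * x"
  have g1: "t^3 + a * t^2 + b * t + c * 1 - 2 * f * (c * d) - (a + t + y) * (t - y)^2
      = (t * y + b) * (t + y) + 2 * a * t * y - 2 * f * (c * d)"
    if "c = y^3 + a * y^2 + b * y" for a b c d f t y :: "'a poly"
    using that by Groebner_Basis.algebra
  have g2: "(t * y + b) * (t + y) + 2 * a * t * y - z = t^2 * y + (b * t + t * y^2 + b * y + 2 * a * t * y - z)"
    for a b t y z :: "'a poly"
    by Groebner_Basis.algebra
  have ck: "cubic^(k+1) = cubic * cubic^k" by simp
  have "N = cubic * (cubic^k)^2 + cubic * ep^2 - 2 * ep * (cubic * cubic^k) - ([:a2:] + T + x) * (T - x)^2"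
    unfolding N_def M_def by Groebner_Basis.algebra
  also have "\<dots> = ?V - 2 * ep * cubic^(k+1)"
    unfolding cubic_power_card ep_square ck by (rule g1[OF cubic_def])
  finally have N: "N = T^2 * x + ([:a4:] * T + T * x^2 + [:a4:] * x + 2 * [:a2:] * T * x - 2 * ep * cubic^(k+1))"
    unfolding g2 .
  have dT: "degree (T^n) = p * n" for n by (simp add: degree_power_eq power_mult[symmetric])
  have dc: "degree ([:c:] * P) \<le> degree P" for c and P :: "'a poly" using degree_mult_le[of "[:c:]" P] by simp
  have p3: "p \<ge> 3" using card_eq k_pos by linarith
  have "degree ([:a4:] * T) \<le> 2 * p" using dc[of a4 T] dT[of 1] by simp
  moreover have "degree (T * x^2) \<le> 2 * p" using degree_mult_le[of T "x^2"] dT[of 1] p3 by (simp add: degree_power_eq)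
  moreover have "degree ([:a4:] * x) \<le> 2 * p" using dc[of a4 x] p3 by simp
  moreover have "degree (2 * [:a2:] * T * x) \<le> 2 * p"
    using degree_mult_le[of "[:2 * a2:] * T" x] dc[of "2 * a2" T] dT[of 1] p3 by (simp add: numeral_poly)
  moreover have "degree (2 * ep * cubic^(k+1)) \<le> 2 * p"
  proof -
    have "degree (2 * ep * cubic^(k+1)) \<le> degree (cubic^(k+1))"
      using dc[of "2 * of_int e" "cubic^(k+1)"] by (simp add: numeral_poly)
    also have "\<dots> = 3 * (k + 1)" by (subst degree_power_eq[OF cubic_nonzero]) (simp add: degree_cubic)
    \<comment> \<open>\<open>3 (k + 1) <= 4 k + 2\<close> holds from \<open>k = 1\<close>
      on.\<close>
    also have "\<dots> \<le> 2 * p" unfolding card_eq using k_pos by simp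
    finally show ?thesis .
  qed
  ultimately have "degree ([:a4:] * T + T * x^2 + [:a4:] * x + 2 * [:a2:] * T * x - 2 * ep * cubic^(k+1)) \<le> 2 * p"
    by (intro degree_diff_le degree_add_le)
  moreover have "degree (T^2 * x) = 2 * p + 1" using dT[of 2] by (subst degree_mult_eq) (auto simp: power_eq_0_iff)
  ultimately show ?thesis unfolding N by (subst degree_add_eq_left) auto
qed

text \<open>Reducing the fraction is where the character sum enters. Since \<open>M\<close> vanishes
  on \<open>R e\<close>, the factor \<open>lin (R e)^2 lin (R 0)\<close> cancels, and nothing more
  does. The remaining numerator has degree \<open>2 p + 1 - 2 |R e| - |R 0|\<close>, one more than
  the remaining denominator.\<close>

lemma height_first:
  "int (height (to_fract N / to_fract ((T - x)^2))) = int p + 1 - e * (\<Sum>r\<in>UNIV. chi (poly cubic r))"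
proof -
  define G where "G = lin (R e)^2 * lin (R 0)"
  define G' where "G' = lin (R (-e))^2 * lin (R 0)"
  have GG: "(T - x)^2 = G * G'" unfolding lin_split G_def G'_def by Groebner_Basis.algebra
  have G0: "G \<noteq> 0" "G' \<noteq> 0" unfolding G_def G'_def using lin_nonzero by auto
  have "lin (R e) dvd M" unfolding lin_def by (rule prod_linear_dvd) (auto simp: poly_M R_def)
  moreover have dc: "lin (R 0) dvd cubic" unfolding lin_def by (rule prod_linear_dvd) (auto simp: R_def)
  ultimately have "G dvd M^2 * cubic" unfolding G_def by (intro mult_dvd_mono dvd_power_same)
  then have "G dvd N" unfolding N_def GG by (metis dvd_diff dvd_mult dvd_triv_left mult.commute)
  then obtain N' where N': "N = G * N'" by (elim dvdE)
  have "coprime N' G'"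
  proof (rule coprime_if_no_prime_dvd[OF G0(2)])
    fix q assume q: "prime_elem q" "q dvd N'" "q dvd G'"
    then have "q dvd lin (R (-e)) \<or> q dvd lin (R 0)"
      unfolding G'_def using prime_elem_dvd_mult_iff prime_elem_dvd_power by blast
    then show False
    proof
      \<comment> \<open>On \<open>R (-e)\<close> the value of \<open>M\<close> is
        \<open>-2 e\<close> and \<open>cubic\<close> is nonzero, so \<open>N\<close> does not
        vanish.\<close>
      assume "q dvd lin (R (-e))"
      then obtain r where r: "r \<in> R (-e)" "[:-r, 1:] dvd q"
        by (rule prime_dvd_prod_linear[OF finite q(1), folded lin_def])
      have "[:-r, 1:] dvd N" unfolding N' using dvd_trans[OF r(2) q(2)] by (rule dvd_mult)
      then have "poly N r = 0" by (simp add: poly_eq_0_iff_dvd)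
      moreover have "poly (T - x) r = 0" by (simp add: frobenius)
      ultimately have "poly cubic r * (poly M r)^2 = 0" unfolding N_def by simp
      moreover have "poly cubic r \<noteq> 0" using r(1) e chi_eq_0_iff[of "poly cubic r"] unfolding R_def by auto
      ultimately have "poly M r = 0" by simp
      moreover have "poly M r = - (2 * of_int e)" using r(1) unfolding R_def poly_M by simp
      ultimately show False using two e by auto
    next
      \<comment> \<open>On \<open>R 0\<close> a further cancellation would make the square of a
        linear factor divide \<open>cubic * M^2\<close>; as \<open>M\<close> is nonzero there,
        \<open>cubic\<close> would have a double root.\<close>
      assume "q dvd lin (R 0)"
      then obtain r where r: "r \<in> R 0" "[:-r, 1:] dvd q"
        by (rule prime_dvd_prod_linear[OF finite q(1), folded lin_def])
      have l: "[:-r, 1:] dvd lin (R 0)" unfolding lin_def using r(1) by (intro dvd_prodI) auto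
      have "[:-r, 1:] dvd N'" using r(2) q(2) by (rule dvd_trans)
      then have "[:-r, 1:]^2 dvd G * N'" unfolding power2_eq_square
        using l unfolding G_def by (intro mult_dvd_mono) (auto intro: dvd_mult)
      moreover have "[:-r, 1:]^2 dvd (T - x)^2" unfolding lin_split using l by (intro dvd_power_same) (auto intro: dvd_mult dvd_mult2)
      moreover have "cubic * M^2 = G * N' + ([:a2:] + T + x) * (T - x)^2" unfolding N'[symmetric] N_def by simp
      ultimately have d: "[:-r, 1:]^2 dvd cubic * M^2" by (metis dvd_add dvd_mult)
      have pr: "prime_elem [:-r, 1:]" by (simp add: prime_elem_linear_field_poly)
      have "poly M r = - of_int e" using r(1) unfolding R_def poly_M by simp
      then have "\<not> [:-r, 1:] dvd M" using e by (auto simp: poly_eq_0_iff_dvd[symmetric])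
      then have "coprime ([:-r, 1:]^2) (M^2)" using pr
        by (metis coprime_power_left_iff coprime_power_right_iff prime_elem_imp_coprime)
      then have "[:-r, 1:]^2 dvd cubic" using d coprime_dvd_mult_left_iff by blast
      then show False by (rule cubic_simple_roots)
    qed
  qed
  then have "reduced (to_fract N / to_fract ((T - x)^2)) N' G'"
    unfolding reduced_def using G0 by (simp add: N' GG)
  then have h: "height (to_fract N / to_fract ((T - x)^2)) = max (degree N') (degree G')" by (rule height_reduced)
  have N0: "N' \<noteq> 0" using degree_N N' by auto
  have dG: "degree G = 2 * card (R e) + card (R 0)" "degree G' = 2 * card (R (-e)) + card (R 0)"
    unfolding G_def G'_def by (subst degree_mult_eq; simp add: lin_nonzero degree_power_eq degree_lin)+
  have dN: "degree G + degree N' = 2 * p + 1" using degree_N N' degree_mult_eq[OF G0(1) N0] by simp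
  have cp: "p = card (R e) + card (R 0) + card (R (-e))"
    unfolding p_def using UNIV_split card_Un_disjoint[of "R e \<union> R 0" "R (-e)"] card_Un_disjoint[of "R e" "R 0"] by simp
  have "(\<Sum>r\<in>UNIV. chi (poly cubic r)) = (\<Sum>r\<in>R e \<union> R 0 \<union> R (-e). chi (poly cubic r))" using UNIV_split(1) by simp
  also have "\<dots> = (\<Sum>r\<in>R e. chi (poly cubic r)) + (\<Sum>r\<in>R 0. chi (poly cubic r)) + (\<Sum>r\<in>R (-e). chi (poly cubic r))"
    using UNIV_split(2,3) by (simp add: sum.union_disjoint)
  also have "\<dots> = e * int (card (R e)) - e * int (card (R (-e)))"
    unfolding R_def by simp
  finally have S: "e * (\<Sum>r\<in>UNIV. chi (poly cubic r)) = int (card (R e)) - int (card (R (-e)))"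
    using e by auto
  show ?thesis unfolding h S using dG dN cp by auto
qed


section \<open>The chain of points and its quadratic height\<close>

abbreviation "xf \<equiv> to_fract x"
abbreviation "lam \<equiv> to_fract cubic"
abbreviation "ef \<equiv> to_fract ep"

text \<open>The points \<open>(T, cubic ^ k) + n (x, e)\<close>. At the abscissa \<open>xf\<close>
  the chord formula divides by zero, so the results below reach only up to the first such
  point.\<close>

primrec pt :: "nat \<Rightarrow> 'a poly fract \<times> 'a poly fract" where
  "pt 0 = (to_fract T, to_fract (cubic ^ k))"
| "pt (Suc n) = (let X = fst (pt n); m = (snd (pt n) - ef) / (X - xf);
      X' = lam * m^2 - to_fract [:a2:] - X - xf in (X', - (ef + m * (X' - xf))))"

declare pt.simps(2) [simp del]

lemma to_fract_power: "to_fract (P ^ n) = to_fract P ^ n" for P :: "'a poly"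
  by (induction n) auto

lemma lam_eq: "lam = xf^3 + to_fract [:a2:] * xf^2 + to_fract [:a4:] * xf"
  unfolding cubic_def by (simp only: to_fract_add to_fract_mult to_fract_power)

lemma ef_square: "ef^2 = 1"
  unfolding to_fract_power[symmetric] ep_square by simp

definition slope :: "nat \<Rightarrow> 'a poly fract" where "slope n = (snd (pt n) - ef) / (fst (pt n) - xf)"

lemma pt_Suc: "fst (pt (Suc n)) = lam * slope n^2 - to_fract [:a2:] - fst (pt n) - xf"
  "snd (pt (Suc n)) = - (ef + slope n * (fst (pt (Suc n)) - xf))"
  by (simp_all add: pt.simps(2) slope_def Let_def)

lemma on_curve:
  assumes "\<And>m. m < n \<Longrightarrow> fst (pt m) \<noteq> xf"
  shows "lam * snd (pt n)^2 = fst (pt n)^3 + to_fract [:a2:] * fst (pt n)^2 + to_fract [:a4:] * fst (pt n)"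
  using assms
proof (induction n)
  case 0
  have "to_fract (cubic * (cubic ^ k)^2) = to_fract (T^3 + [:a2:] * T^2 + [:a4:] * T)"
    by (rule arg_cong[OF cubic_power_card])
  then show ?case by (simp only: to_fract_add to_fract_mult to_fract_power pt.simps fst_conv snd_conv)
next
  case (Suc n)
  show ?case
    by (rule chord_on_curve[OF lam_eq Suc.IH ef_square _ slope_def pt_Suc]) (use Suc.prems in auto)
qed

lemma height_0: "height (fst (pt 0)) = p"
proof -
  have "reduced (to_fract T) T 1" unfolding reduced_def by simp
  then have "height (to_fract T) = max (degree T) (degree (1 :: 'a poly))" by (rule height_reduced)
  then show ?thesis by (simp add: degree_power_eq)
qed

lemma T_neq_x: "to_fract T \<noteq> xf" using T_minus_x_nonzero by simp

lemma height_1: "int (height (fst (pt 1))) = int p + 1 - e * (\<Sum>r\<in>UNIV. chi (poly cubic r))"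
proof -
  have ne: "to_fract (T - x) \<noteq> 0" using T_minus_x_nonzero by (simp only: to_fract_eq_0_iff) simp
  have "fst (pt 1) = lam * (to_fract M / to_fract (T - x))^2 - to_fract [:a2:] - to_fract T - xf"
    unfolding One_nat_def pt_Suc slope_def M_def by simp
  also have "\<dots> = to_fract N / to_fract ((T - x)^2)"
  proof -
    have "(lam * (to_fract M / to_fract (T - x))^2 - to_fract [:a2:] - to_fract T - xf) * to_fract (T - x)^2 = to_fract N"
      unfolding N_def to_fract_diff[of "cubic * M^2"] to_fract_mult to_fract_power to_fract_add
      using ne by (simp add: power_divide left_diff_distrib distrib_right del: to_fract_diff)
    then show ?thesis using ne unfolding to_fract_power[of "T - x" 2] by (simp only: eq_divide_eq) simp
  qed
  finally show ?thesis using height_first by simp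
qed

text \<open>Subtracting \<open>(x, e)\<close> from the point \<open>Suc n\<close> returns to the
  point \<open>n\<close>, because that chord has slope \<open>- slope n\<close>. So the points
  \<open>n + 2\<close> and \<open>n\<close> are the sum and the difference to which
  \<open>height_step\<close> applies.\<close>

lemma height_rec:
  assumes "\<And>m. m \<le> Suc n \<Longrightarrow> fst (pt m) \<noteq> xf"
  shows "height (fst (pt (Suc (Suc n)))) + height (fst (pt n)) = 2 * height (fst (pt (Suc n))) + 2"
proof (rule height_step)
  show ne: "fst (pt (Suc n)) \<noteq> xf" using assms by simp
  have x2: "fst (pt n) = lam * ((snd (pt (Suc n)) + ef) / (fst (pt (Suc n)) - xf))^2 - to_fract [:a2:] - fst (pt (Suc n)) - xf"
  proof -
    have "snd (pt (Suc n)) + ef = - (slope n * (fst (pt (Suc n)) - xf))" by (simp add: pt_Suc(2))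
    then have "(snd (pt (Suc n)) + ef) / (fst (pt (Suc n)) - xf) = - slope n" using ne by simp
    then have "lam * ((snd (pt (Suc n)) + ef) / (fst (pt (Suc n)) - xf))^2 = lam * slope n ^ 2" by simp
    then show ?thesis using pt_Suc(1)[of n] by simp
  qed
  have cv: "lam * snd (pt (Suc n))^2 = fst (pt (Suc n))^3 + to_fract [:a2:] * fst (pt (Suc n))^2 + to_fract [:a4:] * fst (pt (Suc n))"
    by (rule on_curve) (use assms in auto)
  note c = chord_products[OF lam_eq cv ef_square ne pt_Suc(1)[of "Suc n", unfolded slope_def] x2]
  show "fst (pt (Suc (Suc n))) * fst (pt n) * (fst (pt (Suc n)) - xf)^2 = (fst (pt (Suc n)) * xf - to_fract [:a4:])^2"
    by (rule c)
  show "(fst (pt (Suc (Suc n))) + fst (pt n)) * (fst (pt (Suc n)) - xf)^2 =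
    2 * ((fst (pt (Suc n)) * xf + to_fract [:a4:]) * (fst (pt (Suc n)) + xf) + 2 * to_fract [:a2:] * fst (pt (Suc n)) * xf)"
    by (rule c)
qed

definition S :: int where "S = e * (\<Sum>r\<in>UNIV. chi (poly cubic r))"

text \<open>The second difference of the heights is 2, and the first two values are \<open>p\<close>
  and \<open>p + 1 - S\<close>.\<close>

lemma height_quadratic:
  assumes "\<And>m. m < n \<Longrightarrow> fst (pt m) \<noteq> xf"
  shows "int (height (fst (pt n))) = int n^2 - S * int n + int p"
  using assms
proof (induction n rule: less_induct)
  case (less n)
  consider "n = 0" | "n = 1" | m where "n = Suc (Suc m)" by (metis One_nat_def not0_implies_Suc)
  then show ?case
  proof cases
    case 1 then show ?thesis using height_0 by simp
  next
    case 2 then show ?thesis using height_1 by (simp add: S_def)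
  next
    case 3
    have "height (fst (pt n)) + height (fst (pt m)) = 2 * height (fst (pt (Suc m))) + 2"
      unfolding 3 by (rule height_rec) (use less.prems 3 in auto)
    then have "int (height (fst (pt n))) = 2 * int (height (fst (pt (Suc m)))) + 2 - int (height (fst (pt m)))"
      by linarith
    moreover have "int (height (fst (pt m))) = int m^2 - S * int m + int p"
      by (rule less.IH) (use less.prems 3 in auto)
    moreover have "int (height (fst (pt (Suc m)))) = int (Suc m)^2 - S * int (Suc m) + int p"
      by (rule less.IH) (use less.prems 3 in auto)
    ultimately have "int (height (fst (pt n))) = 2 * (int (Suc m)^2 - S * int (Suc m) + int p) + 2 - (int m^2 - S * int m + int p)"
      by simp
    also have "\<dots> = int n^2 - S * int n + int p" unfolding 3 by (simp add: algebra_simps power2_eq_square)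
    finally show ?thesis .
  qed
qed

lemma prime_not_product:
  assumes "int p = a * b" "a > 1" "b > 1" shows False
proof -
  have "int p = int (nat a * nat b)" using assms by simp
  then have "p = nat a * nat b" by (simp only: of_nat_eq_iff)
  then have "prime (nat a * nat b)" using prime_card p_def by simp
  then have "nat a = 1 \<or> nat b = 1" by (rule prime_product)
  then show False using assms by auto
qed

text \<open>Heights are nonnegative, so the quadratic cannot be negative near its vertex
  \<open>S / 2\<close>. The chain has indices \<open>n >= 0\<close> only, hence the vertex must not
  be negative.\<close>

lemma S_bound: "S^2 \<le> 4 * int p \<or> S < 0"
proof (rule ccontr)
  assume "\<not> ?thesis"
  then have big: "S^2 > 4 * int p" and pos: "S \<ge> 0" by auto
  show False
  proof (cases "\<forall>m. fst (pt m) \<noteq> xf")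
    case True
    then have nn: "int n^2 - S * int n + int p \<ge> 0" for n using height_quadratic[of n] by (metis of_nat_0_le_iff)
    \<comment> \<open>The integer at the vertex, rounded down. For odd \<open>S\<close> the vertex
      lies between \<open>n\<close> and \<open>n + 1\<close>, and only \<open>p = n (n + 1)\<close>
      is left, which is even.\<close>
    define n where "n = nat (S div 2)"
    have n: "int n = S div 2" using pos by (simp add: n_def)
    show False
    proof (cases "even S")
      case True
      then have "S = 2 * int n" using n by simp
      then show False using nn[of n] big by (simp add: power2_eq_square)
    next
      case False
      then have S: "S = 2 * int n + 1" using n by (metis add.commute odd_two_times_div_two_succ)
      have "int p \<ge> int n * (int n + 1)" using nn[of n] unfolding S by (simp add: power2_eq_square algebra_simps)
      moreover have "4 * (int n * (int n + 1)) + 1 > 4 * int p" using big unfolding S by (simp add: power2_eq_square algebra_simps)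
      ultimately have q: "int p = int n * (int n + 1)" by linarith
      have "even (int n * (int n + 1))" by simp
      then have "even p" using q by (metis even_of_nat)
      then show False using odd_card p_def by simp
    qed
  next
    case False
    then obtain m where m: "fst (pt m) = xf" "\<And>i. i < m \<Longrightarrow> fst (pt i) \<noteq> xf"
      using exists_least_iff[of "\<lambda>m. fst (pt m) = xf"] by blast
    \<comment> \<open>the chain can only meet \<open>xf\<close> at \<open>-Q\<close>, coming from \<open>-2 Q\<close>; then the quadratic is a
      perfect square and so is \<open>p\<close>\<close>
    have "m \<noteq> 0" using m(1) T_neq_x by (cases m) auto
    then obtain l where l: "m = Suc l" using not0_implies_Suc by blast
    have cv: "lam * snd (pt l)^2 = fst (pt l)^3 + to_fract [:a2:] * fst (pt l)^2 + to_fract [:a4:] * fst (pt l)"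
      by (rule on_curve) (use m l in auto)
    have "fst (pt l) * (4 * lam) = (xf^2 - to_fract [:a4:])^2"
      by (rule chord_degenerate[OF lam_eq cv ef_square _ slope_def]) (use m l pt_Suc(1)[of l] in auto)
    then have h4: "height (fst (pt l)) = 4" by (rule height_double)
    have "reduced xf x 1" unfolding reduced_def by simp
    then have "height xf = max (degree x) (degree (1 :: 'a poly))" by (rule height_reduced)
    then have h1: "height (fst (pt m)) = 1" unfolding m(1) by simp
    have 1: "1 = int m^2 - S * int m + int p" using height_quadratic[of m] m(2) h1 by simp
    have 4: "4 = int l^2 - S * int l + int p" using height_quadratic[of l] m(2) l h4 by simp
    have S: "S = 2 * int l + 4" using 1 4 unfolding l by (simp add: algebra_simps power2_eq_square)
    have "int p = (int l + 2) * (int l + 2)" using 4 unfolding S by (simp add: algebra_simps power2_eq_square)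
    then show False by (rule prime_not_product) auto
  qed
qed

end

theorem hasse_bound:
  fixes a2 a4 :: "'a::{finite_field,field_gcd}"
  assumes "prime (CARD('a))" "odd (CARD('a))" "a4 \<noteq> 0" "a2^2 \<noteq> 4 * a4"
  shows "(\<Sum>r\<in>UNIV. chi (r^3 + a2 * r^2 + a4 * r))^2 \<le> 4 * int (CARD('a))"
proof -
  let ?s = "\<Sum>r\<in>UNIV. chi (r^3 + a2 * r^2 + a4 * r)"
  \<comment> \<open>This sign makes \<open>S\<close> the absolute value of the sum.\<close>
  define e :: int where "e = (if ?s \<ge> 0 then 1 else -1)"
  interpret frobenius_chain a2 a4 e "CARD('a)" "(CARD('a) - 1) div 2"
    by unfold_locales (use assms two_nonzero[OF assms(2)] in \<open>auto simp: e_def\<close>)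
  have S: "S = e * ?s" unfolding S_def poly_cubic ..
  then have "S \<ge> 0" by (auto simp: e_def)
  then have "S^2 \<le> 4 * int (CARD('a))" using S_bound by linarith
  moreover have "S^2 = ?s^2" unfolding S using e by auto
  ultimately show ?thesis by simp
qed

section \<open>Sign patterns of the quadratic character\<close>

lemma sum_chi:
  assumes "odd (CARD('a::{finite_field,field_gcd}))"
  shows "(\<Sum>z\<in>UNIV. chi (z - r :: 'a)) = 0"
proof -
  let ?k = "(CARD('a) - 1) div 2"
  have shift: "(\<Sum>z\<in>UNIV. chi (z - r)) = (\<Sum>z\<in>(UNIV::'a set). chi z)"
    by (rule sum.reindex_bij_witness[of _ "\<lambda>z. z + r" "\<lambda>z. z - r"]) auto
  have c2: "CARD('a) > 2" using assms card_mono[of UNIV "{0,1::'a}"]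
    by (metis One_nat_def Suc_1 card_2_iff even_Suc finite le_neq_implies_less subset_UNIV zero_neq_one even_zero)
  have k: "?k > 0" "?k < CARD('a) - 1" using c2 by auto
  \<comment> \<open>Without a non-square all \<open>CARD('a) - 1\<close> nonzero elements would be
    roots of a polynomial of half that degree.\<close>
  have "\<exists>n::'a. n \<noteq> 0 \<and> chi n = -1"
  proof (rule ccontr)
    assume "\<not> ?thesis"
    then have all: "chi z = 1" if "z \<noteq> 0" for z :: 'a using that chi_values[of z] chi_eq_0_iff[of z] by blast
    let ?P = "monom 1 ?k - 1 :: 'a poly"
    have "degree ?P \<le> ?k" by (intro degree_diff_le) (auto simp: degree_monom_le)
    moreover have P0: "?P \<noteq> 0"
    proof
      assume "?P = 0"
      then have "coeff ?P ?k = 0" by simp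
      then show False using k by (simp add: coeff_1)
    qed
    moreover have "UNIV - {0} \<subseteq> {z. poly ?P z = 0}"
    proof
      fix z :: 'a assume "z \<in> UNIV - {0}"
      then have "z ^ ?k = 1" using all[of z] unfolding chi_def by (auto split: if_splits)
      then show "z \<in> {z. poly ?P z = 0}" by (simp add: poly_monom)
    qed
    then have "card (UNIV - {0::'a}) \<le> card {z. poly ?P z = 0}" by (rule card_mono[rotated]) simp
    ultimately have "CARD('a) - 1 \<le> ?k" using card_poly_roots_bound[OF P0] by (simp add: card_Diff_singleton)
    then show False using k by simp
  qed
  then obtain n :: 'a where n: "n \<noteq> 0" "chi n = -1" by blast
  \<comment> \<open>Multiplication by a non-square permutes the field and negates the sum.\<close>
  have "(\<Sum>z\<in>UNIV. chi (n * z)) = (\<Sum>z\<in>(UNIV::'a set). chi z)"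
    by (rule sum.reindex_bij_witness[of _ "\<lambda>z. z / n" "\<lambda>z. n * z"]) (use n in auto)
  then have "- (\<Sum>z\<in>(UNIV::'a set). chi z) = (\<Sum>z\<in>(UNIV::'a set). chi z)"
    by (simp add: chi_mult[OF assms] n sum_negf)
  then show ?thesis using shift by simp
qed

lemma chi_square:
  assumes "odd (CARD('a::finite_field))" "(z::'a) \<noteq> 0"
  shows "chi z * chi z = 1" "chi (z * z) = 1" 
  using assms chi_values[of z] by (auto simp: chi_mult)

lemma chi_divide:
  assumes "odd (CARD('a::finite_field))" "(z::'a) \<noteq> 0"
  shows "chi (y / z) = chi y * chi z"
proof -
  have "chi (y / z) * (chi z * chi z) = chi (y / z * z) * chi z" by (simp only: chi_mult[OF assms(1)] mult.assoc)
  also have "\<dots> = chi y * chi z" using assms by simp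
  finally show ?thesis using chi_square(1)[OF assms] by simp
qed

text \<open>The product has the character of \<open>(z - r) / (z - t)\<close>, which takes every
  value except 1 exactly once. The full sum is 0, so \<open>- chi 1\<close> remains.\<close>

lemma sum_chi_pair:
  assumes "odd (CARD('a::{finite_field,field_gcd}))" "r \<noteq> (t::'a)"
  shows "(\<Sum>z\<in>UNIV. chi (z - r) * chi (z - t)) = -1"
proof -
  have "(\<Sum>z\<in>UNIV. chi (z - r) * chi (z - t)) = (\<Sum>z\<in>UNIV - {t}. chi (z - r) * chi (z - t))"
    by (rule sum.mono_neutral_right) auto
  also have "\<dots> = (\<Sum>z\<in>UNIV - {t}. chi (1 + (t - r) / (z - t)))"
  proof (rule sum.cong[OF refl])
    fix z assume z: "z \<in> UNIV - {t}"
    then have "1 + (t - r) / (z - t) = (z - r) / (z - t)" by (simp add: field_simps)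
    then show "chi (z - r) * chi (z - t) = chi (1 + (t - r) / (z - t))"
      using chi_divide[OF assms(1), of "z - t"] z by simp
  qed
  also have "\<dots> = (\<Sum>w\<in>UNIV - {1::'a}. chi (w - 0))"
    by (rule sum.reindex_bij_witness[of _ "\<lambda>w. t + (t - r) / (w - 1)" "\<lambda>z. 1 + (t - r) / (z - t)"])
       (use assms in \<open>auto simp: field_simps\<close>)
  also have "\<dots> = (\<Sum>w\<in>(UNIV::'a set). chi (w - 0)) - chi (1::'a)"
    by (subst sum_diff1) auto
  also have "\<dots> = - chi (1::'a)" by (simp only: sum_chi[OF assms(1)])
  also have "chi (1::'a) = 1" by (simp add: chi_def)
  finally show ?thesis by simp
qed

text \<open>Translating \<open>r\<close> to 0 gives the cubic of \<open>hasse_bound\<close>, with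
  \<open>a2^2 - 4 a4 = (t - u)^2\<close>.\<close>

lemma sum_chi_triple:
  fixes r t u :: "'a::{finite_field,field_gcd}"
  assumes p: "prime (CARD('a))" "odd (CARD('a))" and d: "r \<noteq> t" "r \<noteq> u" "t \<noteq> u"
  shows "\<bar>real_of_int (\<Sum>z\<in>UNIV. chi (z - r) * chi (z - t) * chi (z - u))\<bar> \<le> 2 * sqrt (CARD('a))"
proof -
  define v w where "v = t - r" "w = u - r"
  note vw = this
  have "(\<Sum>z\<in>UNIV. chi (z - r) * chi (z - t) * chi (z - u)) = (\<Sum>z\<in>UNIV. chi (z^3 + (-(v+w)) * z^2 + (v*w) * z))"
  proof (rule sum.reindex_bij_witness[of _ "\<lambda>z. z + r" "\<lambda>z. z - r"])
    fix z :: 'a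
    have "(z - r)^3 + (-(v+w)) * (z - r)^2 + (v*w) * (z - r) = (z - r) * (z - t) * (z - u)"
      unfolding vw by Groebner_Basis.algebra
    then show "chi ((z - r)^3 + (-(v+w)) * (z - r)^2 + (v*w) * (z - r)) = chi (z - r) * chi (z - t) * chi (z - u)"
      by (simp only: chi_mult[OF p(2)])
  qed auto
  moreover have "v * w \<noteq> 0" using d vw by simp
  moreover have "(-(v+w))^2 - 4 * (v * w) = (t - u)^2" unfolding vw by Groebner_Basis.algebra
  then have "(-(v+w))^2 \<noteq> 4 * (v * w)" using d(3) by auto
  moreover define Sv where "Sv = (\<Sum>z\<in>UNIV. chi (z - r) * chi (z - t) * chi (z - u))"
  ultimately have "Sv^2 \<le> 4 * int (CARD('a))"
    using hasse_bound[OF p, of "v*w" "-(v+w)"] by presburger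
  then have "real_of_int (Sv^2) \<le> real_of_int (4 * int (CARD('a)))" by (simp only: of_int_le_iff)
  then have "\<bar>real_of_int Sv\<bar>^2 \<le> (2 * sqrt (CARD('a)))^2" by (simp add: power_mult_distrib)
  then have "\<bar>real_of_int Sv\<bar> \<le> 2 * sqrt (CARD('a))" by (rule power2_le_imp_le) simp
  then show ?thesis unfolding Sv_def .
qed

text \<open>The substitution \<open>z -> 1 / (z - q)\<close> sends the root \<open>q\<close> to
  infinity and leaves a cubic. It misses the value 0, whose term accounts for the
  \<open>+ 1\<close>.\<close>

lemma sum_chi_quadruple:
  fixes q r t u :: "'a::{finite_field,field_gcd}"
  assumes p: "prime (CARD('a))" "odd (CARD('a))" and d: "q \<noteq> r" "q \<noteq> t" "q \<noteq> u" "r \<noteq> t" "r \<noteq> u" "t \<noteq> u"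
  shows "\<bar>real_of_int (\<Sum>z\<in>UNIV. chi (z - q) * chi (z - r) * chi (z - t) * chi (z - u)) + 1\<bar> \<le> 2 * sqrt (CARD('a))"
proof -
  define x y w where "x = r - q" "y = t - q" "w = u - q"
  note xyw = this
  have nz: "x \<noteq> 0" "y \<noteq> 0" "w \<noteq> 0" using d xyw by auto
  let ?G = "\<lambda>z. chi (z - 1/x) * chi (z - 1/y) * chi (z - 1/w)"
  have "(\<Sum>z\<in>UNIV. chi (z - q) * chi (z - r) * chi (z - t) * chi (z - u))
    = (\<Sum>z\<in>UNIV - {q}. chi (z - q) * chi (z - r) * chi (z - t) * chi (z - u))"
    by (rule sum.mono_neutral_right) auto
  also have "\<dots> = (\<Sum>z\<in>UNIV - {0}. chi (- x * y * w) * ?G z)"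
  proof (rule sum.reindex_bij_witness[of _ "\<lambda>z. q + 1 / z" "\<lambda>z. 1 / (z - q)"])
    fix z assume "z \<in> UNIV - {q}"
    then have z: "z - q \<noteq> 0" by simp
    have f: "1 / (z - q) - 1 / v = (v - (z - q)) / ((z - q) * v)" if "v \<noteq> 0" for v
      using z that by (simp add: diff_frac_eq)
    \<comment> \<open>The factor \<open>(z - q)^4\<close> clears the denominators without changing
      the character.\<close>
    have "(- x * y * w) * ((1 / (z - q) - 1/x) * (1 / (z - q) - 1/y) * (1 / (z - q) - 1/w)) * ((z - q) * (z - q) * ((z - q) * (z - q)))
        = (z - q) * (z - r) * (z - t) * (z - u)"
    proof -
      have g: "(- x * y * w) * (A * B * C) * (D * D * (D * D)) = - ((x * A * D) * (y * B * D) * (w * C * D)) * D"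
        for A B C D :: 'a by Groebner_Basis.algebra
      have h: "x * (1 / (z - q) - 1/x) * (z - q) = - (z - r)" "y * (1 / (z - q) - 1/y) * (z - q) = - (z - t)"
        "w * (1 / (z - q) - 1/w) * (z - q) = - (z - u)"
        unfolding f[OF nz(1)] f[OF nz(2)] f[OF nz(3)] using z nz by (simp_all add: xyw)
      have m: "(- x * y * w) * ((1 / (z - q) - 1/x) * (1 / (z - q) - 1/y) * (1 / (z - q) - 1/w)) * ((z - q) * (z - q) * ((z - q) * (z - q)))
       = - ((x * (1 / (z - q) - 1/x) * (z - q)) * (y * (1 / (z - q) - 1/y) * (z - q)) * (w * (1 / (z - q) - 1/w) * (z - q))) * (z - q)"
        by (rule g)
      show ?thesis unfolding m h by Groebner_Basis.algebra
    qed
    then have "chi ((- x * y * w) * ((1 / (z - q) - 1/x) * (1 / (z - q) - 1/y) * (1 / (z - q) - 1/w)) * ((z - q) * (z - q) * ((z - q) * (z - q))))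
       = chi ((z - q) * (z - r) * (z - t) * (z - u))" by simp
    then have "chi (- x * y * w) * ?G (1 / (z - q)) * chi ((z - q) * (z - q)) * chi ((z - q) * (z - q))
       = chi (z - q) * chi (z - r) * chi (z - t) * chi (z - u)" by (simp only: chi_mult[OF p(2)] mult_ac)
    then show "chi (- x * y * w) * ?G (1 / (z - q)) = chi (z - q) * chi (z - r) * chi (z - t) * chi (z - u)"
      unfolding chi_square(2)[OF p(2) z] by simp
  qed auto
  also have "\<dots> = (\<Sum>z\<in>UNIV. chi (- x * y * w) * ?G z) - chi (- x * y * w) * ?G 0"
    by (subst sum_diff1) auto
  also have "chi (- x * y * w) * ?G 0 = chi ((- x * y * w) * ((0 - 1/x) * (0 - 1/y) * (0 - 1/w)))"
    by (simp only: chi_mult[OF p(2)])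
  also have "(- x * y * w) * ((0 - 1/x) * (0 - 1/y) * (0 - 1/w)) = 1" using nz by (simp add: field_simps)
  also have "chi (1::'a) = 1" by (simp add: chi_def)
  also have "(\<Sum>z\<in>UNIV. chi (- x * y * w) * ?G z) = chi (- x * y * w) * (\<Sum>z\<in>UNIV. ?G z)" by (simp only: sum_distrib_left)
  finally have e: "real_of_int (\<Sum>z\<in>UNIV. chi (z - q) * chi (z - r) * chi (z - t) * chi (z - u)) + 1
     = real_of_int (chi (- x * y * w)) * real_of_int (\<Sum>z\<in>UNIV. ?G z)" by simp
  have "\<bar>real_of_int (chi (- x * y * w))\<bar> = 1" using chi_values[of "- x * y * w"] nz by auto
  moreover have "\<bar>real_of_int (\<Sum>z\<in>UNIV. ?G z)\<bar> \<le> 2 * sqrt (CARD('a))"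
    by (rule sum_chi_triple[OF p]) (use nz d xyw in \<open>auto simp: field_simps\<close>)
  ultimately show ?thesis unfolding e abs_mult by simp
qed

text \<open>The product \<open>F\<close> of the four factors of the form \<open>1 + ei * chi\<close>
  vanishes outside 0 and 1 at every \<open>z\<close> that is no solution; at \<open>a\<close> and
  \<open>b\<close> one factor is 1, which matches the two alternatives. Without solutions
  \<open>F\<close> sums to at most 16, but its expansion gives at least
  \<open>p - 7 - 10 sqrt p\<close>. From the prime 149 on this is impossible.\<close>

lemma sign_pattern_exists:
  fixes a b :: "'a::{finite_field,field_gcd}"
  assumes p: "prime (CARD('a))" "odd (CARD('a))" "CARD('a) \<ge> 149"
    and d: "a \<noteq> 0" "a \<noteq> 1" "b \<noteq> 0" "b \<noteq> 1" "a \<noteq> b"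
    and e: "\<bar>e0\<bar> = 1" "\<bar>e1\<bar> = 1" "\<bar>e2\<bar> = 1" "\<bar>e3\<bar> = (1::int)"
  shows "\<exists>s. chi s = e0 \<and> chi (s - 1) = e1 \<and> (s = a \<or> chi (s - a) = e2) \<and> (s = b \<or> chi (s - b) = e3)"
proof (rule ccontr)
  assume neg: "\<not> ?thesis"
  define f0 f1 f2 f3 where "f0 z = e0 * chi (z - 0)" and "f1 z = e1 * chi (z - 1)"
    and "f2 z = e2 * chi (z - a)" and "f3 z = e3 * chi (z - b)" for z :: 'a
  note f = f0_def f1_def f2_def f3_def
  define F where "F z = (1 + f0 z) * (1 + f1 z) * (1 + f2 z) * (1 + f3 z)" for z
  have es: "e0 = 1 \<or> e0 = -1" "e1 = 1 \<or> e1 = -1" "e2 = 1 \<or> e2 = -1" "e3 = 1 \<or> e3 = -1" using e by auto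
  have F0: "F z = 0" if z: "z \<noteq> 0" "z \<noteq> 1" for z
  proof -
    have "chi z \<noteq> e0 \<or> chi (z - 1) \<noteq> e1 \<or> (z \<noteq> a \<and> chi (z - a) \<noteq> e2) \<or> (z \<noteq> b \<and> chi (z - b) \<noteq> e3)"
      using neg by blast
    moreover have k: "1 + ei * chi w = 0" if "w \<noteq> 0" "chi w \<noteq> ei" "ei = 1 \<or> ei = -1" for ei and w :: 'a
      using that chi_values[of w] by auto
    have "chi z \<noteq> e0 \<Longrightarrow> 1 + f0 z = 0" "chi (z - 1) \<noteq> e1 \<Longrightarrow> 1 + f1 z = 0"
      "z \<noteq> a \<and> chi (z - a) \<noteq> e2 \<Longrightarrow> 1 + f2 z = 0" "z \<noteq> b \<and> chi (z - b) \<noteq> e3 \<Longrightarrow> 1 + f3 z = 0"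
      unfolding f using z es by (simp_all add: k)
    ultimately show ?thesis unfolding F_def by (elim disjE) simp_all
  qed
  have F8: "F z \<le> 8" if z: "z = 0 \<or> z = 1" for z
  proof -
    have b: "0 \<le> 1 + ei * chi w \<and> 1 + ei * chi w \<le> 2" if "ei = 1 \<or> ei = -1" for ei and w :: 'a
      using that chi_values[of w] by auto
    have b0: "0 \<le> 1 + f0 z \<and> 1 + f0 z \<le> 2" "0 \<le> 1 + f1 z \<and> 1 + f1 z \<le> 2" "0 \<le> 1 + f2 z \<and> 1 + f2 z \<le> 2" "0 \<le> 1 + f3 z \<and> 1 + f3 z \<le> 2"
      unfolding f using b es by auto
    have "(1 + f0 z) * (1 + f1 z) \<le> 2"
    proof -
      \<comment> \<open>At 0 and at 1 one of the first two factors is 1 and each of the others is at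
        most 2.\<close>
      from z have "1 + f0 z = 1 \<or> 1 + f1 z = 1" unfolding f by auto
      then show ?thesis using b0 by auto
    qed
    moreover have "(1 + f2 z) * (1 + f3 z) \<le> 2 * 2" using b0 by (intro mult_mono) auto
    ultimately have "((1 + f0 z) * (1 + f1 z)) * ((1 + f2 z) * (1 + f3 z)) \<le> 2 * (2 * 2)"
      using b0 by (intro mult_mono) auto
    then show ?thesis unfolding F_def by (simp add: mult.assoc)
  qed
  have "(\<Sum>z\<in>UNIV. F z) = (\<Sum>z\<in>{0,1}. F z)"
    by (rule sum.mono_neutral_right) (use F0 in auto)
  also have "\<dots> \<le> 16" using F8[of 0] F8[of 1] by simp
  finally have up: "(\<Sum>z\<in>UNIV. F z) \<le> 16" .
  have exp: "F z = 1 + (f0 z + f1 z + f2 z + f3 z)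
     + (f0 z * f1 z + f0 z * f2 z + f0 z * f3 z + f1 z * f2 z + f1 z * f3 z + f2 z * f3 z)
     + (f0 z * f1 z * f2 z + f0 z * f1 z * f3 z + f0 z * f2 z * f3 z + f1 z * f2 z * f3 z)
     + f0 z * f1 z * f2 z * f3 z" for z
    unfolding F_def by Groebner_Basis.algebra
  have s1: "(\<Sum>z\<in>UNIV. f0 z) = 0" "(\<Sum>z\<in>UNIV. f1 z) = 0" "(\<Sum>z\<in>UNIV. f2 z) = 0" "(\<Sum>z\<in>UNIV. f3 z) = 0"
    unfolding f sum_distrib_left[symmetric] sum_chi[OF p(2)] by simp_all
  have g2: "(\<Sum>z\<in>UNIV. (ei * chi (z - r)) * (ej * chi (z - t))) \<ge> -1" if "r \<noteq> t" "\<bar>ei\<bar> = 1" "\<bar>ej\<bar> = 1"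
    for ei ej and r t :: 'a
  proof -
    have "(\<Sum>z\<in>UNIV. (ei * chi (z - r)) * (ej * chi (z - t))) = (\<Sum>z\<in>UNIV. (ei * ej) * (chi (z - r) * chi (z - t)))"
      by (simp only: mult_ac)
    also have "\<dots> = - (ei * ej)" unfolding sum_distrib_left[symmetric] sum_chi_pair[OF p(2) that(1)] by simp
    also have "\<dots> \<ge> -1" using that(2,3) by (auto simp: abs_if split: if_splits)
    finally show ?thesis .
  qed
  have s2: "(\<Sum>z\<in>UNIV. f0 z * f1 z) \<ge> -1" "(\<Sum>z\<in>UNIV. f0 z * f2 z) \<ge> -1" "(\<Sum>z\<in>UNIV. f0 z * f3 z) \<ge> -1"
    "(\<Sum>z\<in>UNIV. f1 z * f2 z) \<ge> -1" "(\<Sum>z\<in>UNIV. f1 z * f3 z) \<ge> -1" "(\<Sum>z\<in>UNIV. f2 z * f3 z) \<ge> -1"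
    unfolding f by (rule g2; use d e in auto)+
  let ?q = "2 * sqrt (CARD('a))"
  have g3: "real_of_int (\<Sum>z\<in>UNIV. (ei * chi (z - r)) * (ej * chi (z - t)) * (ek * chi (z - u))) \<ge> - ?q"
    if "r \<noteq> t" "r \<noteq> u" "t \<noteq> u" "\<bar>ei\<bar> = 1" "\<bar>ej\<bar> = 1" "\<bar>ek\<bar> = 1" for ei ej ek and r t u :: 'a
  proof -
    have "(\<Sum>z\<in>UNIV. (ei * chi (z - r)) * (ej * chi (z - t)) * (ek * chi (z - u))) = (\<Sum>z\<in>UNIV. (ei * ej * ek) * (chi (z - r) * chi (z - t) * chi (z - u)))"
      by (simp only: mult_ac)
    also have "\<dots> = (ei * ej * ek) * (\<Sum>z\<in>UNIV. chi (z - r) * chi (z - t) * chi (z - u))" by (simp only: sum_distrib_left)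
    finally have "\<bar>real_of_int (\<Sum>z\<in>UNIV. (ei * chi (z - r)) * (ej * chi (z - t)) * (ek * chi (z - u)))\<bar> 
        = \<bar>real_of_int (\<Sum>z\<in>UNIV. chi (z - r) * chi (z - t) * chi (z - u))\<bar>"
      using that by (simp add: abs_mult of_int_abs[symmetric] del: of_int_sum of_int_abs)
    then show ?thesis using sum_chi_triple[OF p(1,2) that(1-3)] by linarith
  qed
  have s3: "real_of_int (\<Sum>z\<in>UNIV. f0 z * f1 z * f2 z) \<ge> - ?q" "real_of_int (\<Sum>z\<in>UNIV. f0 z * f1 z * f3 z) \<ge> - ?q"
    "real_of_int (\<Sum>z\<in>UNIV. f0 z * f2 z * f3 z) \<ge> - ?q" "real_of_int (\<Sum>z\<in>UNIV. f1 z * f2 z * f3 z) \<ge> - ?q"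
    unfolding f by (rule g3; use d e in auto)+
  have s4: "real_of_int (\<Sum>z\<in>UNIV. f0 z * f1 z * f2 z * f3 z) \<ge> - ?q - 1"
  proof -
    let ?Q = "\<Sum>z\<in>UNIV. chi (z - 0) * chi (z - 1) * chi (z - a) * chi (z - b)"
    have "(\<Sum>z\<in>UNIV. f0 z * f1 z * f2 z * f3 z) = (\<Sum>z\<in>UNIV. (e0 * e1 * e2 * e3) * (chi (z - 0) * chi (z - 1) * chi (z - a) * chi (z - b)))"
      unfolding f by (simp only: mult_ac)
    also have "\<dots> = (e0 * e1 * e2 * e3) * ?Q" by (simp only: sum_distrib_left)
    finally have "\<bar>real_of_int (\<Sum>z\<in>UNIV. f0 z * f1 z * f2 z * f3 z)\<bar> = \<bar>real_of_int ?Q\<bar>"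
      using e by (simp add: abs_mult of_int_abs[symmetric] del: of_int_sum of_int_abs)
    moreover have "\<bar>real_of_int ?Q + 1\<bar> \<le> ?q" by (rule sum_chi_quadruple[OF p(1,2)]) (use d in auto)
    ultimately show ?thesis by linarith
  qed
  have aux: "real_of_int S \<ge> real N - 6 - 4 * q - q - 1"
    if "S = int N + (A0 + A1 + A2 + A3) + (B1 + B2 + B3 + B4 + B5 + B6) + (C1 + C2 + C3 + C4) + D"
      "A0 = 0" "A1 = 0" "A2 = 0" "A3 = 0" "B1 \<ge> -1" "B2 \<ge> -1" "B3 \<ge> -1" "B4 \<ge> -1" "B5 \<ge> -1" "B6 \<ge> -1"
      "real_of_int C1 \<ge> -q" "real_of_int C2 \<ge> -q" "real_of_int C3 \<ge> -q" "real_of_int C4 \<ge> -q" "real_of_int D \<ge> -q - 1"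
    for S A0 A1 A2 A3 B1 B2 B3 B4 B5 B6 C1 C2 C3 C4 D :: int and N :: nat and q :: real
  proof -
    have b: "real_of_int B \<ge> -1" if "B \<ge> -1" for B :: int
      using that by (metis of_int_le_iff of_int_minus of_int_1)
    have "real_of_int S = real N + (real_of_int B1 + real_of_int B2 + real_of_int B3 + real_of_int B4 + real_of_int B5 + real_of_int B6)
      + (real_of_int C1 + real_of_int C2 + real_of_int C3 + real_of_int C4) + real_of_int D" unfolding that(1-5) by simp
    then show ?thesis using that(6-11)[THEN b] that(12-16) by linarith
  qed
  have "(\<Sum>z\<in>UNIV. F z) = int (CARD('a)) + ((\<Sum>z\<in>UNIV. f0 z) + (\<Sum>z\<in>UNIV. f1 z) + (\<Sum>z\<in>UNIV. f2 z) + (\<Sum>z\<in>UNIV. f3 z))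
    + ((\<Sum>z\<in>UNIV. f0 z * f1 z) + (\<Sum>z\<in>UNIV. f0 z * f2 z) + (\<Sum>z\<in>UNIV. f0 z * f3 z) + (\<Sum>z\<in>UNIV. f1 z * f2 z) + (\<Sum>z\<in>UNIV. f1 z * f3 z) + (\<Sum>z\<in>UNIV. f2 z * f3 z))
    + ((\<Sum>z\<in>UNIV. f0 z * f1 z * f2 z) + (\<Sum>z\<in>UNIV. f0 z * f1 z * f3 z) + (\<Sum>z\<in>UNIV. f0 z * f2 z * f3 z) + (\<Sum>z\<in>UNIV. f1 z * f2 z * f3 z))
    + (\<Sum>z\<in>UNIV. f0 z * f1 z * f2 z * f3 z)"
    unfolding exp sum.distrib by simp
  then have "real_of_int (\<Sum>z\<in>UNIV. F z) \<ge> real (CARD('a)) - 6 - 4 * ?q - ?q - 1"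
    by (rule aux[OF _ s1 s2 s3 s4])
  then have "16 \<ge> real (CARD('a)) - 7 - 10 * sqrt (CARD('a))" using up by (simp del: of_int_sum)
  \<comment> \<open>\<open>12.2^2 = 148.84\<close>. Completing the square gives
    \<open>p - 10 sqrt p >= 7.2^2 - 25 = 26.84\<close>, while the two bounds together allow at most
    23.\<close>
  moreover have "sqrt (CARD('a)) \<ge> 12.2" using p(3) by (intro real_le_rsqrt) (simp add: power2_eq_square)
  then have "(sqrt (CARD('a)) - 5)^2 \<ge> 7.2^2" by (intro power_mono) auto
  then have "real (CARD('a)) - 10 * sqrt (CARD('a)) + 25 \<ge> 51.84" by (simp add: power2_eq_square algebra_simps)
  ultimately show False by simp
qed

section \<open>Orthomorphisms through three points\<close>

text \<open>On the finite groups considered here injectivity amounts to bijectivity.\<close>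

definition orthomorphism :: "('a::ab_group_add \<Rightarrow> 'a) \<Rightarrow> bool" where
  "orthomorphism f \<longleftrightarrow> inj f \<and> inj (\<lambda>x. f x - x)"

text \<open>Each slope belongs to the side opposite the point over \<open>x\<close>,
  \<open>y\<close>, \<open>z\<close> respectively. Distinct slopes fix the triangle up to
  translation and scaling.\<close>

definition slopes_occur :: "'a::field \<Rightarrow> 'a \<Rightarrow> 'a \<Rightarrow> bool" where
  "slopes_occur a b c \<longleftrightarrow> (\<exists>f x y z. orthomorphism f \<and> x \<noteq> y \<and> y \<noteq> z \<and> x \<noteq> z \<and>
     f z - f y = a * (z - y) \<and> f z - f x = b * (z - x) \<and> f y - f x = c * (y - x))"

lemma slopes_occurI:
  assumes "orthomorphism f" "x \<noteq> y" "y \<noteq> z" "x \<noteq> z"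
    "f z - f y = a * (z - y)" "f z - f x = b * (z - x)" "f y - f x = c * (y - x)"
  shows "slopes_occur a b c"
  unfolding slopes_occur_def using assms by blast

section \<open>Symmetries of the slope triple\<close>

lemma slopes_occur_swap12:
  assumes "slopes_occur a b c" shows "slopes_occur b a c"
proof -
  obtain f x y z where f: "orthomorphism f" "x \<noteq> y" "y \<noteq> z" "x \<noteq> z"
    "f z - f y = a * (z - y)" "f z - f x = b * (z - x)" "f y - f x = c * (y - x)"
    using assms unfolding slopes_occur_def by blast
  have "f x - f y = c * (x - y)" using f(7) by Groebner_Basis.algebra
  then show ?thesis using f by (intro slopes_occurI[OF f(1), of y x z]) auto
qed

lemma slopes_occur_swap23:
  assumes "slopes_occur a b c" shows "slopes_occur a c b"
proof -
  obtain f x y z where f: "orthomorphism f" "x \<noteq> y" "y \<noteq> z" "x \<noteq> z"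
    "f z - f y = a * (z - y)" "f z - f x = b * (z - x)" "f y - f x = c * (y - x)"
    using assms unfolding slopes_occur_def by blast
  have "f y - f z = a * (y - z)" using f(5) by Groebner_Basis.algebra
  then show ?thesis using f by (intro slopes_occurI[OF f(1), of x z y]) auto
qed

text \<open>With \<open>f\<close> also \<open>u -> u - f u\<close> is an orthomorphism.\<close>

lemma slopes_occur_one_minus:
  assumes "slopes_occur a b c" shows "slopes_occur (1 - a) (1 - b) (1 - c)"
proof -
  obtain f x y z where f: "orthomorphism f" "x \<noteq> y" "y \<noteq> z" "x \<noteq> z"
    "f z - f y = a * (z - y)" "f z - f x = b * (z - x)" "f y - f x = c * (y - x)"
    using assms unfolding slopes_occur_def by blast
  let ?g = "\<lambda>u. u - f u"
  have i: "inj f" "inj (\<lambda>u. f u - u)" using f(1) by (auto simp: orthomorphism_def)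
  have "inj ?g"
  proof (rule injI)
    fix u v assume "u - f u = v - f v"
    then have "f u - u = f v - v" by (metis minus_diff_eq)
    then show "u = v" using injD[OF i(2)] by blast
  qed
  moreover have "inj (\<lambda>u. ?g u - u)"
    by (rule injI) (use injD[OF i(1)] in auto)
  ultimately have "orthomorphism ?g" unfolding orthomorphism_def ..
  then show ?thesis
    by (rule slopes_occurI[OF _ f(2-4)]) (use f(5-7) in \<open>simp_all add: algebra_simps\<close>)
qed

text \<open>Passing to the inverse map reflects the graph in the diagonal.\<close>

lemma slopes_occur_inverse:
  fixes a b c :: "'a::{field,finite}"
  assumes "slopes_occur a b c" "a \<noteq> 0" "b \<noteq> 0" "c \<noteq> 0"
  shows "slopes_occur (1 / a) (1 / b) (1 / c)"
proof -
  obtain f x y z where f: "orthomorphism f" "x \<noteq> y" "y \<noteq> z" "x \<noteq> z"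
    "f z - f y = a * (z - y)" "f z - f x = b * (z - x)" "f y - f x = c * (y - x)"
    using assms unfolding slopes_occur_def by blast
  have i: "inj f" "inj (\<lambda>u. f u - u)" using f(1) by (auto simp: orthomorphism_def)
  have s: "surj f" by (rule finite_UNIV_inj_surj[OF finite i(1)])
  define h where "h = inv_into UNIV f"
  have g: "h (f u) = u" "f (h u) = u" for u unfolding h_def using i(1) s by (simp_all add: surj_f_inv_f)
  have "inj h" by (rule injI) (metis g(2))
  moreover have "inj (\<lambda>u. h u - u)"
  proof (rule injI)
    fix u v assume "h u - u = h v - v"
    then have "f (h u) - h u = f (h v) - h v" by (metis g(2) minus_diff_eq)
    then have "h u = h v" using injD[OF i(2)] by blast
    then show "u = v" by (metis g(2))
  qed
  ultimately have "orthomorphism h" unfolding orthomorphism_def ..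
  then show ?thesis
    by (rule slopes_occurI[of _ "f x" "f y" "f z"]) (use f assms(2-4) i(1) in \<open>auto simp: g inj_eq\<close>)
qed

text \<open>In the quadratic orthomorphism \<open>f\<close> the points over \<open>u\<close> and
  \<open>v\<close> lie on the line of slope \<open>c\<close>, and the point over 1 on the line of
  slope \<open>s\<close>. If \<open>s = a\<close> or \<open>s = b\<close>, then \<open>v\<close> or
  \<open>u\<close> is 0, and the origin lies on the first line too.\<close>

lemma slopes_occur_quadratic:
  fixes a b c s :: "'a::finite_field"
  assumes odd: "odd (CARD('a))" and d: "a \<noteq> b" "a \<noteq> c" "b \<noteq> c" and c: "c \<noteq> 0" "c \<noteq> 1"
    and s: "chi s = chi c" "chi (s - 1) = chi (c - 1)"
      "s = a \<or> chi (s - a) = - chi (c - a)" "s = b \<or> chi (s - b) = - chi (c - b)"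
  shows "slopes_occur a b c"
proof -
  have s0: "s \<noteq> 0" "s - 1 \<noteq> 0" using s(1,2) c chi_eq_0_iff[of c] chi_eq_0_iff[of "c - 1"] chi_0 by (metis, metis right_minus_eq)
  have sc: "s \<noteq> c"
  proof
    assume "s = c"
    then have "chi (c - a) = 0" using s(3) d by auto
    then show False using d by simp
  qed
  \<comment> \<open>The solutions of \<open>s - c u = b (1 - u)\<close> and
    \<open>s - c v = a (1 - v)\<close>.\<close>
  define u v where "u = (s - b) / (c - b)" "v = (s - a) / (c - a)"
  note uv = this
  define f where "f z = (if chi z = 1 then s * z else c * z)" for z
  have one: "chi (1::'a) = 1" by (simp add: chi_def)
  have not1: "chi ((s - r) / (c - r)) \<noteq> 1" if "s = r \<or> chi (s - r) = - chi (c - r)" "c \<noteq> r" for r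
  proof (cases "s = r")
    case False
    then have "chi ((s - r) / (c - r)) = - (chi (c - r) * chi (c - r))" using that chi_divide[OF odd, of "c - r"] by simp
    then show ?thesis using chi_square(1)[OF odd, of "c - r"] that by simp
  qed simp
  have fu: "f u = c * u" "f v = c * v" "f 1 = s"
    unfolding f_def uv using not1 s d one by auto
  \<comment> \<open>Multipliers of equal character keep the image of the nonzero squares disjoint
    from the image of the other elements.\<close>
  have inj_two: "inj (\<lambda>z. if chi z = 1 then m * z else n * z)" if mn: "chi m = chi n" "m \<noteq> 0" for m n :: 'a
  proof -
    have n0: "n \<noteq> 0" using mn by (metis chi_eq_0_iff)
    have no: False if "chi z = 1" "chi w \<noteq> 1" "m * z = n * w" for z w
    proof -
      have "chi m * chi z = chi m * chi w" using that(3) mn(1) by (metis chi_mult[OF odd])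
      then show False using that mn(2) by simp
    qed
    show ?thesis
    proof (rule injI)
      fix z w assume e: "(if chi z = 1 then m * z else n * z) = (if chi w = 1 then m * w else n * w)"
      show "z = w" using e no[of z w] no[of w z] mn(2) n0 by (auto split: if_splits)
    qed
  qed
  have "inj f" unfolding f_def by (rule inj_two) (use s s0 in auto)
  moreover have "inj (\<lambda>z. f z - z)"
  proof -
    have "(\<lambda>z. f z - z) = (\<lambda>z. if chi z = 1 then (s - 1) * z else (c - 1) * z)"
      unfolding f_def by (auto simp: algebra_simps)
    then show ?thesis using inj_two[OF s(2) s0(2)] by simp
  qed
  ultimately have o: "orthomorphism f" unfolding orthomorphism_def ..
  have nz: "c - b \<noteq> 0" "c - a \<noteq> 0" using d by auto
  have u: "u * (c - b) = s - b" "v * (c - a) = s - a" using nz uv by simp_all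
  have "u \<noteq> 1" using u(1) sc by auto
  moreover have "v \<noteq> 1" using u(2) sc by auto
  moreover have "u \<noteq> v"
  proof
    assume "u = v"
    then have "(s - b) * (c - a) = (s - a) * (c - b)" using u by (metis mult.assoc mult.commute)
    then have "(b - a) * (s - c) = 0" by Groebner_Basis.algebra
    then show False using d(1) sc by auto
  qed
  moreover have "s - c * v = a * (1 - v)" using u(2) by Groebner_Basis.algebra
  moreover have "s - c * u = b * (1 - u)" using u(1) by Groebner_Basis.algebra
  ultimately show ?thesis
    by (intro slopes_occurI[OF o, of u v 1]) (auto simp: fu algebra_simps)
qed

text \<open>The slopes determine the ratio \<open>(z - x) / (y - x) = (c - a) / (b - a)\<close>, so
  a translation and the scaling by \<open>l\<close> carry one triangle to the other.\<close>

lemma orthomorphism_through_triangle: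
  fixes a b c :: "'a::field"
  assumes "slopes_occur a b c" "a \<noteq> b"
    and ne: "x1 \<noteq> x2" and t: "y3 - y2 = a * (x3 - x2)" "y3 - y1 = b * (x3 - x1)" "y2 - y1 = c * (x2 - x1)"
  shows "\<exists>f. orthomorphism f \<and> f x1 = y1 \<and> f x2 = y2 \<and> f x3 = y3"
proof -
  obtain f x y z where f: "orthomorphism f" "x \<noteq> y" "y \<noteq> z" "x \<noteq> z"
    "f z - f y = a * (z - y)" "f z - f x = b * (z - x)" "f y - f x = c * (y - x)"
    using assms unfolding slopes_occur_def by blast
  define l where "l = (x2 - x1) / (y - x)"
  have l: "l \<noteq> 0" "l * (y - x) = x2 - x1" unfolding l_def using ne f(2) by auto
  have 1: "(b - a) * (z - x) = (c - a) * (y - x)" using f(5-7) by Groebner_Basis.algebra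
  have 2: "(b - a) * (x3 - x1) = (c - a) * (x2 - x1)" using t by Groebner_Basis.algebra
  have "(b - a) * (l * (z - x)) = (b - a) * (x3 - x1)" using 1 2 l(2) by Groebner_Basis.algebra
  then have l3: "l * (z - x) = x3 - x1" using assms(2) by simp
  define g where "g u = y1 + l * (f (x + (u - x1) / l) - f x)" for u
  have i: "inj f" "inj (\<lambda>u. f u - u)" using f(1) by (auto simp: orthomorphism_def)
  have inner: "x + (u - x1) / l = x + (v - x1) / l \<Longrightarrow> u = v" for u v using l(1) by simp
  have "inj g"
  proof (rule injI)
    fix u v assume "g u = g v"
    then have "f (x + (u - x1) / l) = f (x + (v - x1) / l)" using l(1) by (simp add: g_def)
    then show "u = v" using injD[OF i(1)] inner by blast
  qed
  moreover have "inj (\<lambda>u. g u - u)"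
  proof (rule injI)
    fix u v assume e: "g u - u = g v - v"
    have k: "g w - w = l * (f (x + (w - x1) / l) - (x + (w - x1) / l)) + (y1 - x1 + l * x - l * f x)" for w
    proof -
      define q where "q = (w - x1) / l"
      have "w = x1 + l * q" unfolding q_def using l(1) by simp
      then show ?thesis unfolding g_def q_def[symmetric] by (simp add: algebra_simps)
    qed
    have "f (x + (u - x1) / l) - (x + (u - x1) / l) = f (x + (v - x1) / l) - (x + (v - x1) / l)"
      using e l(1) unfolding k by simp
    then show "u = v" using injD[OF i(2)] inner by blast
  qed
  ultimately have "orthomorphism g" unfolding orthomorphism_def ..
  moreover have "g x1 = y1" unfolding g_def by simp
  moreover have "(x2 - x1) / l = y - x" "(x3 - x1) / l = z - x" using l l3 by (simp_all add: field_simps)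
  then have "g x2 = y1 + l * (f y - f x)" "g x3 = y1 + l * (f z - f x)" unfolding g_def by simp_all
  then have "g x2 = y2" "g x3 = y3" using f(6,7) l(2) l3 t by Groebner_Basis.algebra+
  ultimately show ?thesis by blast
qed

lemma orthomorphism_through_line:
  fixes m :: "'a::field"
  assumes "m \<noteq> 0" "m \<noteq> 1" shows "orthomorphism (\<lambda>u. y + m * (u - x))"
proof -
  have "inj (\<lambda>u. y + m * (u - x))" using assms(1) by (intro injI) simp
  moreover have "inj (\<lambda>u. y + m * (u - x) - u)"
  proof (rule injI)
    fix u v assume "y + m * (u - x) - u = y + m * (v - x) - v"
    then have "(m - 1) * (u - v) = 0" by Groebner_Basis.algebra
    then show "u = v" using assms by simp
  qed
  ultimately show ?thesis unfolding orthomorphism_def ..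
qed

section \<open>Reduction of three points to their slopes\<close>

definition all_slopes :: "'a::field itself \<Rightarrow> bool" where
  "all_slopes _ \<longleftrightarrow> (\<forall>a b c :: 'a. {a, b, c} \<inter> {0, 1} = {} \<longrightarrow> a \<noteq> b \<longrightarrow> a \<noteq> c \<longrightarrow> b \<noteq> c \<longrightarrow> slopes_occur a b c)"

lemma orthomorphism_extension:
  fixes x1 :: "'a::field"
  assumes all: "all_slopes TYPE('a)"
    and x: "x1 \<noteq> x2" "x1 \<noteq> x3" "x2 \<noteq> x3" and y: "y1 \<noteq> y2" "y1 \<noteq> y3" "y2 \<noteq> y3"
    and z: "y1 - x1 \<noteq> y2 - x2" "y1 - x1 \<noteq> y3 - x3" "y2 - x2 \<noteq> y3 - x3"
  shows "\<exists>f. orthomorphism f \<and> f x1 = y1 \<and> f x2 = y2 \<and> f x3 = y3"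
proof -
  define a b c where "a = (y3 - y2) / (x3 - x2)" "b = (y3 - y1) / (x3 - x1)" "c = (y2 - y1) / (x2 - x1)"
  note abc = this
  have t: "y3 - y2 = a * (x3 - x2)" "y3 - y1 = b * (x3 - x1)" "y2 - y1 = c * (x2 - x1)"
    unfolding abc using x by auto
  have n0: "a \<noteq> 0" "b \<noteq> 0" "c \<noteq> 0" unfolding abc using x y by auto
  have n1: "a \<noteq> 1" "b \<noteq> 1" "c \<noteq> 1"
    using t z by (auto simp: algebra_simps)
  show ?thesis
  proof (cases "b = c")
    case True
    have "y1 + b * (x3 - x1) = y3" "y1 + b * (x2 - x1) = y2" using t True by (metis add_diff_cancel_left' diff_add_cancel add.commute)+
    then show ?thesis using orthomorphism_through_line[OF n0(2) n1(2), of y1 x1] by auto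
  next
    case False
    \<comment> \<open>By this relation two equal slopes force the third to agree, so
      \<open>b\<close> differing from \<open>c\<close> makes all three distinct.\<close>
    have 2: "(b - a) * (x3 - x1) = (c - a) * (x2 - x1)" using t by Groebner_Basis.algebra
    have ab: "a \<noteq> b" using 2 False x by auto
    have ac: "a \<noteq> c" using 2 False x by auto
    have "slopes_occur a b c" using all n0 n1 ab ac False unfolding all_slopes_def by auto
    then show ?thesis using ab x(1) t by (rule orthomorphism_through_triangle)
  qed
qed

lemma all_slopes_large:
  assumes "prime (CARD('a::{finite_field,field_gcd}))" "CARD('a) \<ge> 149"
  shows "all_slopes TYPE('a)"
  unfolding all_slopes_def
proof (intro allI impI)
  fix a b c :: 'a assume d: "{a, b, c} \<inter> {0, 1} = {}" "a \<noteq> b" "a \<noteq> c" "b \<noteq> c"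
  have odd: "odd (CARD('a))" using assms prime_odd_nat by auto
  have u: "\<bar>chi w\<bar> = 1" if "w \<noteq> 0" for w :: 'a using that chi_values[of w] by auto
  obtain s where "chi s = chi c" "chi (s - 1) = chi (c - 1)"
    "s = a \<or> chi (s - a) = - chi (c - a)" "s = b \<or> chi (s - b) = - chi (c - b)"
    using sign_pattern_exists[OF assms(1) odd assms(2), of a b "chi c" "chi (c - 1)" "- chi (c - a)" "- chi (c - b)"] d u by auto
  then show "slopes_occur a b c" using slopes_occur_quadratic[OF odd d(2-4)] d(1) by auto
qed

section \<open>Small primes\<close>

definition squares :: "int \<Rightarrow> int list" where "squares p = 1 # map (\<lambda>j. j * j mod p) [2..(p - 1) div 2]"

definition res :: "int \<Rightarrow> int \<Rightarrow> bool" where "res p k \<longleftrightarrow> k mod p \<in> set (squares p)"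

lemma of_int_mod_ring_eq_iff:
  "(of_int k :: 'a::prime_card mod_ring) = of_int l \<longleftrightarrow> [k = l] (mod int (CARD('a)))"
  by (simp add: of_int_eq_iff_cong_CHAR)

lemma QuadRes_imp_res:
  assumes "odd p" "p > 2" "QuadRes p k" "\<not> [k = 0] (mod p)"
  shows "res p k"
proof -
  obtain y where y: "[y^2 = k] (mod p)" using assms(3) unfolding QuadRes_def by blast
  define z where "z = y mod p"
  have z: "[z * z = k] (mod p)" using y unfolding z_def cong_def power2_eq_square by (metis mod_mult_eq)
  have zr: "0 \<le> z" "z < p" using assms(2) unfolding z_def by auto
  have "z \<noteq> 0" using z assms(4) by (auto simp: cong_def)
  \<comment> \<open>A root and its negative have the same square, so roots up to
    \<open>(p - 1) div 2\<close> suffice.\<close>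
  define j where "j = (if z \<le> (p - 1) div 2 then z else p - z)"
  have "j \<in> {1..(p - 1) div 2}" using zr \<open>z \<noteq> 0\<close> assms(1,2) unfolding j_def by (auto elim!: oddE)
  moreover have "[j * j = z * z] (mod p)"
  proof -
    have "(p - z) * (p - z) = z * z + p * (p - 2 * z)" by (simp add: algebra_simps)
    then show ?thesis unfolding j_def cong_def by simp
  qed
  then have k: "k mod p = j * j mod p" using z unfolding cong_def by simp
  ultimately show ?thesis
  proof (cases "j = 1")
    case True
    then have "k mod p = 1" using k assms(2) by simp
    then show ?thesis unfolding res_def squares_def by simp
  next
    case False
    then have "j \<in> set [2..(p - 1) div 2]" using \<open>j \<in> {1..(p - 1) div 2}\<close> by auto
    then show ?thesis unfolding res_def squares_def k by simp
  qed
qed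

lemma res_imp_QuadRes: "res p k \<Longrightarrow> QuadRes p k"
proof -
  assume "res p k"
  then consider "k mod p = 1" | j where "k mod p = j * j mod p" unfolding res_def squares_def by auto
  then show ?thesis
  proof cases
    case 1
    then have "1^2 mod p = k mod p" by (metis mod_mod_trivial one_power2)
    then show ?thesis unfolding QuadRes_def cong_def by blast
  next
    case 2
    then show ?thesis unfolding QuadRes_def cong_def by (metis power2_eq_square)
  qed
qed

text \<open>Euler's criterion identifies \<open>chi\<close> with the Legendre symbol.\<close>

lemma chi_of_int:
  assumes p: "p = int (CARD('a::prime_card))" "p > 2" and k: "\<not> [k = 0] (mod p)"
  shows "chi (of_int k :: 'a mod_ring) = (if res p k then 1 else -1)"
proof -
  have pr: "prime p" unfolding p(1) using prime_card[where 'a='a] by simp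
  have odd: "odd p" using pr p(2) by (simp add: prime_odd_int)
  have h: "nat ((p - 1) div 2) = (CARD('a mod_ring) - 1) div 2" using p by (simp add: nat_div_distrib nat_diff_distrib)
  have "[Legendre k p = k ^ nat ((p - 1) div 2)] (mod p)"
    using euler_criterion[of "CARD('a)" k] prime_card[where 'a='a] p h by simp
  then have pw: "(of_int (Legendre k p) :: 'a mod_ring) = of_int k ^ ((CARD('a mod_ring) - 1) div 2)"
    unfolding h[symmetric] of_int_power[symmetric] of_int_mod_ring_eq_iff p(1)[symmetric] .
  have m1: "(of_int (-1) :: 'a mod_ring) \<noteq> of_int 1"
    unfolding of_int_mod_ring_eq_iff p(1)[symmetric] cong_iff_dvd_diff using p(2) zdvd_imp_le[of p 2] by auto
  have nz: "(of_int k :: 'a mod_ring) \<noteq> 0"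
    using k of_int_mod_ring_eq_iff[of k 0, where 'a='a] p(1) by simp
  have "res p k \<longleftrightarrow> QuadRes p k" using QuadRes_imp_res[OF odd p(2) _ k] res_imp_QuadRes by blast
  then have L: "Legendre k p = (if res p k then 1 else -1)" unfolding Legendre_def using k by simp
  show ?thesis
  proof (cases "res p k")
    case True
    then have "(of_int k :: 'a mod_ring) ^ ((CARD('a mod_ring) - 1) div 2) = 1" unfolding pw[symmetric] L by simp
    then show ?thesis unfolding chi_def using nz True by simp
  next
    case False
    then have "(of_int k :: 'a mod_ring) ^ ((CARD('a mod_ring) - 1) div 2) \<noteq> 1" unfolding pw[symmetric] L using m1 by simp
    then show ?thesis unfolding chi_def using nz False by simp
  qed
qed

text \<open>
  The check runs over the first slope \<open>a\<close>, the classes (\<open>quadrant\<close>, \<open>half\<close>) of the possible \<open>s\<close> and \<open>c\<close>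
  with respect to \<open>0, 1, a\<close>, and the second slope \<open>b\<close>; the third slope \<open>c\<close> is only enumerated for those
  \<open>(a, b)\<close> for which some sign pattern is not attained. A triple \<open>(a, x, y)\<close> in the list \<open>A\<close> has
  \<open>x = 1/a\<close>, \<open>y = 1/(1 - a)\<close>, which makes the orbit of \<open>a\<close> under the symmetries easy to read off; \<open>E\<close>
  lists the triples of slopes that are left to explicit orthomorphisms. In \<open>hit\<close>, \<open>both\<close>, \<open>pair_ok\<close> and
  \<open>row_ok\<close> the second slope is represented by \<open>p - b\<close>, so that all differences \<open>s - b\<close> become sums.
\<close>

definition rng :: "int \<Rightarrow> int list" where "rng p = [2..p - 1]"

fun quadrant :: "int \<Rightarrow> bool \<Rightarrow> bool \<Rightarrow> int list \<Rightarrow> int list" where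
  "quadrant p e0 e1 [] = []"
| "quadrant p e0 e1 (s # R) =
    (if res p s = e0 then if res p (s - 1) = e1 then s # quadrant p e0 e1 R else quadrant p e0 e1 R
     else quadrant p e0 e1 R)"

fun half :: "int \<Rightarrow> int \<Rightarrow> bool \<Rightarrow> int list \<Rightarrow> int list" where
  "half p a e [] = []"
| "half p a e (s # R) =
    (if s = a then s # half p a e R else if res p (s - a) = e then s # half p a e R else half p a e R)"

text \<open>If \<open>s\<close> is the second slope itself, the argument of \<open>res\<close> is
  \<open>p\<close> and counts as a non-square. Such a hit is legitimate, because the criterion
  admits \<open>s = b\<close>.\<close>

fun hit :: "int \<Rightarrow> int \<Rightarrow> bool \<Rightarrow> int list \<Rightarrow> bool" where
  "hit p b e [] = False"
| "hit p b e (s # D) = (if res p (s + b) = e then True else hit p b e D)"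

text \<open>Nested conditionals, here and in the neighbouring functions, let
  \<open>if_weak_cong\<close> evaluate only the branch that is reached.\<close>

definition good :: "int \<Rightarrow> int \<Rightarrow> int \<Rightarrow> int \<Rightarrow> int \<Rightarrow> bool" where
  "good p a b c s = (if res p s = res p c then if res p (s - 1) = res p (c - 1) then
     if (if s = a then True else res p (s - a) = (\<not> res p (c - a))) then
       (if s = b then True else res p (s - b) = (\<not> res p (c - b))) else False else False else False)"

fun search :: "int \<Rightarrow> int \<Rightarrow> int \<Rightarrow> int \<Rightarrow> int list \<Rightarrow> bool" where
  "search p a b c [] = False"
| "search p a b c (s # R) = (if good p a b c s then True else search p a b c R)"

fun listed :: "int \<Rightarrow> int \<Rightarrow> int \<Rightarrow> (int \<times> int \<times> int) list \<Rightarrow> bool" where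
  "listed a b c [] = False"
| "listed a b c ((x, y, z) # E) = (if x = a \<and> y = b \<and> z = c then True else listed a b c E)"

text \<open>The slopes \<open>c\<close>, \<open>a\<close> and \<open>b\<close> take turns as the
  distinguished one.\<close>

definition fallback :: "int \<Rightarrow> (int \<times> int \<times> int) list \<Rightarrow> int \<Rightarrow> int \<Rightarrow> int \<Rightarrow> bool" where
  "fallback p E a b c = (if search p a b c (rng p) then True else if search p b c a (rng p) then True else if search p a c b (rng p) then True
     else if listed a b c E then True else listed a c b E)"

text \<open>\<open>D\<close> holds the candidates for \<open>c\<close>, and \<open>e\<close> is a
  sign at \<open>b\<close> that no available \<open>s\<close> has. A \<open>c\<close> with this same
  sign needs an \<open>s\<close> of the opposite sign and is passed over.\<close>

fun covered :: "int \<Rightarrow> (int \<times> int \<times> int) list \<Rightarrow> int \<Rightarrow> int \<Rightarrow> bool \<Rightarrow> int list \<Rightarrow> bool" where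
  "covered p E a b e [] = True"
| "covered p E a b e (c # D) =
    (if c = a then covered p E a b e D else if c = b then covered p E a b e D
     else if res p (c - b) = e then covered p E a b e D
     else if fallback p E a b c then covered p E a b e D else False)"

text \<open>The first element shows one of the two signs, so it remains to find the other.\<close>

fun both :: "int \<Rightarrow> int \<Rightarrow> int list \<Rightarrow> bool" where
  "both p b [] = False"
| "both p b (s # D) = hit p b (\<not> res p (s + b)) D"

definition pair_ok :: "int \<Rightarrow> (int \<times> int \<times> int) list \<Rightarrow> int \<Rightarrow> int \<Rightarrow> bool \<Rightarrow> int list \<Rightarrow> int list \<Rightarrow> bool" where
  "pair_ok p E a b e D D' = (if hit p b e D then True else covered p E a (p - b) e D')"

text \<open>Started at \<open>p - 2\<close>, \<open>b\<close> counts down to 1, so the second slope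
  \<open>p - b\<close> runs from 2 to \<open>p - 1\<close>; \<open>a + b = p\<close> is the excluded
  case of equal slopes.\<close>

function row_ok :: "int \<Rightarrow> (int \<times> int \<times> int) list \<Rightarrow> int \<Rightarrow> int list \<Rightarrow> int list \<Rightarrow> int \<Rightarrow> bool" where
  "row_ok p E a D D' b = (if b < 1 then True else if both p b D then row_ok p E a D D' (b - 1)
     else if a + b = p then row_ok p E a D D' (b - 1) else if pair_ok p E a b True D D' then if pair_ok p E a b False D D' then row_ok p E a D D' (b - 1) else False
     else False)"
  by auto
termination by (relation "measure (\<lambda>(p, E, a, D, D', b). nat b)") auto

declare row_ok.simps [simp del]

text \<open>The two calls treat the two signs of \<open>c - a\<close>; \<open>s\<close> is taken
  from the half opposite to that of \<open>c\<close>.\<close>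

definition halves_ok :: "int \<Rightarrow> (int \<times> int \<times> int) list \<Rightarrow> int \<Rightarrow> int list \<Rightarrow> int list \<Rightarrow> bool" where
  "halves_ok p E a D D' = (if row_ok p E a D D' (p - 2) then row_ok p E a D' D (p - 2) else False)"

fun rows_ok :: "int \<Rightarrow> (int \<times> int \<times> int) list \<Rightarrow> int list \<Rightarrow> (int \<times> int \<times> int) list \<Rightarrow> bool" where
  "rows_ok p E Q [] = True"
| "rows_ok p E Q ((a, x, y) # A) = (if halves_ok p E a (half p a True Q) (half p a False Q) then rows_ok p E Q A else False)"

definition check :: "int \<Rightarrow> (int \<times> int \<times> int) list \<Rightarrow> (int \<times> int \<times> int) list \<Rightarrow> bool" where
  "check p E A \<longleftrightarrow> rows_ok p E (quadrant p True True (rng p)) A \<and> rows_ok p E (quadrant p True False (rng p)) A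
     \<and> rows_ok p E (quadrant p False True (rng p)) A \<and> rows_ok p E (quadrant p False False (rng p)) A"

text \<open>The six values of a cross-ratio: \<open>a\<close>, \<open>1/a\<close>,
  \<open>1/(1 - a)\<close> and their images under \<open>m -> 1 - m\<close>. For \<open>a\<close>
  between 2 and \<open>p - 1\<close>, \<open>p + 1 - a\<close> represents \<open>1 - a\<close> in
  the same range.\<close>

fun orbit :: "int \<Rightarrow> (int \<times> int \<times> int) list \<Rightarrow> int list" where
  "orbit p [] = []"
| "orbit p ((a, x, y) # A) = a # (p + 1 - a) # x # (p + 1 - x) # y # (p + 1 - y) # orbit p A"

fun inverses :: "int \<Rightarrow> (int \<times> int \<times> int) list \<Rightarrow> bool" where
  "inverses p [] = True"
| "inverses p ((a, x, y) # A) = (if a * x mod p = 1 then if (1 - a) * y mod p = 1 then inverses p A else False else False)"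

section \<open>Soundness of the check\<close>

lemma set_quadrant: "set (quadrant p e0 e1 R) = {s \<in> set R. res p s = e0 \<and> res p (s - 1) = e1}"
  by (induction R) auto

lemma set_half: "set (half p a e R) = {s \<in> set R. s = a \<or> res p (s - a) = e}"
  by (induction R) auto

lemma hit_iff: "hit p b e D \<longleftrightarrow> (\<exists>s\<in>set D. res p (s + b) = e)"
  by (induction D) auto

lemma res_shift: "res p (s + (p - b)) = res p (s - b)"
proof -
  have "s + (p - b) = (s - b) + p" by simp
  then show ?thesis unfolding res_def by (simp only: mod_add_self2)
qed

lemma search_iff: "search p a b c R \<longleftrightarrow> (\<exists>s\<in>set R. good p a b c s)"
  by (induction R) auto

lemma goodD:
  assumes "good p a b c s"
  shows "res p s = res p c" "res p (s - 1) = res p (c - 1)"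
    "s = a \<or> res p (s - a) = (\<not> res p (c - a))" "s = b \<or> res p (s - b) = (\<not> res p (c - b))"
  using assms unfolding good_def by (auto split: if_splits)

lemma listed_iff: "listed a b c E \<longleftrightarrow> (a, b, c) \<in> set E"
  by (induction E) (auto split: if_splits)

lemma covered_iff: "covered p E a b e D \<longleftrightarrow>
    (\<forall>c\<in>set D. c = a \<or> c = b \<or> res p (c - b) = e \<or> fallback p E a b c)"
  by (induction D) auto

lemma both_imp_hit: "both p b D \<Longrightarrow> hit p b e D"
  by (cases D) (auto simp: hit_iff)

lemma row_okD:
  "row_ok p E a D D' n \<Longrightarrow> 1 \<le> b \<Longrightarrow> b \<le> n \<Longrightarrow> a + b \<noteq> p \<Longrightarrow> pair_ok p E a b e D D'"
proof (induction "nat n" arbitrary: n)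
  case 0
  then show ?case by simp
next
  case (Suc k)
  have "row_ok p E a D D' (n - 1)" using Suc.prems(1,2,3) row_ok.simps[of p E a D D' n] by (auto split: if_splits)
  moreover have "pair_ok p E a n e D D'" if "a + n \<noteq> p"
    using Suc.prems(1,2,3) row_ok.simps[of p E a D D' n] that both_imp_hit[of p n D e]
    by (cases e) (auto simp: pair_ok_def split: if_splits)
  ultimately show ?case using Suc.hyps(1)[of "n - 1"] Suc.hyps(2) Suc.prems by (cases "b = n") auto
qed

lemma rows_ok_iff: "rows_ok p E Q A \<longleftrightarrow>
    (\<forall>(a, x, y)\<in>set A. halves_ok p E a (half p a True Q) (half p a False Q))"
  by (induction A) (auto split: if_splits)

lemma in_orbitE:
  assumes "b \<in> set (orbit p A)" "inverses p A"
  obtains a x y where "(a, x, y) \<in> set A" "[a * x = 1] (mod p)" "[(1 - a) * y = 1] (mod p)"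
    "b = a \<or> b = p + 1 - a \<or> b = x \<or> b = p + 1 - x \<or> b = y \<or> b = p + 1 - y"
proof -
  have "\<exists>a x y. (a, x, y) \<in> set A \<and> [a * x = 1] (mod p) \<and> [(1 - a) * y = 1] (mod p) \<and>
    (b = a \<or> b = p + 1 - a \<or> b = x \<or> b = p + 1 - x \<or> b = y \<or> b = p + 1 - y)"
    using assms
  proof (induction A)
    case (Cons t A)
    obtain a x y where t: "t = (a, x, y)" by (cases t)
    have i: "[a * x = 1] (mod p)" "[(1 - a) * y = 1] (mod p)" "inverses p A"
      using Cons.prems(2) unfolding t by (auto simp: cong_def split: if_splits) (metis mod_mod_trivial)+
    show ?case using Cons.prems(1) Cons.IH[OF _ i(3)] i unfolding t by auto
  qed simp
  then show ?thesis using that by blast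
qed

text \<open>With one slope singled out, the symmetries reduce the check to one representative of
  each orbit.\<close>

definition occurs :: "'a::field \<Rightarrow> bool" where
  "occurs a \<longleftrightarrow> (\<forall>b c. {a, b, c} \<inter> {0, 1} = {} \<longrightarrow> a \<noteq> b \<longrightarrow> a \<noteq> c \<longrightarrow> b \<noteq> c \<longrightarrow> slopes_occur a b c)"

lemma occurs_one_minus:
  assumes "occurs a" shows "occurs (1 - a)"
  unfolding occurs_def
proof (intro allI impI)
  fix b c assume d: "{1 - a, b, c} \<inter> {0, 1} = {}" "1 - a \<noteq> b" "1 - a \<noteq> c" "b \<noteq> c"
  have "a \<noteq> 1 - b" "a \<noteq> 1 - c" using d(2,3) by auto
  then have "slopes_occur a (1 - b) (1 - c)" using assms d unfolding occurs_def by auto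
  from slopes_occur_one_minus[OF this] show "slopes_occur (1 - a) b c" by simp
qed

lemma occurs_inverse:
  fixes a x :: "'a::{field,finite}"
  assumes "occurs a" "a * x = 1" shows "occurs x"
  unfolding occurs_def
proof (intro allI impI)
  fix b c assume d: "{x, b, c} \<inter> {0, 1} = {}" "x \<noteq> b" "x \<noteq> c" "b \<noteq> c"
  have "a \<noteq> 0" "x \<noteq> 0" using assms(2) by auto
  then have x: "x = 1 / a" using assms(2) by (simp add: eq_divide_eq mult.commute)
  have "a \<noteq> 1 / b" "a \<noteq> 1 / c" "a \<noteq> 1" using d(1-3) unfolding x by auto
  then have "slopes_occur a (1 / b) (1 / c)" using assms(1) d(1,4) \<open>a \<noteq> 0\<close> unfolding occurs_def by auto
  then have "slopes_occur (1 / a) (1 / (1 / b)) (1 / (1 / c))"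
    by (rule slopes_occur_inverse) (use d(1) \<open>a \<noteq> 0\<close> in auto)
  then show "slopes_occur x b c" by (simp add: x)
qed

text \<open>For given \<open>a\<close>, \<open>b\<close>, \<open>c\<close> a suitable
  \<open>s\<close> is sought in the quadrant of \<open>c\<close>, separated from \<open>c\<close> by
  the signs at \<open>a\<close> and at \<open>b\<close>. Either \<open>hit\<close> finds it, or
  \<open>c\<close> is among the candidates settled by \<open>covered\<close>. Orbits then extend the
  result from the slopes in \<open>A\<close> to all.\<close>

lemma all_slopes_check:
  fixes p :: int
  assumes p: "p = int (CARD('a::prime_card))" "p > 2"
    and chk: "check p E A" and orb: "set (rng p) \<subseteq> set (orbit p A)" and inv: "inverses p A"
    and rA: "\<forall>(a, x, y)\<in>set A. a \<in> set (rng p)"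
    and E: "\<forall>(x, y, z)\<in>set E. slopes_occur (of_int x :: 'a mod_ring) (of_int y) (of_int z)"
  shows "all_slopes TYPE('a mod_ring)"
proof -
  let ?f = "of_int :: int \<Rightarrow> 'a mod_ring"
  have odd: "odd (CARD('a mod_ring))" using p prime_card[where 'a='a] by (simp add: prime_odd_nat)
  have rng: "k \<in> set (rng p) \<longleftrightarrow> 2 \<le> k \<and> k < p" for k unfolding rng_def by auto
  have cng: "k = l" if "[k = l] (mod p)" "0 \<le> k" "k < p" "0 \<le> l" "l < p" for k l
    using that by (simp add: cong_def)
  have inj: "?f k = ?f l \<longleftrightarrow> k = l" if "k \<in> set (rng p) \<union> {0,1}" "l \<in> set (rng p) \<union> {0,1}" for k l
    unfolding of_int_mod_ring_eq_iff p(1)[symmetric] using that cng[of k l] p(2) unfolding Un_iff rng by auto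
  have chi: "chi (?f k - ?f l) = (if res p (k - l) then 1 else -1)"
    if "k \<noteq> l" "k \<in> set (rng p) \<union> {0,1}" "l \<in> set (rng p) \<union> {0,1}" for k l
  proof -
    have "\<not> [k - l = 0] (mod p)" using inj[OF that(2,3)] that(1)
      unfolding of_int_mod_ring_eq_iff p(1)[symmetric] by (simp add: cong_diff_iff_cong_0)
    then show ?thesis using chi_of_int[OF p] by (metis of_int_diff)
  qed
  \<comment> \<open>The criterion of \<open>slopes_occur_quadratic\<close> with \<open>res\<close>
    in place of \<open>chi\<close>.\<close>
  have quad: "slopes_occur (?f a) (?f b) (?f c)"
    if r: "a \<in> set (rng p)" "b \<in> set (rng p)" "c \<in> set (rng p)" "s \<in> set (rng p)"
      and d: "a \<noteq> b" "a \<noteq> c" "b \<noteq> c"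
      and s: "res p s = res p c" "res p (s - 1) = res p (c - 1)"
        "s = a \<or> res p (s - a) = (\<not> res p (c - a))" "s = b \<or> res p (s - b) = (\<not> res p (c - b))" for a b c s
  proof (rule slopes_occur_quadratic[OF odd, where s = "?f s"])
    have n: "k \<noteq> 0" "k \<noteq> 1" if "k \<in> set (rng p)" for k using that unfolding rng by auto
    show "?f a \<noteq> ?f b" "?f a \<noteq> ?f c" "?f b \<noteq> ?f c" using inj d r by auto
    show "?f c \<noteq> 0" "?f c \<noteq> 1" using inj[of c 0] inj[of c 1] r n[of c] by auto
    show "chi (?f s) = chi (?f c)" using chi[of s 0] chi[of c 0] n r s(1) by simp
    show "chi (?f s - 1) = chi (?f c - 1)" using chi[of s 1] chi[of c 1] n r s(2) by simp
    show "?f s = ?f a \<or> chi (?f s - ?f a) = - chi (?f c - ?f a)"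
      by (cases "s = a") (use chi[of s a] chi[of c a] r s(3) d in auto)
    show "?f s = ?f b \<or> chi (?f s - ?f b) = - chi (?f c - ?f b)"
      by (cases "s = b") (use chi[of s b] chi[of c b] r s(4) d in auto)
  qed
  have main: "slopes_occur (?f a) (?f b) (?f c)"
    if aA: "(a, x, y) \<in> set A" and r: "b \<in> set (rng p)" "c \<in> set (rng p)" and d: "a \<noteq> b" "a \<noteq> c" "b \<noteq> c" for a x y b c
  proof -
    have ra: "a \<in> set (rng p)" using aA rA by auto
    define Q where "Q = quadrant p (res p c) (res p (c - 1)) (rng p)"
    have "rows_ok p E Q A" using chk unfolding check_def Q_def
      by (cases "res p c"; cases "res p (c - 1)") simp_all
    then have ho: "halves_ok p E a (half p a True Q) (half p a False Q)" using aA unfolding rows_ok_iff by auto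
    define e where "e = res p (c - a)"
    have "row_ok p E a (half p a (\<not> e) Q) (half p a e Q) (p - 2)"
      using ho unfolding halves_ok_def by (cases e) (auto split: if_splits)
    then have "pair_ok p E a (p - b) (\<not> res p (c - b)) (half p a (\<not> e) Q) (half p a e Q)"
      by (rule row_okD) (use r d in \<open>auto simp: rng\<close>)
    then consider (1) "hit p (p - b) (\<not> res p (c - b)) (half p a (\<not> e) Q)"
      | (2) "covered p E a b (\<not> res p (c - b)) (half p a e Q)" unfolding pair_ok_def by (auto split: if_splits)
    then show ?thesis
    proof cases
      case 1
      then obtain s where "s \<in> set (half p a (\<not> e) Q)" "res p (s - b) = (\<not> res p (c - b))"
        unfolding hit_iff res_shift by blast
      then show ?thesis using quad[OF ra r _ d, of s] unfolding set_half Q_def set_quadrant e_def by auto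
    next
      case 2
      have "c \<in> set (half p a e Q)" unfolding set_half Q_def set_quadrant e_def using r by auto
      then have "fallback p E a b c" using 2 d unfolding covered_iff by auto
      then consider "search p a b c (rng p)" | "search p b c a (rng p)" | "search p a c b (rng p)" | "(a, b, c) \<in> set E" | "(a, c, b) \<in> set E"
        unfolding fallback_def listed_iff by (auto split: if_splits)
      then show ?thesis
      proof cases
        case 1
        then obtain s where s: "s \<in> set (rng p)" "good p a b c s" unfolding search_iff by blast
        show ?thesis by (rule quad[OF ra r s(1) d goodD[OF s(2)]])
      next
        case 2
        then obtain s where s: "s \<in> set (rng p)" "good p b c a s" unfolding search_iff by blast
        have "slopes_occur (?f b) (?f c) (?f a)" by (rule quad[OF r ra s(1) _ _ _ goodD[OF s(2)]]) (use d in auto)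
        then show ?thesis using slopes_occur_swap12 slopes_occur_swap23 by blast
      next
        case 3
        then obtain s where s: "s \<in> set (rng p)" "good p a c b s" unfolding search_iff by blast
        have "slopes_occur (?f a) (?f c) (?f b)" by (rule quad[OF ra r(2) r(1) s(1) _ _ _ goodD[OF s(2)]]) (use d in auto)
        then show ?thesis by (rule slopes_occur_swap23)
      next
        case 4
        then show ?thesis using E by auto
      next
        case 5
        then have "slopes_occur (?f a) (?f c) (?f b)" using E by auto
        then show ?thesis by (rule slopes_occur_swap23)
      qed
    qed
  qed
  have rep: "\<exists>k\<in>set (rng p). z = ?f k" if "z \<noteq> 0" "z \<noteq> 1" for z
  proof -
    obtain i where i: "i < CARD('a)" "z = of_nat i" using surj_of_nat_mod_ring[of z] by blast
    have "i \<noteq> 0" using that(1) i(2) by (metis of_nat_0)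
    moreover have "i \<noteq> 1" using that(2) i(2) by (metis of_nat_1)
    ultimately have "int i \<noteq> 0" "int i \<noteq> 1" by auto
    then have "int i \<in> set (rng p)" unfolding rng using i(1) p(1) by auto
    then show ?thesis using i(2) by (intro bexI[of _ "int i"]) auto
  qed
  have occA: "occurs (?f a)" if "(a, x, y) \<in> set A" for a x y
    unfolding occurs_def
  proof (intro allI impI)
    fix b c assume d: "{?f a, b, c} \<inter> {0, 1} = {}" "?f a \<noteq> b" "?f a \<noteq> c" "b \<noteq> c"
    obtain k where k: "k \<in> set (rng p)" "b = ?f k" using rep[of b] d by auto
    obtain l where l: "l \<in> set (rng p)" "c = ?f l" using rep[of c] d by auto
    show "slopes_occur (?f a) b c" unfolding k(2) l(2) by (rule main[OF that k(1) l(1)]) (use d k l in auto)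
  qed
  have "occurs (?f b)" if br: "b \<in> set (rng p)" for b
  proof -
    obtain a x y where a: "(a, x, y) \<in> set A" "[a * x = 1] (mod p)" "[(1 - a) * y = 1] (mod p)"
      "b = a \<or> b = p + 1 - a \<or> b = x \<or> b = p + 1 - x \<or> b = y \<or> b = p + 1 - y"
      by (rule in_orbitE[OF subsetD[OF orb br] inv])
    have "?f (a * x) = ?f 1" "?f ((1 - a) * y) = ?f 1"
      unfolding of_int_mod_ring_eq_iff p(1)[symmetric] using a by auto
    then have m: "?f a * ?f x = 1" "(1 - ?f a) * ?f y = 1" by simp_all
    have p1: "?f (p + 1 - k) = 1 - ?f k" for k
    proof -
      have "?f (p + 1 - k) = ?f (1 - k)" unfolding of_int_mod_ring_eq_iff p(1)[symmetric] by (simp add: cong_iff_dvd_diff)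
      then show ?thesis by simp
    qed
    \<comment> \<open>\<open>o1\<close> to \<open>o6\<close> follow the order of
      \<open>orbit\<close>: \<open>a\<close>, \<open>1 - a\<close>, \<open>x\<close>,
      \<open>1 - x\<close>, \<open>y\<close>, \<open>1 - y\<close>.\<close>
    note o1 = occA[OF a(1)]
    note o2 = occurs_one_minus[OF o1]
    note o3 = occurs_inverse[OF o1 m(1)] and o5 = occurs_inverse[OF o2 m(2)]
    note o4 = occurs_one_minus[OF o3] and o6 = occurs_one_minus[OF o5]
    show ?thesis using a(4) o1 o2 o3 o4 o5 o6 unfolding p1[symmetric] by blast
  qed
  then have "occurs z" if "z \<noteq> 0" "z \<noteq> 1" for z :: "'a mod_ring" using rep[OF that] by auto
  then show ?thesis unfolding all_slopes_def occurs_def by auto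
qed

definition certificate :: "int \<Rightarrow> (int \<times> int \<times> int) list \<Rightarrow> (int \<times> int \<times> int) list \<Rightarrow> bool" where
  "certificate p E A \<longleftrightarrow> check p E A \<and> set (rng p) \<subseteq> set (orbit p A) \<and> inverses p A \<and>
     (\<forall>(a, x, y)\<in>set A. a \<in> set (rng p))"

lemma all_slopes_certificate:
  assumes "certificate p E A" "p = int (CARD('a::prime_card))" "p > 2"
    and "\<forall>(x, y, z)\<in>set E. slopes_occur (of_int x :: 'a mod_ring) (of_int y) (of_int z)"
  shows "all_slopes TYPE('a mod_ring)"
  using assms all_slopes_check[of p E A, where 'a='a] unfolding certificate_def by blast

section \<open>Evaluation by rewriting, and explicit tables\<close>

lemma res_table: "p > 2 \<Longrightarrow> list_all (\<lambda>k. res p k \<longleftrightarrow> k \<in> set (squares p)) (1 # rng p)"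
  by (auto simp: list_all_iff res_def rng_def)

text \<open>Sums \<open>s + b\<close> reach beyond \<open>p\<close> and differences can be negative;
  these rules extend the table so that no reduction modulo \<open>p\<close> occurs during the
  evaluation.\<close>

lemma res_table_shift:
  "list_all (\<lambda>k. res p (k + p) \<longleftrightarrow> res p k) (1 # rng p)"
  "list_all (\<lambda>k. res p (k - p) \<longleftrightarrow> res p k) (1 # rng p)"
  "res p p \<longleftrightarrow> 0 \<in> set (squares p)"
  by (simp_all add: list_all_iff res_def)

definition hold :: "int list \<Rightarrow> int list" where "hold D = D"

text \<open>As a congruence rule this stops the simplifier from revisiting the lists that the
  evaluation below carries around.\<close>

lemma hold_cong: "hold D = hold D" by (rule refl)

lemma hold_simps:
  "hit p b e (hold []) = False"
  "hit p b e (hold (s # D)) = (if res p (s + b) = e then True else hit p b e (hold D))"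
  "both p b (hold []) = False"
  "both p b (hold (s # D)) = hit p b (\<not> res p (s + b)) (hold D)"
  "covered p E a b e (hold D) = covered p E a b e D"
  "halves_ok p E a D D' = (if row_ok p E a (hold D) (hold D') (p - 2)
     then row_ok p E a (hold D') (hold D) (p - 2) else False)"
  by (simp_all add: hold_def halves_ok_def)

lemmas check_simps = check_def quadrant.simps half.simps hold_simps good_def search.simps
  listed.simps fallback_def covered.simps pair_ok_def row_ok.simps rows_ok.simps
  if_True if_False simp_thms arith_simps rel_simps numeral_One diff_numeral_special
  add_numeral_special less_irrefl diff_self zero_less_one

text \<open>\<open>fs\<close> tabulates an orthomorphism with value 0 at 0, and the three points are
  those over 0, 1 and \<open>z\<close>. Distinct entries and distinct differences
  \<open>v - i\<close> give the two injectivity conditions.\<close>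

lemma slopes_occur_table:
  fixes fs :: "int list" and z :: nat
  assumes p: "p = CARD('a::prime_card)" and len: "length fs = p" and dist: "distinct fs"
    and ran: "\<forall>v\<in>set fs. 0 \<le> v \<and> v < int p"
    and dif: "distinct (map (\<lambda>(i, v). (v - i) mod int p) (zip (0 # 1 # [2..int p - 1]) fs))"
    and z: "1 < z" "z < p" and f0: "fs ! 0 = 0" and f1: "fs ! 1 = c"
    and fb: "fs ! z mod int p = b * int z mod int p"
    and fa: "(fs ! z - c) mod int p = a * (int z - 1) mod int p"
  shows "slopes_occur (of_int a :: 'a mod_ring) (of_int b) (of_int c)"
proof -
  let ?f = "of_int :: int \<Rightarrow> 'a mod_ring"
  note iff = of_int_mod_ring_eq_iff[where 'a='a, folded p]
  have "[0..int p - 1] = 0 # 1 # [2..int p - 1]" using z by (simp add: upto_rec1)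
  note dif = dif[folded this]
  define g where "g u = ?f (fs ! nat (to_int_mod_ring u))" for u :: "'a mod_ring"
  have g: "g (of_nat i) = ?f (fs ! i)" if "i < p" for i
  proof -
    have "to_int_mod_ring (of_nat i :: 'a mod_ring) = int i"
      using that p unfolding of_nat_of_int_mod_ring by simp
    then show ?thesis unfolding g_def by simp
  qed
  have surj: "\<exists>i<p. u = of_nat i" for u :: "'a mod_ring" using surj_of_nat_mod_ring[of u] p by auto
  have "inj g"
  proof (rule injI)
    fix u v assume e: "g u = g v"
    obtain i j where i: "i < p" "u = of_nat i" and j: "j < p" "v = of_nat j" using surj by metis
    have "[fs ! i = fs ! j] (mod int p)" using e g i j iff by simp
    then have "fs ! i = fs ! j" using ran i(1) j(1) len by (simp add: cong_def)
    then show "u = v" using dist i j len by (simp add: nth_eq_iff_index_eq)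
  qed
  moreover have "inj (\<lambda>u. g u - u)"
  proof (rule injI)
    fix u v assume e: "g u - u = g v - v"
    obtain i j where i: "i < p" "u = of_nat i" and j: "j < p" "v = of_nat j" using surj by metis
    have "?f (fs ! i - int i) = ?f (fs ! j - int j)" using e g i j by simp
    then have "(fs ! i - int i) mod int p = (fs ! j - int j) mod int p" unfolding iff cong_def .
    moreover have "map (\<lambda>(i, v). (v - i) mod int p) (zip [0..int p - 1] fs) ! k = (fs ! k - int k) mod int p"
      if "k < p" for k using that len by (simp add: nth_upto)
    ultimately have "i = j" using nth_eq_iff_index_eq[OF dif, of i j] i j len by simp
    then show "u = v" using i j by simp
  qed
  ultimately have "orthomorphism g" unfolding orthomorphism_def ..
  moreover have "(0 :: 'a mod_ring) \<noteq> 1" by simp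
  moreover have "of_nat z \<noteq> (0 :: 'a mod_ring)" "of_nat z \<noteq> (1 :: 'a mod_ring)"
    using iff[of "int z" 0] iff[of "int z" 1] z by (auto simp: cong_def)
  moreover have "g 0 = 0" "g 1 = ?f c" "g (of_nat z) = ?f (fs ! z)"
    using g[of 0] g[of 1] g[of z] z f0 f1 by simp_all
  moreover have "?f (fs ! z) = ?f (b * int z)" "?f (fs ! z - c) = ?f (a * (int z - 1))"
    unfolding iff cong_def by (fact fb fa)+
  ultimately show ?thesis
    by (intro slopes_occurI[of g 0 1 "of_nat z"]) auto
qed

section \<open>Certificates and explicit orthomorphisms, prime by prime\<close>

lemma certificate_11:
  "certificate 11 [(2, 3, 7), (3, 2, 7), (3, 5, 8), (3, 5, 9), (3, 7, 8), (3, 7, 9)]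
     [(2, 6, 10), (3, 4, 5)]"
proof -
  \<comment> \<open>The range, the squares and the values of \<open>res\<close> are computed once,
    so that the check itself is table lookup. The same pattern serves every prime.\<close>
  note R = rng_def[of 11, simplified]
  note S = squares_def[of 11, simplified]
  note T = res_table[of 11, simplified R S, simplified]
  note T' = res_table_shift[of 11, simplified R S T, simplified T, simplified]
  show ?thesis unfolding certificate_def
    by (intro conjI, simp only: check_simps T T' R cong: if_weak_cong hold_cong) (simp_all add: R)
qed

lemma all_slopes_11:
  assumes "CARD('a::prime_card) = 11" shows "all_slopes TYPE('a mod_ring)"
proof -
  \<comment> \<open>The slopes force \<open>z = (c - a) / (b - a)\<close> modulo 11, here and in the
    other tables.\<close>
  have e0: "slopes_occur (of_int 2 :: 'a mod_ring) (of_int 3) (of_int 7)"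
    by (rule slopes_occur_table[where p = 11 and z = 5 and fs =
     "[0, 7, 6, 8, 2, 4, 3, 10, 9, 5, 1]"]) (simp_all add: assms)
  have e1: "slopes_occur (of_int 3 :: 'a mod_ring) (of_int 2) (of_int 7)"
    by (rule slopes_occur_table[where p = 11 and z = 7 and fs =
     "[0, 7, 5, 2, 8, 10, 4, 3, 9, 6, 1]"]) (simp_all add: assms)
  have e2: "slopes_occur (of_int 3 :: 'a mod_ring) (of_int 5) (of_int 8)"
    by (rule slopes_occur_table[where p = 11 and z = 8 and fs =
     "[0, 8, 5, 1, 6, 9, 3, 2, 7, 10, 4]"]) (simp_all add: assms)
  have e3: "slopes_occur (of_int 3 :: 'a mod_ring) (of_int 5) (of_int 9)"
    by (rule slopes_occur_table[where p = 11 and z = 3 and fs =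
     "[0, 9, 6, 4, 2, 1, 8, 10, 7, 3, 5]"]) (simp_all add: assms)
  have e4: "slopes_occur (of_int 3 :: 'a mod_ring) (of_int 7) (of_int 8)"
    by (rule slopes_occur_table[where p = 11 and z = 4 and fs =
     "[0, 8, 5, 2, 6, 3, 10, 1, 9, 4, 7]"]) (simp_all add: assms)
  have e5: "slopes_occur (of_int 3 :: 'a mod_ring) (of_int 7) (of_int 9)"
    by (rule slopes_occur_table[where p = 11 and z = 7 and fs =
     "[0, 9, 6, 4, 7, 10, 2, 5, 3, 8, 1]"]) (simp_all add: assms)
  show ?thesis
    by (rule all_slopes_certificate[OF certificate_11])
      (simp_all add: assms e0[simplified] e1[simplified] e2[simplified] e3[simplified] e4[simplified] e5[simplified])
qed

lemma certificate_13:
  "certificate 13 [(2, 4, 10), (4, 2, 10), (2, 7, 12), (3, 5, 6), (4, 7, 10), (4, 10, 12)]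
     [(2, 7, 12), (3, 9, 6), (4, 10, 4)]"
proof -
  note R = rng_def[of 13, simplified]
  note S = squares_def[of 13, simplified]
  note T = res_table[of 13, simplified R S, simplified]
  note T' = res_table_shift[of 13, simplified R S T, simplified T, simplified]
  show ?thesis unfolding certificate_def
    by (intro conjI, simp only: check_simps T T' R cong: if_weak_cong hold_cong) (simp_all add: R)
qed

lemma all_slopes_13:
  assumes "CARD('a::prime_card) = 13" shows "all_slopes TYPE('a mod_ring)"
proof -
  have e0: "slopes_occur (of_int 2 :: 'a mod_ring) (of_int 4) (of_int 10)"
    by (rule slopes_occur_table[where p = 13 and z = 4 and fs =
     "[0, 10, 8, 6, 3, 2, 1, 9, 12, 7, 11, 5, 4]"]) (simp_all add: assms)
  have e1: "slopes_occur (of_int 4 :: 'a mod_ring) (of_int 2) (of_int 10)"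
    by (rule slopes_occur_table[where p = 13 and z = 10 and fs =
     "[0, 10, 6, 4, 12, 3, 11, 9, 2, 8, 7, 1, 5]"]) (simp_all add: assms)
  have e2: "slopes_occur (of_int 2 :: 'a mod_ring) (of_int 7) (of_int 12)"
    by (rule slopes_occur_table[where p = 13 and z = 2 and fs =
     "[0, 12, 1, 7, 9, 2, 8, 10, 3, 5, 11, 4, 6]"]) (simp_all add: assms)
  have e3: "slopes_occur (of_int 3 :: 'a mod_ring) (of_int 5) (of_int 6)"
    by (rule slopes_occur_table[where p = 13 and z = 8 and fs =
     "[0, 6, 10, 2, 5, 7, 3, 11, 1, 12, 4, 9, 8]"]) (simp_all add: assms)
  have e4: "slopes_occur (of_int 4 :: 'a mod_ring) (of_int 7) (of_int 10)"
    by (rule slopes_occur_table[where p = 13 and z = 2 and fs =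
     "[0, 10, 1, 8, 7, 9, 3, 2, 6, 11, 4, 12, 5]"]) (simp_all add: assms)
  have e5: "slopes_occur (of_int 4 :: 'a mod_ring) (of_int 10) (of_int 12)"
    by (rule slopes_occur_table[where p = 13 and z = 10 and fs =
     "[0, 12, 4, 8, 10, 1, 7, 11, 5, 3, 9, 6, 2]"]) (simp_all add: assms)
  show ?thesis
    by (rule all_slopes_certificate[OF certificate_13])
      (simp_all add: assms e0[simplified] e1[simplified] e2[simplified] e3[simplified] e4[simplified] e5[simplified])
qed

lemma certificate_17:
  "certificate 17 [(2, 9, 16), (3, 8, 12)]
     [(2, 9, 16), (3, 6, 8), (4, 13, 11)]"
proof -
  note R = rng_def[of 17, simplified]
  note S = squares_def[of 17, simplified]
  note T = res_table[of 17, simplified R S, simplified]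
  note T' = res_table_shift[of 17, simplified R S T, simplified T, simplified]
  show ?thesis unfolding certificate_def
    by (intro conjI, simp only: check_simps T T' R cong: if_weak_cong hold_cong) (simp_all add: R)
qed

lemma all_slopes_17:
  assumes "CARD('a::prime_card) = 17" shows "all_slopes TYPE('a mod_ring)"
proof -
  have e0: "slopes_occur (of_int 2 :: 'a mod_ring) (of_int 9) (of_int 16)"
    by (rule slopes_occur_table[where p = 17 and z = 2 and fs =
     "[0, 16, 1, 6, 13, 10, 8, 15, 14, 4, 11, 5, 9, 3, 7, 2, 12]"]) (simp_all add: assms)
  have e1: "slopes_occur (of_int 3 :: 'a mod_ring) (of_int 8) (of_int 12)"
    by (rule slopes_occur_table[where p = 17 and z = 12 and fs =
     "[0, 12, 14, 1, 8, 7, 3, 16, 9, 15, 13, 2, 11, 6, 10, 5, 4]"]) (simp_all add: assms)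
  show ?thesis
    by (rule all_slopes_certificate[OF certificate_17])
      (simp_all add: assms e0[simplified] e1[simplified])
qed

lemma certificate_19:
  "certificate 19 []
     [(2, 10, 18), (3, 13, 9), (4, 5, 6), (8, 12, 8)]"
proof -
  note R = rng_def[of 19, simplified]
  note S = squares_def[of 19, simplified]
  note T = res_table[of 19, simplified R S, simplified]
  note T' = res_table_shift[of 19, simplified R S T, simplified T, simplified]
  show ?thesis unfolding certificate_def
    by (intro conjI, simp only: check_simps T T' R cong: if_weak_cong hold_cong) (simp_all add: R)
qed

lemma all_slopes_19:
  assumes "CARD('a::prime_card) = 19" shows "all_slopes TYPE('a mod_ring)"
  by (rule all_slopes_certificate[OF certificate_19]) (simp_all add: assms)

lemma certificate_23:
  "certificate 23 [(3, 11, 16)]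
     [(2, 12, 22), (3, 8, 11), (4, 6, 15), (5, 14, 17)]"
proof -
  note R = rng_def[of 23, simplified]
  note S = squares_def[of 23, simplified]
  note T = res_table[of 23, simplified R S, simplified]
  note T' = res_table_shift[of 23, simplified R S T, simplified T, simplified]
  show ?thesis unfolding certificate_def
    by (intro conjI, simp only: check_simps T T' R cong: if_weak_cong hold_cong) (simp_all add: R)
qed

lemma all_slopes_23:
  assumes "CARD('a::prime_card) = 23" shows "all_slopes TYPE('a mod_ring)"
proof -
  have e0: "slopes_occur (of_int 3 :: 'a mod_ring) (of_int 11) (of_int 16)"
    by (rule slopes_occur_table[where p = 23 and z = 16 and fs =
     "[0, 16, 5, 8, 2, 13, 7, 3, 18, 22, 21, 20, 14, 4, 9, 19, 15, 11, 1, 12, 17, 10, 6]"]) (simp_all add: assms)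
  show ?thesis
    by (rule all_slopes_certificate[OF certificate_23])
      (simp_all add: assms e0[simplified])
qed

text \<open>The exceptional triple is \<open>2, 1/2, -1\<close>, the orbit of harmonic cross-ratios.
  It is also exceptional for 13, 17, 31 and 41.\<close>

lemma certificate_29:
  "certificate 29 [(2, 15, 28)]
     [(2, 15, 28), (3, 10, 14), (4, 22, 19), (5, 6, 7), (9, 13, 18)]"
proof -
  note R = rng_def[of 29, simplified]
  note S = squares_def[of 29, simplified]
  note T = res_table[of 29, simplified R S, simplified]
  note T' = res_table_shift[of 29, simplified R S T, simplified T, simplified]
  show ?thesis unfolding certificate_def
    by (intro conjI, simp only: check_simps T T' R cong: if_weak_cong hold_cong) (simp_all add: R)
qed

lemma all_slopes_29:
  assumes "CARD('a::prime_card) = 29" shows "all_slopes TYPE('a mod_ring)"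
proof -
  have e0: "slopes_occur (of_int 2 :: 'a mod_ring) (of_int 15) (of_int 28)"
    by (rule slopes_occur_table[where p = 29 and z = 2 and fs =
     "[0, 28, 1, 12, 25, 6, 17, 2, 4, 21, 18, 15, 22, 16, 20, 8, 7, 5, 3, 24, 27, 10, 9, 13, 26, 19,
     23, 11, 14]"]) (simp_all add: assms)
  show ?thesis
    by (rule all_slopes_certificate[OF certificate_29])
      (simp_all add: assms e0[simplified])
qed

lemma certificate_31:
  "certificate 31 [(2, 16, 30)]
     [(2, 16, 30), (3, 21, 15), (4, 8, 10), (5, 25, 23), (6, 26, 6), (12, 13, 14)]"
proof -
  note R = rng_def[of 31, simplified]
  note S = squares_def[of 31, simplified]
  note T = res_table[of 31, simplified R S, simplified]
  note T' = res_table_shift[of 31, simplified R S T, simplified T, simplified]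
  show ?thesis unfolding certificate_def
    by (intro conjI, simp only: check_simps T T' R cong: if_weak_cong hold_cong) (simp_all add: R)
qed

lemma all_slopes_31:
  assumes "CARD('a::prime_card) = 31" shows "all_slopes TYPE('a mod_ring)"
proof -
  have e0: "slopes_occur (of_int 2 :: 'a mod_ring) (of_int 16) (of_int 30)"
    by (rule slopes_occur_table[where p = 31 and z = 2 and fs =
     "[0, 30, 1, 10, 19, 23, 25, 21, 24, 12, 16, 7, 4, 17, 3, 5, 26, 22, 11, 13, 28, 18, 2, 14, 6, 20,
     27, 29, 9, 15, 8]"]) (simp_all add: assms)
  show ?thesis
    by (rule all_slopes_certificate[OF certificate_31])
      (simp_all add: assms e0[simplified])
qed

lemma certificate_37:
  "certificate 37 []
     [(2, 19, 36), (3, 25, 18), (4, 28, 12), (5, 15, 9), (6, 31, 22), (8, 14, 21), (11, 27, 11)]"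
proof -
  note R = rng_def[of 37, simplified]
  note S = squares_def[of 37, simplified]
  note T = res_table[of 37, simplified R S, simplified]
  note T' = res_table_shift[of 37, simplified R S T, simplified T, simplified]
  show ?thesis unfolding certificate_def
    by (intro conjI, simp only: check_simps T T' R cong: if_weak_cong hold_cong) (simp_all add: R)
qed

lemma all_slopes_37:
  assumes "CARD('a::prime_card) = 37" shows "all_slopes TYPE('a mod_ring)"
  by (rule all_slopes_certificate[OF certificate_37]) (simp_all add: assms)

lemma certificate_41:
  "certificate 41 [(2, 21, 40)]
     [(2, 21, 40), (3, 14, 20), (4, 31, 27), (5, 33, 10), (6, 7, 8), (12, 24, 26), (13, 19, 17)]"
proof -
  note R = rng_def[of 41, simplified]
  note S = squares_def[of 41, simplified]
  note T = res_table[of 41, simplified R S, simplified]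
  note T' = res_table_shift[of 41, simplified R S T, simplified T, simplified]
  show ?thesis unfolding certificate_def
    by (intro conjI, simp only: check_simps T T' R cong: if_weak_cong hold_cong) (simp_all add: R)
qed

lemma all_slopes_41:
  assumes "CARD('a::prime_card) = 41" shows "all_slopes TYPE('a mod_ring)"
proof -
  have e0: "slopes_occur (of_int 2 :: 'a mod_ring) (of_int 21) (of_int 40)"
    by (rule slopes_occur_table[where p = 41 and z = 2 and fs =
     "[0, 40, 1, 38, 12, 37, 15, 36, 39, 13, 33, 29, 19, 6, 11, 27, 21, 3, 34, 8, 30, 24, 17, 25, 35,
     31, 2, 28, 20, 9, 4, 16, 10, 5, 7, 14, 32, 18, 22, 26, 23]"]) (simp_all add: assms)
  show ?thesis
    by (rule all_slopes_certificate[OF certificate_41])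
      (simp_all add: assms e0[simplified])
qed

text \<open>From here on no triple is exceptional: quadratic orthomorphisms and the symmetries
  settle them all.\<close>

lemma certificate_43:
  "certificate 43 []
     [(2, 22, 42), (3, 29, 21), (4, 11, 14), (5, 26, 32), (6, 36, 17), (7, 37, 7), (9, 24, 16), (10,
     13, 19)]"
proof -
  note R = rng_def[of 43, simplified]
  note S = squares_def[of 43, simplified]
  note T = res_table[of 43, simplified R S, simplified]
  note T' = res_table_shift[of 43, simplified R S T, simplified T, simplified]
  show ?thesis unfolding certificate_def
    by (intro conjI, simp only: check_simps T T' R cong: if_weak_cong hold_cong) (simp_all add: R)
qed

lemma all_slopes_43:
  assumes "CARD('a::prime_card) = 43" shows "all_slopes TYPE('a mod_ring)"
  by (rule all_slopes_certificate[OF certificate_43]) (simp_all add: assms)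

lemma certificate_47:
  "certificate 47 []
     [(2, 24, 46), (3, 16, 23), (4, 12, 31), (5, 19, 35), (6, 8, 28), (7, 27, 39), (10, 33, 26), (11,
     30, 14)]"
proof -
  note R = rng_def[of 47, simplified]
  note S = squares_def[of 47, simplified]
  note T = res_table[of 47, simplified R S, simplified]
  note T' = res_table_shift[of 47, simplified R S T, simplified T, simplified]
  show ?thesis unfolding certificate_def
    by (intro conjI, simp only: check_simps T T' R cong: if_weak_cong hold_cong) (simp_all add: R)
qed

lemma all_slopes_47:
  assumes "CARD('a::prime_card) = 47" shows "all_slopes TYPE('a mod_ring)"
  by (rule all_slopes_certificate[OF certificate_47]) (simp_all add: assms)

lemma certificate_53:
  "certificate 53 []
     [(2, 27, 52), (3, 18, 26), (4, 40, 35), (5, 32, 13), (6, 9, 21), (7, 38, 44), (8, 20, 15), (11,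
     29, 37), (12, 31, 24)]"
proof -
  note R = rng_def[of 53, simplified]
  note S = squares_def[of 53, simplified]
  note T = res_table[of 53, simplified R S, simplified]
  note T' = res_table_shift[of 53, simplified R S T, simplified T, simplified]
  show ?thesis unfolding certificate_def
    by (intro conjI, simp only: check_simps T T' R cong: if_weak_cong hold_cong) (simp_all add: R)
qed

lemma all_slopes_53:
  assumes "CARD('a::prime_card) = 53" shows "all_slopes TYPE('a mod_ring)"
  by (rule all_slopes_certificate[OF certificate_53]) (simp_all add: assms)

lemma certificate_59:
  "certificate 59 []
     [(2, 30, 58), (3, 20, 29), (4, 15, 39), (5, 12, 44), (6, 10, 47), (7, 17, 49), (8, 37, 42), (9,
     46, 22), (19, 28, 36), (25, 26, 27)]"
proof -
  note R = rng_def[of 59, simplified]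
  note S = squares_def[of 59, simplified]
  note T = res_table[of 59, simplified R S, simplified]
  note T' = res_table_shift[of 59, simplified R S T, simplified T, simplified]
  show ?thesis unfolding certificate_def
    by (intro conjI, simp only: check_simps T T' R cong: if_weak_cong hold_cong) (simp_all add: R)
qed

lemma all_slopes_59:
  assumes "CARD('a::prime_card) = 59" shows "all_slopes TYPE('a mod_ring)"
  by (rule all_slopes_certificate[OF certificate_59]) (simp_all add: assms)

lemma certificate_61:
  "certificate 61 []
     [(2, 31, 60), (3, 41, 30), (4, 46, 20), (5, 49, 15), (6, 51, 12), (7, 35, 10), (8, 23, 26), (9,
     34, 38), (14, 48, 14), (17, 18, 19), (22, 25, 29)]"
proof -
  note R = rng_def[of 61, simplified]
  note S = squares_def[of 61, simplified]
  note T = res_table[of 61, simplified R S, simplified]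
  note T' = res_table_shift[of 61, simplified R S T, simplified T, simplified]
  show ?thesis unfolding certificate_def
    by (intro conjI, simp only: check_simps T T' R cong: if_weak_cong hold_cong) (simp_all add: R)
qed

lemma all_slopes_61:
  assumes "CARD('a::prime_card) = 61" shows "all_slopes TYPE('a mod_ring)"
  by (rule all_slopes_certificate[OF certificate_61]) (simp_all add: assms)

lemma certificate_67:
  "certificate 67 []
     [(2, 34, 66), (3, 45, 33), (4, 17, 22), (5, 27, 50), (6, 56, 40), (7, 48, 11), (8, 42, 19), (9,
     15, 25), (10, 47, 52), (13, 31, 39), (14, 24, 36), (30, 38, 30)]"
proof -
  note R = rng_def[of 67, simplified]
  note S = squares_def[of 67, simplified]
  note T = res_table[of 67, simplified R S, simplified]
  note T' = res_table_shift[of 67, simplified R S T, simplified T, simplified]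
  show ?thesis unfolding certificate_def
    by (intro conjI, simp only: check_simps T T' R cong: if_weak_cong hold_cong) (simp_all add: R)
qed

lemma all_slopes_67:
  assumes "CARD('a::prime_card) = 67" shows "all_slopes TYPE('a mod_ring)"
  by (rule all_slopes_certificate[OF certificate_67]) (simp_all add: assms)

lemma certificate_71:
  "certificate 71 []
     [(2, 36, 70), (3, 24, 35), (4, 18, 47), (5, 57, 53), (6, 12, 14), (7, 61, 59), (8, 9, 10), (16,
     40, 52), (17, 46, 31), (21, 44, 39), (22, 42, 27), (23, 34, 29)]"
proof -
  note R = rng_def[of 71, simplified]
  note S = squares_def[of 71, simplified]
  note T = res_table[of 71, simplified R S, simplified]
  note T' = res_table_shift[of 71, simplified R S T, simplified T, simplified]
  show ?thesis unfolding certificate_def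
    by (intro conjI, simp only: check_simps T T' R cong: if_weak_cong hold_cong) (simp_all add: R)
qed

lemma all_slopes_71:
  assumes "CARD('a::prime_card) = 71" shows "all_slopes TYPE('a mod_ring)"
  by (rule all_slopes_certificate[OF certificate_71]) (simp_all add: assms)

lemma certificate_73:
  "certificate 73 []
     [(2, 37, 72), (3, 49, 36), (4, 55, 24), (5, 44, 18), (6, 61, 29), (7, 21, 12), (8, 64, 52), (9,
     65, 9), (11, 20, 51), (14, 47, 28), (15, 39, 26), (16, 32, 34), (17, 43, 41)]"
proof -
  note R = rng_def[of 73, simplified]
  note S = squares_def[of 73, simplified]
  note T = res_table[of 73, simplified R S, simplified]
  note T' = res_table_shift[of 73, simplified R S T, simplified T, simplified]
  show ?thesis unfolding certificate_def
    by (intro conjI, simp only: check_simps T T' R cong: if_weak_cong hold_cong) (simp_all add: R)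
qed

lemma all_slopes_73:
  assumes "CARD('a::prime_card) = 73" shows "all_slopes TYPE('a mod_ring)"
  by (rule all_slopes_certificate[OF certificate_73]) (simp_all add: assms)

lemma certificate_79:
  "certificate 79 []
     [(2, 40, 78), (3, 53, 39), (4, 20, 26), (5, 16, 59), (6, 66, 63), (7, 34, 13), (8, 10, 45), (9,
     44, 69), (12, 33, 43), (15, 58, 62), (19, 25, 57), (24, 56, 24), (28, 48, 38), (29, 30, 31)]"
proof -
  note R = rng_def[of 79, simplified]
  note S = squares_def[of 79, simplified]
  note T = res_table[of 79, simplified R S, simplified]
  note T' = res_table_shift[of 79, simplified R S T, simplified T, simplified]
  show ?thesis unfolding certificate_def
    by (intro conjI, simp only: check_simps T T' R cong: if_weak_cong hold_cong) (simp_all add: R)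
qed

lemma all_slopes_79:
  assumes "CARD('a::prime_card) = 79" shows "all_slopes TYPE('a mod_ring)"
  by (rule all_slopes_certificate[OF certificate_79]) (simp_all add: assms)

lemma certificate_83:
  "certificate 83 []
     [(2, 42, 82), (3, 28, 41), (4, 21, 55), (5, 50, 62), (6, 14, 33), (7, 12, 69), (8, 52, 71), (9,
     37, 31), (10, 25, 46), (11, 68, 58), (17, 44, 57), (18, 60, 39), (19, 35, 23), (20, 54, 48)]"
proof -
  note R = rng_def[of 83, simplified]
  note S = squares_def[of 83, simplified]
  note T = res_table[of 83, simplified R S, simplified]
  note T' = res_table_shift[of 83, simplified R S T, simplified T, simplified]
  show ?thesis unfolding certificate_def
    by (intro conjI, simp only: check_simps T T' R cong: if_weak_cong hold_cong) (simp_all add: R)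
qed

lemma all_slopes_83:
  assumes "CARD('a::prime_card) = 83" shows "all_slopes TYPE('a mod_ring)"
  by (rule all_slopes_certificate[OF certificate_83]) (simp_all add: assms)

lemma certificate_89:
  "certificate 89 []
     [(2, 45, 88), (3, 30, 44), (4, 67, 59), (5, 18, 22), (6, 15, 71), (7, 51, 74), (8, 78, 38), (9,
     10, 11), (13, 48, 37), (14, 70, 41), (17, 21, 50), (24, 26, 58), (25, 57, 63), (28, 35, 56),
     (29, 43, 54)]"
proof -
  note R = rng_def[of 89, simplified]
  note S = squares_def[of 89, simplified]
  note T = res_table[of 89, simplified R S, simplified]
  note T' = res_table_shift[of 89, simplified R S T, simplified T, simplified]
  show ?thesis unfolding certificate_def
    by (intro conjI, simp only: check_simps T T' R cong: if_weak_cong hold_cong) (simp_all add: R)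
qed

lemma all_slopes_89:
  assumes "CARD('a::prime_card) = 89" shows "all_slopes TYPE('a mod_ring)"
  by (rule all_slopes_certificate[OF certificate_89]) (simp_all add: assms)

lemma certificate_97:
  "certificate 97 []
     [(2, 49, 96), (3, 65, 48), (4, 73, 32), (5, 39, 24), (6, 81, 58), (7, 14, 16), (8, 85, 83), (9,
     54, 12), (10, 68, 43), (11, 53, 29), (18, 27, 57), (19, 46, 70), (20, 34, 51), (21, 37, 63),
     (22, 75, 60), (26, 56, 31), (36, 62, 36)]"
proof -
  note R = rng_def[of 97, simplified]
  note S = squares_def[of 97, simplified]
  note T = res_table[of 97, simplified R S, simplified]
  note T' = res_table_shift[of 97, simplified R S T, simplified T, simplified]
  show ?thesis unfolding certificate_def
    by (intro conjI, simp only: check_simps T T' R cong: if_weak_cong hold_cong) (simp_all add: R)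
qed

lemma all_slopes_97:
  assumes "CARD('a::prime_card) = 97" shows "all_slopes TYPE('a mod_ring)"
  by (rule all_slopes_certificate[OF certificate_97]) (simp_all add: assms)

lemma certificate_101:
  "certificate 101 []
     [(2, 51, 100), (3, 34, 50), (4, 76, 67), (5, 81, 25), (6, 17, 20), (7, 29, 84), (8, 38, 72), (9,
     45, 63), (10, 91, 56), (12, 59, 55), (13, 70, 42), (14, 65, 31), (15, 27, 36), (16, 19, 74),
     (22, 23, 24), (33, 49, 41), (40, 48, 44)]"
proof -
  note R = rng_def[of 101, simplified]
  note S = squares_def[of 101, simplified]
  note T = res_table[of 101, simplified R S, simplified]
  note T' = res_table_shift[of 101, simplified R S T, simplified T, simplified]
  show ?thesis unfolding certificate_def
    by (intro conjI, simp only: check_simps T T' R cong: if_weak_cong hold_cong) (simp_all add: R)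
qed

lemma all_slopes_101:
  assumes "CARD('a::prime_card) = 101" shows "all_slopes TYPE('a mod_ring)"
  by (rule all_slopes_certificate[OF certificate_101]) (simp_all add: assms)

lemma certificate_103:
  "certificate 103 []
     [(2, 52, 102), (3, 69, 51), (4, 26, 34), (5, 62, 77), (6, 86, 41), (7, 59, 17), (8, 13, 44), (9,
     23, 90), (10, 31, 80), (11, 75, 72), (12, 43, 28), (15, 55, 22), (16, 58, 48), (19, 38, 40),
     (20, 67, 65), (21, 54, 36), (25, 33, 30), (47, 57, 47)]"
proof -
  note R = rng_def[of 103, simplified]
  note S = squares_def[of 103, simplified]
  note T = res_table[of 103, simplified R S, simplified]
  note T' = res_table_shift[of 103, simplified R S T, simplified T, simplified]
  show ?thesis unfolding certificate_def
    by (intro conjI, simp only: check_simps T T' R cong: if_weak_cong hold_cong) (simp_all add: R)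
qed

lemma all_slopes_103:
  assumes "CARD('a::prime_card) = 103" shows "all_slopes TYPE('a mod_ring)"
  by (rule all_slopes_certificate[OF certificate_103]) (simp_all add: assms)

lemma certificate_107:
  "certificate 107 []
     [(2, 54, 106), (3, 36, 53), (4, 27, 71), (5, 43, 80), (6, 18, 64), (7, 46, 89), (8, 67, 61), (9,
     12, 40), (10, 75, 95), (11, 39, 32), (14, 23, 74), (15, 50, 84), (16, 87, 57), (17, 63, 20),
     (22, 73, 56), (25, 30, 49), (26, 70, 77), (29, 48, 42)]"
proof -
  note R = rng_def[of 107, simplified]
  note S = squares_def[of 107, simplified]
  note T = res_table[of 107, simplified R S, simplified]
  note T' = res_table_shift[of 107, simplified R S T, simplified T, simplified]
  show ?thesis unfolding certificate_def
    by (intro conjI, simp only: check_simps T T' R cong: if_weak_cong hold_cong) (simp_all add: R)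
qed

lemma all_slopes_107:
  assumes "CARD('a::prime_card) = 107" shows "all_slopes TYPE('a mod_ring)"
  by (rule all_slopes_certificate[OF certificate_107]) (simp_all add: assms)

lemma certificate_109:
  "certificate 109 []
     [(2, 55, 108), (3, 73, 54), (4, 82, 36), (5, 22, 27), (6, 91, 87), (7, 78, 18), (8, 41, 31), (9,
     97, 68), (10, 11, 12), (14, 39, 67), (15, 80, 70), (16, 75, 29), (17, 77, 34), (20, 60, 86),
     (21, 26, 49), (25, 48, 59), (38, 66, 53), (45, 63, 52), (46, 64, 46)]"
proof -
  note R = rng_def[of 109, simplified]
  note S = squares_def[of 109, simplified]
  note T = res_table[of 109, simplified R S, simplified]
  note T' = res_table_shift[of 109, simplified R S T, simplified T, simplified]
  show ?thesis unfolding certificate_def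
    by (intro conjI, simp only: check_simps T T' R cong: if_weak_cong hold_cong) (simp_all add: R)
qed

lemma all_slopes_109:
  assumes "CARD('a::prime_card) = 109" shows "all_slopes TYPE('a mod_ring)"
  by (rule all_slopes_certificate[OF certificate_109]) (simp_all add: assms)

lemma certificate_113:
  "certificate 113 []
     [(2, 57, 112), (3, 38, 56), (4, 85, 75), (5, 68, 28), (6, 19, 45), (7, 97, 94), (8, 99, 16), (9,
     88, 14), (10, 34, 25), (11, 72, 79), (12, 66, 41), (13, 87, 47), (18, 44, 93), (22, 36, 43),
     (23, 59, 77), (24, 33, 54), (30, 49, 74), (31, 62, 64), (32, 53, 51)]"
proof -
  note R = rng_def[of 113, simplified]
  note S = squares_def[of 113, simplified]
  note T = res_table[of 113, simplified R S, simplified]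
  note T' = res_table_shift[of 113, simplified R S T, simplified T, simplified]
  show ?thesis unfolding certificate_def
    by (intro conjI, simp only: check_simps T T' R cong: if_weak_cong hold_cong) (simp_all add: R)
qed

lemma all_slopes_113:
  assumes "CARD('a::prime_card) = 113" shows "all_slopes TYPE('a mod_ring)"
  by (rule all_slopes_certificate[OF certificate_113]) (simp_all add: assms)

lemma certificate_127:
  "certificate 127 []
     [(2, 64, 126), (3, 85, 63), (4, 32, 42), (5, 51, 95), (6, 106, 76), (7, 109, 21), (8, 16, 18),
     (9, 113, 111), (10, 89, 14), (11, 104, 38), (12, 53, 23), (13, 88, 74), (20, 108, 20), (25, 61,
     37), (26, 44, 66), (27, 80, 83), (28, 59, 47), (29, 92, 68), (30, 72, 35), (31, 41, 55), (34,
     71, 50), (46, 58, 79)]"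
proof -
  note R = rng_def[of 127, simplified]
  note S = squares_def[of 127, simplified]
  note T = res_table[of 127, simplified R S, simplified]
  note T' = res_table_shift[of 127, simplified R S T, simplified T, simplified]
  show ?thesis unfolding certificate_def
    by (intro conjI, simp only: check_simps T T' R cong: if_weak_cong hold_cong) (simp_all add: R)
qed

lemma all_slopes_127:
  assumes "CARD('a::prime_card) = 127" shows "all_slopes TYPE('a mod_ring)"
  by (rule all_slopes_certificate[OF certificate_127]) (simp_all add: assms)

lemma certificate_131:
  "certificate 131 []
     [(2, 66, 130), (3, 44, 65), (4, 33, 87), (5, 105, 98), (6, 22, 26), (7, 75, 109), (8, 82, 56),
     (9, 102, 49), (10, 118, 29), (11, 12, 13), (15, 35, 28), (16, 41, 96), (17, 54, 90), (18, 51,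
     77), (19, 69, 80), (20, 59, 62), (21, 25, 72), (24, 71, 74), (31, 93, 48), (32, 86, 38), (37,
     85, 40), (43, 64, 53)]"
proof -
  note R = rng_def[of 131, simplified]
  note S = squares_def[of 131, simplified]
  note T = res_table[of 131, simplified R S, simplified]
  note T' = res_table_shift[of 131, simplified R S T, simplified T, simplified]
  show ?thesis unfolding certificate_def
    by (intro conjI, simp only: check_simps T T' R cong: if_weak_cong hold_cong) (simp_all add: R)
qed

lemma all_slopes_131:
  assumes "CARD('a::prime_card) = 131" shows "all_slopes TYPE('a mod_ring)"
  by (rule all_slopes_certificate[OF certificate_131]) (simp_all add: assms)

lemma certificate_137:
  "certificate 137 []
     [(2, 69, 136), (3, 46, 68), (4, 103, 91), (5, 55, 34), (6, 23, 82), (7, 98, 114), (8, 120, 39),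
     (9, 61, 17), (10, 96, 76), (11, 25, 41), (12, 80, 112), (13, 116, 57), (14, 49, 21), (15, 64,
     88), (16, 60, 73), (19, 101, 38), (20, 48, 36), (27, 66, 79), (28, 93, 71), (29, 52, 44), (30,
     32, 85), (31, 84, 105), (43, 51, 75)]"
proof -
  note R = rng_def[of 137, simplified]
  note S = squares_def[of 137, simplified]
  note T = res_table[of 137, simplified R S, simplified]
  note T' = res_table_shift[of 137, simplified R S T, simplified T, simplified]
  show ?thesis unfolding certificate_def
    by (intro conjI, simp only: check_simps T T' R cong: if_weak_cong hold_cong) (simp_all add: R)
qed

lemma all_slopes_137:
  assumes "CARD('a::prime_card) = 137" shows "all_slopes TYPE('a mod_ring)"
  by (rule all_slopes_certificate[OF certificate_137]) (simp_all add: assms)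

lemma certificate_139:
  "certificate 139 []
     [(2, 70, 138), (3, 93, 69), (4, 35, 46), (5, 28, 104), (6, 116, 111), (7, 20, 23), (8, 87, 119),
     (9, 31, 52), (10, 14, 108), (11, 38, 125), (12, 58, 101), (13, 107, 81), (16, 113, 37), (17, 90,
     26), (18, 85, 49), (19, 22, 54), (25, 89, 110), (34, 45, 80), (40, 73, 57), (41, 78, 66), (42,
     96, 61), (43, 97, 43), (48, 84, 68), (63, 64, 65)]"
proof -
  note R = rng_def[of 139, simplified]
  note S = squares_def[of 139, simplified]
  note T = res_table[of 139, simplified R S, simplified]
  note T' = res_table_shift[of 139, simplified R S T, simplified T, simplified]
  show ?thesis unfolding certificate_def
    by (intro conjI, simp only: check_simps T T' R cong: if_weak_cong hold_cong) (simp_all add: R)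
qed

lemma all_slopes_139:
  assumes "CARD('a::prime_card) = 139" shows "all_slopes TYPE('a mod_ring)"
  by (rule all_slopes_certificate[OF certificate_139]) (simp_all add: assms)

section \<open>All primes above 7\<close>

lemma primes_between_7_and_149:
  fixes p :: nat
  assumes "prime p" "7 < p" "p < 149"
  shows "p \<in> set [11, 13, 17, 19, 23, 29, 31, 37, 41, 43, 47, 53, 59, 61, 67, 71, 73, 79, 83, 89,
    97, 101, 103, 107, 109, 113, 127, 131, 137, 139]"
proof -
  \<comment> \<open>Sieving by the primes up to 11 suffices, since
    \<open>13^2 > 149\<close>.\<close>
  let ?P = "\<lambda>n. \<not> 2 dvd n \<and> \<not> 3 dvd n \<and> \<not> 5 dvd n \<and> \<not> 7 dvd n \<and> (n = 11 \<or> \<not> 11 dvd n)"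
  have "\<not> q dvd p" if "q > 1" "q \<noteq> p" for q
    using that assms(1) prime_nat_iff by auto
  from this[of 2] this[of 3] this[of 5] this[of 7] this[of 11] have "?P p" using assms(2) by auto
  then have "p \<in> set (filter ?P [8..<149])" using assms(2,3) unfolding set_filter set_upt by (intro CollectI conjI) simp_all
  moreover have "filter ?P [8..<149] = [11, 13, 17, 19, 23, 29, 31, 37, 41, 43, 47, 53, 59, 61, 67,
    71, 73, 79, 83, 89, 97, 101, 103, 107, 109, 113, 127, 131, 137, 139]" by simp
  ultimately show ?thesis by (simp only:)
qed

lemma all_slopes_prime:
  assumes "CARD('a::prime_card) > 7" shows "all_slopes TYPE('a mod_ring)"
proof (cases "CARD('a) \<ge> 149")
  case True
  then show ?thesis using prime_card[where 'a='a] by (intro all_slopes_large) simp_all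
next
  case False
  then have "CARD('a) \<in> set [11, 13, 17, 19, 23, 29, 31, 37, 41, 43, 47, 53, 59, 61, 67, 71, 73, 79, 83,
    89, 97, 101, 103, 107, 109, 113, 127, 131, 137, 139]"
    using assms prime_card[where 'a='a] by (intro primes_between_7_and_149) simp_all
  then show ?thesis
    using all_slopes_11[where 'a='a] all_slopes_13[where 'a='a] all_slopes_17[where 'a='a]
      all_slopes_19[where 'a='a] all_slopes_23[where 'a='a] all_slopes_29[where 'a='a]
      all_slopes_31[where 'a='a] all_slopes_37[where 'a='a] all_slopes_41[where 'a='a]
      all_slopes_43[where 'a='a] all_slopes_47[where 'a='a] all_slopes_53[where 'a='a]
      all_slopes_59[where 'a='a] all_slopes_61[where 'a='a] all_slopes_67[where 'a='a]
      all_slopes_71[where 'a='a] all_slopes_73[where 'a='a] all_slopes_79[where 'a='a]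
      all_slopes_83[where 'a='a] all_slopes_89[where 'a='a] all_slopes_97[where 'a='a]
      all_slopes_101[where 'a='a] all_slopes_103[where 'a='a] all_slopes_107[where 'a='a]
      all_slopes_109[where 'a='a] all_slopes_113[where 'a='a] all_slopes_127[where 'a='a]
      all_slopes_131[where 'a='a] all_slopes_137[where 'a='a] all_slopes_139[where 'a='a]
    by auto
qed

section \<open>The latin square\<close>

text \<open>Integers and congruences replace the field here, so that \<open>p\<close> is a variable
  and no type of that cardinality is mentioned.\<close>

definition orthomorphisms_extend :: "nat \<Rightarrow> bool" where
  "orthomorphisms_extend p \<longleftrightarrow> (\<forall>x1 x2 x3 y1 y2 y3 :: int.
     \<not> [x1 = x2] (mod int p) \<and> \<not> [x1 = x3] (mod int p) \<and> \<not> [x2 = x3] (mod int p) \<and>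
     \<not> [y1 = y2] (mod int p) \<and> \<not> [y1 = y3] (mod int p) \<and> \<not> [y2 = y3] (mod int p) \<and>
     \<not> [y1 - x1 = y2 - x2] (mod int p) \<and> \<not> [y1 - x1 = y3 - x3] (mod int p) \<and> \<not> [y2 - x2 = y3 - x3] (mod int p) \<longrightarrow>
     (\<exists>f :: int \<Rightarrow> int. (\<forall>i j. [f i = f j] (mod int p) \<longleftrightarrow> [i = j] (mod int p)) \<and>
        (\<forall>i j. [f i - i = f j - j] (mod int p) \<longrightarrow> [i = j] (mod int p)) \<and>
        [f x1 = y1] (mod int p) \<and> [f x2 = y2] (mod int p) \<and> [f x3 = y3] (mod int p)))"

lemma orthomorphisms_extend_card:
  assumes "all_slopes TYPE('a::prime_card mod_ring)"
  shows "orthomorphisms_extend (CARD('a))"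
  unfolding orthomorphisms_extend_def
proof (intro allI impI, elim conjE)
  fix x1 x2 x3 y1 y2 y3 :: int
  let ?f = "of_int :: int \<Rightarrow> 'a mod_ring" and ?p = "int (CARD('a))"
  note iff = of_int_mod_ring_eq_iff[where 'a='a, symmetric]
  assume *: "\<not> [x1 = x2] (mod ?p)" "\<not> [x1 = x3] (mod ?p)" "\<not> [x2 = x3] (mod ?p)"
     "\<not> [y1 = y2] (mod ?p)" "\<not> [y1 = y3] (mod ?p)" "\<not> [y2 = y3] (mod ?p)"
     "\<not> [y1 - x1 = y2 - x2] (mod ?p)" "\<not> [y1 - x1 = y3 - x3] (mod ?p)" "\<not> [y2 - x2 = y3 - x3] (mod ?p)"
  obtain f where f: "orthomorphism f" "f (?f x1) = ?f y1" "f (?f x2) = ?f y2" "f (?f x3) = ?f y3"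
    using orthomorphism_extension[OF assms, of "?f x1" "?f x2" "?f x3" "?f y1" "?f y2" "?f y3"] *
    unfolding iff of_int_diff by blast
  have i: "inj f" "inj (\<lambda>u. f u - u)" using f(1) by (auto simp: orthomorphism_def)
  define g where "g k = to_int_mod_ring (f (?f k))" for k
  have g: "?f (g k) = f (?f k)" for k unfolding g_def by (simp add: of_int_of_int_mod_ring)
  show "\<exists>f :: int \<Rightarrow> int. (\<forall>i j. [f i = f j] (mod ?p) \<longleftrightarrow> [i = j] (mod ?p)) \<and>
        (\<forall>i j. [f i - i = f j - j] (mod ?p) \<longrightarrow> [i = j] (mod ?p)) \<and>
        [f x1 = y1] (mod ?p) \<and> [f x2 = y2] (mod ?p) \<and> [f x3 = y3] (mod ?p)"
  proof (intro exI[of _ g] conjI allI impI)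
    show "[g k = g l] (mod ?p) \<longleftrightarrow> [k = l] (mod ?p)" for k l
      unfolding iff g by (rule inj_eq[OF i(1)])
    show "[k = l] (mod ?p)" if "[g k - k = g l - l] (mod ?p)" for k l
      using that injD[OF i(2), of "?f k" "?f l"] unfolding iff of_int_diff g by blast
    show "[g x1 = y1] (mod ?p)" "[g x2 = y2] (mod ?p)" "[g x3 = y3] (mod ?p)"
      unfolding iff g using f by auto
  qed
qed

text \<open>
  The field of order \<open>p\<close> is needed as a type, but a type cannot depend on the variable \<open>p\<close>. A type is
  therefore built for one fixed prime that is a counterexample if there is one; proving the claim for
  this prime proves it for all.
\<close>

definition test_prime :: nat where
  "test_prime = (if \<exists>p. prime p \<and> p > 7 \<and> \<not> orthomorphisms_extend p
     then SOME p. prime p \<and> p > 7 \<and> \<not> orthomorphisms_extend p else 11)"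

lemma test_prime: "prime test_prime" "test_prime > 7"
  "prime p \<Longrightarrow> p > 7 \<Longrightarrow> orthomorphisms_extend test_prime \<Longrightarrow> orthomorphisms_extend p"
proof -
  let ?B = "\<lambda>p. prime p \<and> p > 7 \<and> \<not> orthomorphisms_extend p"
  have s: "?B test_prime" if "\<exists>p. ?B p" using someI_ex[OF that] that unfolding test_prime_def by simp
  have e: "test_prime = 11" if "\<nexists>p. ?B p" unfolding test_prime_def by (rule if_not_P[OF that])
  \<comment> \<open>If there is no counterexample, the default 11 must itself be a prime above
    7.\<close>
  have "{2..<11::nat} = {2, 3, 4, 5, 6, 7, 8, 9, 10}" by auto
  then have "prime (11::nat)" by (simp add: prime_nat_iff')
  then show "prime test_prime" "test_prime > 7" using s e by (cases "\<exists>p. ?B p"; force)+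
  show "prime p \<Longrightarrow> p > 7 \<Longrightarrow> orthomorphisms_extend test_prime \<Longrightarrow> orthomorphisms_extend p"
    using s by blast
qed

typedef test_index = "{..<test_prime}"
  using test_prime(2) by (intro exI[of _ 0]) simp

lemma card_test_index: "CARD(test_index) = test_prime"
  using type_definition.card[OF type_definition_test_index] by simp

instance test_index :: prime_card
  by standard (simp add: card_test_index test_prime(1))

text \<open>\<open>L\<close> puts \<open>i + f d\<close> into the cell \<open>(i, i + d)\<close>.
  Rows are governed by the injectivity of \<open>f\<close>, columns by that of
  \<open>f d - d\<close>, and a diagonal shift preserves the differences that define
  \<open>L\<close>.\<close>

lemma latin_square_of_orthomorphism:
  fixes p :: nat and f :: "int \<Rightarrow> int"
  assumes p: "p > 0" and f: "\<And>i j. [f i = f j] (mod int p) \<longleftrightarrow> [i = j] (mod int p)"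
    and fd: "\<And>i j. [f i - i = f j - j] (mod int p) \<longrightarrow> [i = j] (mod int p)"
  defines "L \<equiv> {(i, j, k). i < p \<and> j < p \<and> k < p \<and> [int k - int i = f (int j - int i)] (mod int p)}"
  shows "latin_square p L" "diagonally_cyclic p L"
    "i < p \<Longrightarrow> [f (int c) = int s] (mod int p) \<Longrightarrow> (i, (c + i) mod p, (s + i) mod p) \<in> L"
proof -
  have eq: "k = l" if "[int k = int l] (mod int p)" "k < p" "l < p" for k l
    using that by (simp add: cong_int_iff cong_def)
  have "(r = r' \<and> c = c' \<longrightarrow> u = u') \<and> (r = r' \<and> u = u' \<longrightarrow> c = c') \<and> (c = c' \<and> u = u' \<longrightarrow> r = r')"
    if "(r, c, u) \<in> L" "(r', c', u') \<in> L" for r c u r' c' u'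
  proof -
    have l: "r < p" "c < p" "u < p" "[int u - int r = f (int c - int r)] (mod int p)"
      and l': "r' < p" "c' < p" "u' < p" "[int u' - int r' = f (int c' - int r')] (mod int p)"
      using that unfolding L_def by auto
    have "u = u'" if "r = r'" "c = c'"
    proof -
      have "[int u - int r = int u' - int r] (mod int p)" using l(4) l'(4) that by (metis cong_sym cong_trans)
      then show ?thesis using eq l l' by (simp add: cong_iff_dvd_diff)
    qed
    moreover have "c = c'" if "r = r'" "u = u'"
    proof -
      have "[f (int c - int r) = f (int c' - int r)] (mod int p)" using l(4) l'(4) that by (metis cong_sym cong_trans)
      then have "[int c - int r = int c' - int r] (mod int p)" by (simp only: f)
      then show ?thesis using eq l l' by (simp add: cong_iff_dvd_diff)
    qed
    moreover have "r = r'" if "c = c'" "u = u'"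
    proof -
      \<comment> \<open>For a fixed column and symbol, \<open>u - c\<close> is the value of
        \<open>f d - d\<close> at \<open>d = c - r\<close>.\<close>
      have "[(int u - int r) - (int c - int r) = f (int c - int r) - (int c - int r)] (mod int p)"
        using l(4) by (intro cong_diff cong_refl)
      moreover have "[(int u - int r') - (int c - int r') = f (int c - int r') - (int c - int r')] (mod int p)"
        using l'(4) that by (intro cong_diff cong_refl) auto
      ultimately have "[f (int c - int r) - (int c - int r) = f (int c - int r') - (int c - int r')] (mod int p)"
        by (simp add: cong_def)
      then have "[int c - int r = int c - int r'] (mod int p)" by (rule fd[rule_format])
      then have "[int r = int r'] (mod int p)" by (simp add: cong_iff_dvd_diff dvd_diff_commute)
      then show ?thesis using eq l l' by simp
    qed
    ultimately show ?thesis by blast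
  qed
  then have "\<forall>(r, c, u)\<in>L. \<forall>(r', c', u')\<in>L.
      (r = r' \<and> c = c' \<longrightarrow> u = u') \<and> (r = r' \<and> u = u' \<longrightarrow> c = c') \<and> (c = c' \<and> u = u' \<longrightarrow> r = r')"
    by fast
  then have "partial_latin_square p L"
    unfolding partial_latin_square_def by (auto simp: L_def)
  moreover have "\<exists>u. (r, t, u) \<in> L" if "r < p" "t < p" for r t
  proof -
    define u where "u = nat ((int r + f (int t - int r)) mod int p)"
    have iu: "int u = (int r + f (int t - int r)) mod int p" unfolding u_def using p by simp
    have "u < p" using iu p by (metis of_nat_0_less_iff of_nat_less_iff pos_mod_bound)
    moreover have "[int u - int r = f (int t - int r)] (mod int p)" unfolding iu cong_def by (simp add: mod_diff_left_eq)
    ultimately show ?thesis unfolding L_def using that by blast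
  qed
  ultimately show "latin_square p L" unfolding latin_square_def by blast
  have md: "[int (n mod p) = int n] (mod int p)" for n by (simp add: cong_def zmod_int)
  show "diagonally_cyclic p L"
    unfolding diagonally_cyclic_def
  proof (clarify)
    fix i j k assume l: "(i, j, k) \<in> L"
    have "[int ((k + 1) mod p) - int ((i + 1) mod p) = int (k + 1) - int (i + 1)] (mod int p)"
      by (intro cong_diff md)
    also have "int (k + 1) - int (i + 1) = int k - int i" by simp
    also have "[int k - int i = f (int j - int i)] (mod int p)" using l unfolding L_def by simp
    also have "[f (int j - int i) = f (int ((j + 1) mod p) - int ((i + 1) mod p))] (mod int p)"
    proof -
      have "[int ((j + 1) mod p) - int ((i + 1) mod p) = int (j + 1) - int (i + 1)] (mod int p)"
        by (intro cong_diff md)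
      then show ?thesis unfolding f by (simp add: cong_sym)
    qed
    finally show "((i + 1) mod p, (j + 1) mod p, (k + 1) mod p) \<in> L" unfolding L_def using p by simp
  qed
  assume i: "i < p" and fc: "[f (int c) = int s] (mod int p)"
  have "[int ((s + i) mod p) - int i = int (s + i) - int i] (mod int p)" by (intro cong_diff md cong_refl)
  also have "int (s + i) - int i = int s" by simp
  also have "[int s = f (int c)] (mod int p)" using fc by (rule cong_sym)
  also have "[f (int c) = f (int ((c + i) mod p) - int i)] (mod int p)"
  proof -
    have "[int ((c + i) mod p) - int i = int (c + i) - int i] (mod int p)" by (intro cong_diff md cong_refl)
    then show ?thesis unfolding f by (simp add: cong_sym)
  qed
  finally show "(i, (c + i) mod p, (s + i) mod p) \<in> L" unfolding L_def using i p by simp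
qed

text \<open>If the differences agreed, rows \<open>c'\<close> and \<open>c\<close> would both
  contain the symbol \<open>s + c'\<close> in the column \<open>c + c'\<close>, modulo
  \<open>p\<close>.\<close>

lemma cyclic_differences_distinct:
  fixes c c' s s' p :: nat
  assumes pls: "partial_latin_square p P" and l: "c < p" "c' < p" "c \<noteq> c'"
    and 1: "\<And>i. i < p \<Longrightarrow> (i, (c + i) mod p, (s + i) mod p) \<in> P"
    and 2: "\<And>i. i < p \<Longrightarrow> (i, (c' + i) mod p, (s' + i) mod p) \<in> P"
  shows "\<not> [int s - int c = int s' - int c'] (mod int p)"
proof
  assume "[int s - int c = int s' - int c'] (mod int p)"
  then have "[(int s - int c) + (int c + int c') = (int s' - int c') + (int c + int c')] (mod int p)"
    by (intro cong_add cong_refl)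
  then have "[int (s + c') = int (s' + c)] (mod int p)" by (simp add: algebra_simps)
  then have m: "(s + c') mod p = (s' + c) mod p" by (simp only: cong_int_iff) (simp add: cong_def)
  have "(c', (c + c') mod p, (s + c') mod p) \<in> P" using 1[OF l(2)] .
  moreover have "(c, (c + c') mod p, (s + c') mod p) \<in> P" using 2[OF l(1)] m by (simp add: add.commute)
  ultimately have "c' = c" using pls unfolding partial_latin_square_def by fastforce
  then show False using l by simp
qed

theorem theorem8:
  fixes p c c' c'' s s' s'' :: nat
    and P :: "(nat \<times> nat \<times> nat) set"
  assumes "prime p" and "p > 7"
    and "c < p" and "c' < p" and "c'' < p"
    and "s < p" and "s' < p" and "s'' < p"
    and "c \<noteq> c'" and "c \<noteq> c''" and "c' \<noteq> c''"
    and "s \<noteq> s'" and "s \<noteq> s''" and "s' \<noteq> s''"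
    and "P = {(i, (c + i) mod p, (s + i) mod p) | i. i < p}
           \<union> {(i, (c' + i) mod p, (s' + i) mod p) | i. i < p}
           \<union> {(i, (c'' + i) mod p, (s'' + i) mod p) | i. i < p}"
    and "partial_latin_square p P"
  shows "\<exists>L. latin_square p L \<and> diagonally_cyclic p L \<and> P \<subseteq> L"
proof -
  \<comment> \<open>The field is available as a type for \<open>test_prime\<close>; the choice of
    that prime carries the claim over to \<open>p\<close>.\<close>
  have "orthomorphisms_extend test_prime"
    using orthomorphisms_extend_card[where 'a=test_index] all_slopes_prime[where 'a=test_index]
    by (simp add: card_test_index test_prime(1,2))
  then have ext: "orthomorphisms_extend p" 
    by (rule test_prime(3)[OF \<open>prime p\<close> \<open>p > 7\<close>])
  note P = \<open>P = _\<close> and pls = \<open>partial_latin_square p P\<close>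
  have ncong: "\<not> [int k = int l] (mod int p)" if "k < p" "l < p" "k \<noteq> l" for k l
    using that by (simp add: cong_int_iff cong_def)
  have in_P: "i < p \<Longrightarrow> (i, (c + i) mod p, (s + i) mod p) \<in> P"
    "i < p \<Longrightarrow> (i, (c' + i) mod p, (s' + i) mod p) \<in> P"
    "i < p \<Longrightarrow> (i, (c'' + i) mod p, (s'' + i) mod p) \<in> P" for i unfolding P by auto
  \<comment> \<open>The third requirement on the points, distinct values of \<open>y - x\<close>, is
    the column condition of \<open>P\<close>.\<close>
  have d: "\<not> [int s - int c = int s' - int c'] (mod int p)" "\<not> [int s - int c = int s'' - int c''] (mod int p)"
    "\<not> [int s' - int c' = int s'' - int c''] (mod int p)"
    using cyclic_differences_distinct[OF pls] in_P assms by blast+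
  obtain f :: "int \<Rightarrow> int" where f: "\<And>i j. [f i = f j] (mod int p) \<longleftrightarrow> [i = j] (mod int p)"
    "\<And>i j. [f i - i = f j - j] (mod int p) \<longrightarrow> [i = j] (mod int p)"
    "[f (int c) = int s] (mod int p)" "[f (int c') = int s'] (mod int p)" "[f (int c'') = int s''] (mod int p)"
    using ext[unfolded orthomorphisms_extend_def, rule_format, of "int c" "int c'" "int c''" "int s" "int s'" "int s''"]
      d ncong assms by blast
  have "p > 0" using \<open>p > 7\<close> by simp
  note L = latin_square_of_orthomorphism[OF this f(1,2)]
  show ?thesis
    using L(1,2) L(3)[OF _ f(3)] L(3)[OF _ f(4)] L(3)[OF _ f(5)] unfolding P by blast
qed

end
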